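(* Suppose that twisted field data $(W,\phi_W^i\ (i\in I),\psi_W^a\ (a\in A),L_W(0),L_W(-1),g,\mathcal L_g,\mathcal S_g,\mathcal N_g)$ as in the context satisfy Properties 1--5 and 7 of the context. Then weak commutativity of the twisted fields holds: for $i,j\in I$ there exists $M_{ij}\in\mathbb Z_+$ such that $$(x_1-x_2)^{M_{ij}}\phi_W^i(x_1)\phi_W^j(x_2)=(x_1-x_2)^{M_{ij}}(-1)^{|\phi^i||\phi^j|}\phi_W^j(x_2)\phi_W^i(x_1).$$
   Context: $\mathbb N=\{0,1,2,\dots\}$. $V$ is a grading-restricted vertex superalgebra: a $\frac12\mathbb Z\times\mathbb Z_2$-graded complex vector space (weight $\mathrm{wt}$, fermion number $|\cdot|$) $V=\coprod_n V_{(n)}$ with $\dim V_{(n)}<\infty$, $V_{(n)}=0$ for $n$ sufficiently negative, an even vacuum $\mathbf 1\in V_{(0)}$, an even map $Y_V:V\otimes V\to V((x))$, operators $L_V(0)$ (equal to $n$ on $V_{(n)}$) and $L_V(-1)$, satisfying the vacuum and creation properties, the super Jacobi identity, $[L_V(0),Y_V(v,x)]=x\frac{d}{dx}Y_V(v,x)+Y_V(L_V(0)v,x)$ and $\frac{d}{dx}Y_V(v,x)=Y_V(L_V(-1)v,x)=[L_V(-1),Y_V(v,x)]$. $g$ is an automorphism of $V$ (bijection preserving gradings, $\mathbf 1$, $Y_V$, commuting with $L_V(-1)$). $P_V=\{\alpha\in\mathbb C:0\le\Re\alpha<1,\ e^{2\pi i\alpha}\text{ is an eigenvalue of }g\}$,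 $V^{[\alpha]}$ is the generalized $e^{2\pi i\alpha}$-eigenspace, $V=\coprod_{\alpha\in P_V}V^{[\alpha]}$, $g=e^{2\pi i\mathcal L_g}$ with $\mathcal L_g=\mathcal S_g+\mathcal N_g$, $\mathcal S_g=\alpha$ on $V^{[\alpha]}$ and $\mathcal N_g$ (locally) nilpotent. Generating fields of $V$: $\phi^i(x)=Y_V(\phi^i_{-1}\mathbf 1,x)=\sum_{n\in\mathbb Z}\phi^i_nx^{-n-1}$, $i\in I$, generate $V$ (i.e. the $\phi^{i_1}_{m_1}\cdots\phi^{i_l}_{m_l}\mathbf 1$ span $V$); each $\phi^i_{-1}\mathbf 1$ is homogeneous of weight $\mathrm{wt}\,\phi^i$ and fermion number $|\phi^i|$, lies in $V^{[\alpha^i]}$, $\alpha^i\in P_V$, and $\mathcal N_g\phi^i_{-1}\mathbf 1$ is $0$ or equals $\phi^{\mathcal N_g(i)}_{-1}\mathbf 1$ for some $\mathcal N_g(i)\in I$. A field whose index $\mathcal N_g(i)$ is undefined is $0$. Expansions: $(x_1-x_2)^\beta$, $\log(x_1-x_2)$ are expanded in nonnegative powers of $x_2$; $(-x_2+x_1)^\beta$, $\log(-x_2+x_1)$ in nonnegative powers of $x_1$, with $(-x_2)^\beta=e^{\pi i\beta}x_2^\beta$, $\log(-x_2)=\log x_2+\pi i$. Twisted field data: (a) a $\mathbb C\times\mathbb Z_2\times\mathbb C/\mathbb Z$-graded space $W=\coprod W_{[n]}^{s;[\alpha]}$ with $W_{[n]}=0$ for $\Re n$ sufficiently negative; $P_W$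 the set of $\alpha$, $0\le\Re\alpha<1$, occurring as $g$-weights; (b) linear maps $\phi_W^i(x):W\to x^{-\alpha^i}W((x))[\log x]$, $\phi_W^i(x)w=\sum_{k\in\mathbb N}\sum_{n\in\alpha^i+\mathbb Z}(\phi_W^i)_{n,k}w\,x^{-n-1}(\log x)^k$, $i\in I$, with branches $\phi_W^{i;p}(z)$, $p\in\mathbb Z$, obtained by $x^n\mapsto e^{nl_p(z)}$, $\log x\mapsto l_p(z)=\log|z|+i\arg z+2\pi ip$, $0\le\arg z<2\pi$; (c) linear maps $\psi_W^a$, $a\in A$, with $\psi_W^a(x)v=\sum_{k\in\mathbb N}\sum_{n\in\alpha+\mathbb Z}(\psi_W^a)_{n,k}v\,x^{-n-1}(\log x)^k\in x^{-\alpha}W((x))[\log x]$ for $v\in V^{[\alpha]}$; (d) operators $L_W(0),L_W(-1)$ on $W$; (e) an action of $g=e^{2\pi i\mathcal L_g}$ on $W$, $\mathcal L_g=\mathcal S_g+\mathcal N_g$ (semisimple and nilpotent parts). Properties: 1. $L_W(0)=L_W(0)_S+L_W(0)_N$ (semisimple, nilpotent); $[L_W(0),\phi^i_W(x)]=x\frac{d}{dx}\phi^i_W(x)+(\mathrm{wt}\,\phi^i)\phi^i_W(x)$; for $a\in A$ there is $\mathrm{wt}\,\psi_W^a\in\mathbb C$ and, when $L_W(0)_N\psi_W^a(x)\ne0$, $L_W(0)_N(a)\in A$ with $L_W(0)\psi_W^a(x)-\psi_W^a(x)L_V(0)=x\frac{d}{dx}\psi_W^a(x)+(\mathrm{wt}\,\psi_W^a)\psi_W^a(x)+\psi_W^{L_W(0)_N(a)}(x)$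 (last term $0$ when $L_W(0)_N\psi_W^a(x)=0$). 2. $[L_W(-1),\phi_W^i(x)]=\frac{d}{dx}\phi_W^i(x)$, $L_W(-1)\psi_W^a(x)-\psi_W^a(x)L_V(-1)=\frac{d}{dx}\psi_W^a(x)$. 3. $\psi_W^a(x)\mathbf 1\in W[[x]]$ with constant term homogeneous in weight, fermion number, $g$-weight. 4. $W$ is spanned by the $(\phi_W^{i_1})_{n_1,l_1}\cdots(\phi_W^{i_k})_{n_k,l_k}(\psi_W^a)_{n,l}v$, $v\in V$. 5. (i) $g\phi_W^{i;p+1}(z)g^{-1}=\phi_W^{i;p}(z)$; (ii) $\phi_W^i(x)=x^{-\mathcal N_g}(\phi_W^i)_0(x)x^{\mathcal N_g}$, $\psi_W^a(x)=(\psi_W^a)_0(x)x^{-\mathcal N_g}$, subscript $0$ denoting the constant term in $\log x$; (iii) $e^{2\pi i\mathcal S_g}\phi_W^i(z)e^{-2\pi i\mathcal S_g}=e^{2\pi i\alpha^i}\phi_W^i(z)$, $[\mathcal N_g,\phi_W^i(z)]=\phi_W^{\mathcal N_g(i)}(z)$; (iv) for $a\in A$ there is $\alpha^a\in P_W$ with $(\psi_W^a)_{n,0}\mathbf 1$, $n\in-\mathbb N-1$, generalized eigenvectors of $g$ with eigenvalue $e^{2\pi i\alpha^a}$. 7. For $i\in I,a\in A$ there is $M_{ia}\in\mathbb Z_+$ with $$(x_1-x_2)^{\alpha^i+M_{ia}}(x_1-x_2)^{\mathcal N_g}\phi_W^i(x_1)(x_1-x_2)^{-\mathcal N_g}\psi_W^a(x_2)=(-1)^{|\phi^i||\psi^a|}(-x_2+x_1)^{\alpha^i+M_{ia}}\psi_W^a(x_2)(-x_2+x_1)^{\mathcal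 N_g}\phi^i(x_1)(-x_2+x_1)^{-\mathcal N_g}$$ ($|\psi^a|$ is the fermion number of $(\psi_W^a)_{-1,0}\mathbf 1$; on the right $\phi^i(x_1)$ is the field of $V$). *)

theory Defs
  imports
    "HOL-Analysis.Analysis"
    "HOL-Computational_Algebra.Formal_Laurent_Series"
    "HOL-Library.Z2"
begin

section \<open>Linear algebra\<close>

text \<open>A complex vector space is a type together with a scalar multiplication \<open>sc\<close> satisfying the
  library predicate \<^const>\<open>vector_space\<close>.\<close>

definition direct_sum ::
    "(complex \<Rightarrow> 'v \<Rightarrow> 'v) \<Rightarrow> 'j set \<Rightarrow> ('j \<Rightarrow> 'v::ab_group_add set) \<Rightarrow> bool" where
  "direct_sum sc J U \<longleftrightarrow>
     (\<forall>j\<in>J. module.subspace sc (U j)) \<and>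
     (\<forall>v. \<exists>!f. (\<forall>j\<in>J. f j \<in> U j) \<and> (\<forall>j. j \<notin> J \<longrightarrow> f j = 0) \<and>
               finite {j. f j \<noteq> 0} \<and> v = (\<Sum>j | f j \<noteq> 0. f j))"

definition semisimple_op :: "(complex \<Rightarrow> 'v \<Rightarrow> 'v::ab_group_add) \<Rightarrow> ('v \<Rightarrow> 'v) \<Rightarrow> bool" where
  "semisimple_op sc S \<longleftrightarrow>
     Vector_Spaces.linear sc sc S \<and> module.span sc {v. \<exists>a. S v = sc a v} = UNIV"

definition loc_nilpotent_op :: "(complex \<Rightarrow> 'v \<Rightarrow> 'v::ab_group_add) \<Rightarrow> ('v \<Rightarrow> 'v) \<Rightarrow> bool" where
  "loc_nilpotent_op sc N \<longleftrightarrow>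
     Vector_Spaces.linear sc sc N \<and> (\<forall>v. \<exists>k. (N ^^ k) v = 0)"

definition jordan_parts ::
    "(complex \<Rightarrow> 'v \<Rightarrow> 'v::ab_group_add) \<Rightarrow> ('v \<Rightarrow> 'v) \<Rightarrow> ('v \<Rightarrow> 'v) \<Rightarrow> ('v \<Rightarrow> 'v) \<Rightarrow> bool" where
  "jordan_parts sc L S N \<longleftrightarrow>
     semisimple_op sc S \<and> loc_nilpotent_op sc N \<and> S \<circ> N = N \<circ> S \<and> (\<forall>v. L v = S v + N v)"

definition gen_eigenspace ::
    "(complex \<Rightarrow> 'v \<Rightarrow> 'v::ab_group_add) \<Rightarrow> ('v \<Rightarrow> 'v) \<Rightarrow> complex \<Rightarrow> 'v set" where
  "gen_eigenspace sc g c = {v. \<exists>k. ((\<lambda>u. g u - sc c u) ^^ k) v = 0}"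

text \<open>\<open>e\<^sup>c\<^sup>S\<close> for semisimple \<open>S\<close>, and \<open>e\<^sup>c\<^sup>N\<close> for locally nilpotent \<open>N\<close>.\<close>

definition ss_exp ::
    "(complex \<Rightarrow> 'v \<Rightarrow> 'v::ab_group_add) \<Rightarrow> complex \<Rightarrow> ('v \<Rightarrow> 'v) \<Rightarrow> 'v \<Rightarrow> 'v" where
  "ss_exp sc c S =
     (THE E. Vector_Spaces.linear sc sc E \<and> (\<forall>a v. S v = sc a v \<longrightarrow> E v = sc (exp (c * a)) v))"

definition nil_exp ::
    "(complex \<Rightarrow> 'v \<Rightarrow> 'v::ab_group_add) \<Rightarrow> complex \<Rightarrow> ('v \<Rightarrow> 'v) \<Rightarrow> 'v \<Rightarrow> 'v" where
  "nil_exp sc c N v = (\<Sum>k | (N ^^ k) v \<noteq> 0. sc (c ^ k / fact k) ((N ^^ k) v))"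

section \<open>Formal series\<close>

text \<open>A formal series is the function assigning to a monomial its coefficient.  Monomials form an
  additive monoid: \<open>(r, k)\<close> is \<open>x\<^sup>r (log x)\<^sup>k\<close>, and \<open>(m\<^sub>1, m\<^sub>2)\<close> is the product of
  the monomial \<open>m\<^sub>1\<close> in \<open>x\<^sub>1\<close> and the monomial \<open>m\<^sub>2\<close> in \<open>x\<^sub>2\<close>.
  A map \<open>A :: 'v \<Rightarrow> 'm \<Rightarrow> 'w\<close> is an operator-valued series: \<open>A v m\<close> is its coefficient at \<open>m\<close>
  applied to \<open>v\<close>.  The index conventions \<open>x\<^sup>-\<^sup>n\<^sup>-\<^sup>1\<close> are translated by \<open>r = - n - 1\<close>.\<close>

type_synonym mono1 = "complex \<times> nat"
type_synonym mono2 = "mono1 \<times> mono1"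

text \<open>Products of series.  The sums are over the nonzero contributions only; in all products formed
  below there are finitely many of these, because of the truncation conditions and the
  direction of the expansions.  (An infinite family of contributions would be assigned \<open>0\<close>.)\<close>

definition op_comp :: "('u \<Rightarrow> 'm::plus \<Rightarrow> 'w::comm_monoid_add) \<Rightarrow> ('v \<Rightarrow> 'm \<Rightarrow> 'u) \<Rightarrow> 'v \<Rightarrow> 'm \<Rightarrow> 'w"
    (infixr "\<odot>" 75) where
  "(A \<odot> B) v m = (\<Sum>(p, q) \<in> {(p, q). p + q = m \<and> A (B v q) p \<noteq> 0}. A (B v q) p)"

definition ser_mult :: "('m::plus \<Rightarrow> complex) \<Rightarrow> ('m \<Rightarrow> complex) \<Rightarrow> 'm \<Rightarrow> complex" where
  "ser_mult f h m = (\<Sum>(p, q) \<in> {(p, q). p + q = m \<and> f p * h q \<noteq> 0}. f p * h q)"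

primrec ser_pow :: "('m::{plus,zero} \<Rightarrow> complex) \<Rightarrow> nat \<Rightarrow> 'm \<Rightarrow> complex" where
  "ser_pow f 0 = (\<lambda>m. if m = 0 then 1 else 0)"
| "ser_pow f (Suc k) = ser_mult f (ser_pow f k)"

definition scalar_ser ::
    "(complex \<Rightarrow> 'w \<Rightarrow> 'w) \<Rightarrow> ('m \<Rightarrow> complex) \<Rightarrow> 'w \<Rightarrow> 'm \<Rightarrow> 'w::ab_group_add" where
  "scalar_ser sc f w m = sc (f m) w"

definition op_scale ::
    "(complex \<Rightarrow> 'w \<Rightarrow> 'w) \<Rightarrow> complex \<Rightarrow> ('v \<Rightarrow> 'm \<Rightarrow> 'w) \<Rightarrow> 'v \<Rightarrow> 'm \<Rightarrow> 'w::ab_group_add" where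
  "op_scale sc c A v m = sc c (A v m)"

definition in_x1 :: "('v \<Rightarrow> mono1 \<Rightarrow> 'w::zero) \<Rightarrow> 'v \<Rightarrow> mono2 \<Rightarrow> 'w" where
  "in_x1 A v = (\<lambda>(m1, m2). if m2 = 0 then A v m1 else 0)"

definition in_x2 :: "('v \<Rightarrow> mono1 \<Rightarrow> 'w::zero) \<Rightarrow> 'v \<Rightarrow> mono2 \<Rightarrow> 'w" where
  "in_x2 A v = (\<lambda>(m1, m2). if m1 = 0 then A v m2 else 0)"

text \<open>\<open>y\<^sup>N\<close> as the sum of \<open>(log y)\<^sup>k N\<^sup>k / k!\<close>, where \<open>l\<close> is the series \<open>log y\<close>.\<close>

definition nil_pow ::
    "(complex \<Rightarrow> 'v \<Rightarrow> 'v) \<Rightarrow> ('m::{plus,zero} \<Rightarrow> complex) \<Rightarrow> ('v \<Rightarrow> 'v) \<Rightarrow> 'v \<Rightarrow> 'm \<Rightarrow> 'v::ab_group_add"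
  where
  "nil_pow sc l N v m = (\<Sum>k | (N ^^ k) v \<noteq> 0. sc (ser_pow l k m / fact k) ((N ^^ k) v))"

definition log_x :: "mono1 \<Rightarrow> complex" where
  "log_x m = (if m = (0, 1) then 1 else 0)"

text \<open>\<open>(x\<^sub>1 - x\<^sub>2)\<^sup>b\<close> and \<open>log (x\<^sub>1 - x\<^sub>2)\<close>, expanded in nonnegative powers of \<open>x\<^sub>2\<close>.\<close>

definition pow_x1_x2 :: "complex \<Rightarrow> mono2 \<Rightarrow> complex" where
  "pow_x1_x2 b = (\<lambda>((r, k), (s, l)).
     if k = 0 \<and> l = 0 \<and> s \<in> \<nat> \<and> r = b - s
     then (let m = nat \<lfloor>Re s\<rfloor> in (- 1) ^ m * (b gchoose m)) else 0)"

definition log_x1_x2 :: "mono2 \<Rightarrow> complex" where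
  "log_x1_x2 = (\<lambda>((r, k), (s, l)).
     if r = 0 \<and> k = 1 \<and> s = 0 \<and> l = 0 then 1
     else if k = 0 \<and> l = 0 \<and> s \<in> \<nat> \<and> s \<noteq> 0 \<and> r = - s then - 1 / s else 0)"

text \<open>\<open>(- x\<^sub>2 + x\<^sub>1)\<^sup>b\<close> and \<open>log (- x\<^sub>2 + x\<^sub>1)\<close>, expanded in nonnegative powers of \<open>x\<^sub>1\<close>,
  with \<open>(- x\<^sub>2)\<^sup>b = e\<^sup>\<pi>\<^sup>i\<^sup>b x\<^sub>2\<^sup>b\<close> and \<open>log (- x\<^sub>2) = log x\<^sub>2 + \<pi>i\<close>.\<close>

definition pow_mx2_x1 :: "complex \<Rightarrow> mono2 \<Rightarrow> complex" where
  "pow_mx2_x1 b = (\<lambda>((r, k), (s, l)).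
     if k = 0 \<and> l = 0 \<and> r \<in> \<nat> \<and> s = b - r
     then (let m = nat \<lfloor>Re r\<rfloor> in exp (of_real pi * \<i> * (b - r)) * (b gchoose m)) else 0)"

definition log_mx2_x1 :: "mono2 \<Rightarrow> complex" where
  "log_mx2_x1 = (\<lambda>((r, k), (s, l)).
     if r = 0 \<and> k = 0 \<and> s = 0 \<and> l = 1 then 1
     else if r = 0 \<and> k = 0 \<and> s = 0 \<and> l = 0 then of_real pi * \<i>
     else if k = 0 \<and> l = 0 \<and> r \<in> \<nat> \<and> r \<noteq> 0 \<and> s = - r then - 1 / r else 0)"

definition ser_deriv ::
    "(complex \<Rightarrow> 'w \<Rightarrow> 'w) \<Rightarrow> (mono1 \<Rightarrow> 'w) \<Rightarrow> mono1 \<Rightarrow> 'w::ab_group_add" where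
  "ser_deriv sc F = (\<lambda>(r, k). sc (r + 1) (F (r + 1, k)) + sc (of_nat (k + 1)) (F (r + 1, k + 1)))"

definition ser_xderiv ::
    "(complex \<Rightarrow> 'w \<Rightarrow> 'w) \<Rightarrow> (mono1 \<Rightarrow> 'w) \<Rightarrow> mono1 \<Rightarrow> 'w::ab_group_add" where
  "ser_xderiv sc F = (\<lambda>(r, k). sc r (F (r, k)) + sc (of_nat (k + 1)) (F (r, k + 1)))"

text \<open>\<open>F \<in> x\<^sup>-\<^sup>a W((x))[log x]\<close>.\<close>

definition log_laurent :: "complex \<Rightarrow> (mono1 \<Rightarrow> 'w::zero) \<Rightarrow> bool" where
  "log_laurent a F \<longleftrightarrow>
     (\<forall>r k. F (r, k) \<noteq> 0 \<longrightarrow> r + a \<in> \<int>) \<and>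
     (\<exists>R. \<forall>r k. Re r < R \<longrightarrow> F (r, k) = 0) \<and>
     (\<exists>K. \<forall>r k. K < k \<longrightarrow> F (r, k) = 0)"

definition log_const_term :: "('v \<Rightarrow> mono1 \<Rightarrow> 'w::zero) \<Rightarrow> 'v \<Rightarrow> mono1 \<Rightarrow> 'w" where
  "log_const_term A v = (\<lambda>(r, k). if k = 0 then A v (r, 0) else 0)"

definition log_branch :: "int \<Rightarrow> complex \<Rightarrow> complex" where
  "log_branch p z = of_real (ln (norm z)) + \<i> * of_real (Arg2pi z) + 2 * of_real pi * \<i> * of_int p"

text \<open>The substitution \<open>x\<^sup>r \<mapsto> e\<^bsup>r l\<^esup>\<close>, \<open>log x \<mapsto> l\<close> with \<open>l = log_branch p z\<close>.
  The result is an infinite formal sum of vectors, kept as the family of its summands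
  indexed by the exponent \<open>r\<close>; operators on the vector space act on it summand by summand.\<close>

definition branch ::
    "(complex \<Rightarrow> 'w \<Rightarrow> 'w) \<Rightarrow> int \<Rightarrow> complex \<Rightarrow> (mono1 \<Rightarrow> 'w) \<Rightarrow> complex \<Rightarrow> 'w::ab_group_add" where
  "branch sc p z F r =
     (\<Sum>k | F (r, k) \<noteq> 0. sc (exp (r * log_branch p z) * log_branch p z ^ k) (F (r, k)))"

section \<open>Grading-restricted vertex superalgebras and automorphisms\<close>

text \<open>\<open>vhom V n s\<close> is the subspace of weight \<open>n\<close> and fermion number \<open>s\<close>.\<close>

record (overloaded) ('v::zero) vertex_superalgebra =
  vscale :: "complex \<Rightarrow> 'v \<Rightarrow> 'v"
  vhom :: "complex \<Rightarrow> bit \<Rightarrow> 'v set"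
  vacuum :: 'v
  vertex_op :: "'v \<Rightarrow> 'v \<Rightarrow> 'v fls"
  LV0 :: "'v \<Rightarrow> 'v"
  LVm1 :: "'v \<Rightarrow> 'v"

definition koszul :: "bit \<Rightarrow> bit \<Rightarrow> complex" where
  "koszul s t = (if s * t = 0 then 1 else - 1)"

definition half_ints :: "complex set" where
  "half_ints = {n. 2 * n \<in> \<int>}"

definition vmode :: "('v::ab_group_add) vertex_superalgebra \<Rightarrow> 'v \<Rightarrow> int \<Rightarrow> 'v \<Rightarrow> 'v" where
  "vmode V u n v = fls_nth (vertex_op V u v) (- n - 1)"

definition vfield :: "('v::ab_group_add) vertex_superalgebra \<Rightarrow> 'v \<Rightarrow> 'v \<Rightarrow> mono1 \<Rightarrow> 'v" where
  "vfield V u v = (\<lambda>(r, k). if k = 0 \<and> r \<in> \<int> then fls_nth (vertex_op V u v) \<lfloor>Re r\<rfloor> else 0)"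

definition weight_space :: "('v::ab_group_add) vertex_superalgebra \<Rightarrow> complex \<Rightarrow> 'v set" where
  "weight_space V n = module.span (vscale V) (\<Union>s. vhom V n s)"

definition parity_space :: "('v::ab_group_add) vertex_superalgebra \<Rightarrow> bit \<Rightarrow> 'v set" where
  "parity_space V s = module.span (vscale V) (\<Union>n\<in>half_ints. vhom V n s)"

text \<open>The Jacobi identity below is the coefficient of \<open>x\<^sub>0\<^sup>-\<^sup>l\<^sup>-\<^sup>1 x\<^sub>1\<^sup>-\<^sup>m\<^sup>-\<^sup>1 x\<^sub>2\<^sup>-\<^sup>n\<^sup>-\<^sup>1\<close>
  in its delta-function form
  \<open>x\<^sub>0\<^sup>-\<^sup>1 \<delta>((x\<^sub>1 - x\<^sub>2)/x\<^sub>0) Y(u,x\<^sub>1) Y(v,x\<^sub>2)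
    - (-1)\<^bsup>|u||v|\<^esup> x\<^sub>0\<^sup>-\<^sup>1 \<delta>((x\<^sub>2 - x\<^sub>1)/(- x\<^sub>0)) Y(v,x\<^sub>2) Y(u,x\<^sub>1)
    = x\<^sub>2\<^sup>-\<^sup>1 \<delta>((x\<^sub>1 - x\<^sub>0)/x\<^sub>2) Y(Y(u,x\<^sub>0)v, x\<^sub>2)\<close>.
  All three sums have finitely many nonzero terms.\<close>

definition jacobi_identity :: "('v::ab_group_add) vertex_superalgebra \<Rightarrow> bool" where
  "jacobi_identity V \<longleftrightarrow>
    (\<forall>s t. \<forall>u\<in>parity_space V s. \<forall>v\<in>parity_space V t. \<forall>w. \<forall>l m n :: int.
       (let P = (\<lambda>i. vscale V ((- 1) ^ i * (of_int l gchoose i))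
                       (vmode V u (m + l - int i) (vmode V v (n + int i) w)));
            Q = (\<lambda>i. vscale V ((- 1) powi l * koszul s t * (- 1) ^ i * (of_int l gchoose i))
                       (vmode V v (n + l - int i) (vmode V u (m + int i) w)));
            R = (\<lambda>i. vscale V (of_int m gchoose i)
                       (vmode V (vmode V u (l + int i) v) (m + n - int i) w))
        in (\<Sum>i | P i \<noteq> 0. P i) - (\<Sum>i | Q i \<noteq> 0. Q i) = (\<Sum>i | R i \<noteq> 0. R i)))"

definition grading_restricted_vertex_superalgebra ::
    "('v::ab_group_add) vertex_superalgebra \<Rightarrow> bool" where
  "grading_restricted_vertex_superalgebra V \<longleftrightarrow>
     vector_space (vscale V) \<and>
     direct_sum (vscale V) (half_ints \<times> UNIV) (\<lambda>(n, s). vhom V n s) \<and>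
     (\<forall>n\<in>half_ints. \<exists>B. finite B \<and> weight_space V n \<subseteq> module.span (vscale V) B) \<and>
     (\<exists>R. \<forall>n\<in>half_ints. Re n < R \<longrightarrow> weight_space V n = {0}) \<and>
     vacuum V \<in> vhom V 0 0 \<and>
     (\<forall>n v. Vector_Spaces.linear (vscale V) (vscale V) (\<lambda>u. vmode V u n v)) \<and>
     (\<forall>u n. Vector_Spaces.linear (vscale V) (vscale V) (vmode V u n)) \<and>
     (\<forall>s t n. \<forall>u\<in>parity_space V s. \<forall>v\<in>parity_space V t. vmode V u n v \<in> parity_space V (s + t)) \<and>
     Vector_Spaces.linear (vscale V) (vscale V) (LV0 V) \<and>
     Vector_Spaces.linear (vscale V) (vscale V) (LVm1 V) \<and>
     (\<forall>n\<in>half_ints. \<forall>v\<in>weight_space V n. LV0 V v = vscale V n v) \<and>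
     (\<forall>n v. vmode V (vacuum V) n v = (if n = - 1 then v else 0)) \<and>
     (\<forall>u. vmode V u (- 1) (vacuum V) = u \<and> (\<forall>n\<ge>0. vmode V u n (vacuum V) = 0)) \<and>
     jacobi_identity V \<and>
     (\<forall>u v m. LV0 V (vfield V u v m) - vfield V u (LV0 V v) m
        = ser_xderiv (vscale V) (vfield V u v) m + vfield V (LV0 V u) v m) \<and>
     (\<forall>u v m. ser_deriv (vscale V) (vfield V u v) m = vfield V (LVm1 V u) v m) \<and>
     (\<forall>u v m. ser_deriv (vscale V) (vfield V u v) m
        = LVm1 V (vfield V u v m) - vfield V u (LVm1 V v) m)"

text \<open>An operator \<open>g\<close> with \<open>g = e\<^sup>2\<^sup>\<pi>\<^sup>i\<^sup>L\<close>, \<open>L = S + N\<close>.\<close>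

record 'v g_action =
  gop :: "'v \<Rightarrow> 'v"
  Lg :: "'v \<Rightarrow> 'v"
  Sg :: "'v \<Rightarrow> 'v"
  Ng :: "'v \<Rightarrow> 'v"

definition exp_of_log :: "(complex \<Rightarrow> 'v \<Rightarrow> 'v::ab_group_add) \<Rightarrow> 'v g_action \<Rightarrow> bool" where
  "exp_of_log sc g \<longleftrightarrow>
     jordan_parts sc (Lg g) (Sg g) (Ng g) \<and>
     gop g = ss_exp sc (2 * of_real pi * \<i>) (Sg g) \<circ> nil_exp sc (2 * of_real pi * \<i>) (Ng g)"

definition vsa_automorphism :: "('v::ab_group_add) vertex_superalgebra \<Rightarrow> ('v \<Rightarrow> 'v) \<Rightarrow> bool" where
  "vsa_automorphism V g \<longleftrightarrow>
     Vector_Spaces.linear (vscale V) (vscale V) g \<and> bij g \<and>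
     (\<forall>n\<in>half_ints. \<forall>s. g ` vhom V n s = vhom V n s) \<and>
     g (vacuum V) = vacuum V \<and>
     (\<forall>u n v. g (vmode V u n v) = vmode V (g u) n (g v)) \<and>
     g \<circ> LVm1 V = LVm1 V \<circ> g"

definition PV :: "('v::ab_group_add) vertex_superalgebra \<Rightarrow> 'v g_action \<Rightarrow> complex set" where
  "PV V g = {a. 0 \<le> Re a \<and> Re a < 1 \<and>
                (\<exists>v. v \<noteq> 0 \<and> gop g v = vscale V (exp (2 * of_real pi * \<i> * a)) v)}"

definition Vg :: "('v::ab_group_add) vertex_superalgebra \<Rightarrow> 'v g_action \<Rightarrow> complex \<Rightarrow> 'v set" where
  "Vg V g a = gen_eigenspace (vscale V) (gop g) (exp (2 * of_real pi * \<i> * a))"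

definition automorphism_with_log ::
    "('v::ab_group_add) vertex_superalgebra \<Rightarrow> 'v g_action \<Rightarrow> bool" where
  "automorphism_with_log V g \<longleftrightarrow>
     vsa_automorphism V (gop g) \<and>
     direct_sum (vscale V) (PV V g) (Vg V g) \<and>
     exp_of_log (vscale V) g \<and>
     (\<forall>a\<in>PV V g. \<forall>v\<in>Vg V g a. Sg g v = vscale V a v)"

section \<open>Generating fields\<close>

text \<open>\<open>gvec G i\<close> is the vector \<open>\<phi>\<^sup>i\<^sub>-\<^sub>1 \<one>\<close>; \<open>Nidx G i = None\<close> means that the index \<open>N\<^sub>g(i)\<close> is
  undefined.\<close>

record ('i, 'v) gen_fields =
  gidx :: "'i set"
  gvec :: "'i \<Rightarrow> 'v"
  gwt :: "'i \<Rightarrow> complex"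
  gpar :: "'i \<Rightarrow> bit"
  galpha :: "'i \<Rightarrow> complex"
  Nidx :: "'i \<Rightarrow> 'i option"

definition opt_field :: "('j \<Rightarrow> 'v \<Rightarrow> 'm \<Rightarrow> 'w::zero) \<Rightarrow> 'j option \<Rightarrow> 'v \<Rightarrow> 'm \<Rightarrow> 'w" where
  "opt_field f j = (case j of None \<Rightarrow> (\<lambda>_ _. 0) | Some j' \<Rightarrow> f j')"

inductive_set generated_vectors ::
    "('v::ab_group_add) vertex_superalgebra \<Rightarrow> ('i, 'v) gen_fields \<Rightarrow> 'v set"
  for V G where
  "vacuum V \<in> generated_vectors V G"
| "v \<in> generated_vectors V G \<Longrightarrow> i \<in> gidx G \<Longrightarrow> vmode V (gvec G i) m v \<in> generated_vectors V G"

definition generating_fields ::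
    "('v::ab_group_add) vertex_superalgebra \<Rightarrow> 'v g_action \<Rightarrow> ('i, 'v) gen_fields \<Rightarrow> bool" where
  "generating_fields V g G \<longleftrightarrow>
     module.span (vscale V) (generated_vectors V G) = UNIV \<and>
     (\<forall>i\<in>gidx G.
        gwt G i \<in> half_ints \<and> gvec G i \<in> vhom V (gwt G i) (gpar G i) \<and>
        galpha G i \<in> PV V g \<and> gvec G i \<in> Vg V g (galpha G i) \<and>
        (case Nidx G i of
           None \<Rightarrow> Ng g (gvec G i) = 0
         | Some j \<Rightarrow> Ng g (gvec G i) \<noteq> 0 \<and> j \<in> gidx G \<and> Ng g (gvec G i) = gvec G j))"

section \<open>Twisted field data\<close>

text \<open>\<open>whom T n s a\<close> is the subspace of weight \<open>n\<close>, fermion number \<open>s\<close> and \<open>g\<close>-weight \<open>a\<close>, where an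
  element of \<open>\<complex>/\<int>\<close> is given by its representative \<open>a\<close> with \<open>0 \<le> Re a < 1\<close>.\<close>

record ('i, 'a, 'v, 'w) twisted_fields =
  wscale :: "complex \<Rightarrow> 'w \<Rightarrow> 'w"
  whom :: "complex \<Rightarrow> bit \<Rightarrow> complex \<Rightarrow> 'w set"
  phi :: "'i \<Rightarrow> 'w \<Rightarrow> mono1 \<Rightarrow> 'w"
  aidx :: "'a set"
  psi :: "'a \<Rightarrow> 'v \<Rightarrow> mono1 \<Rightarrow> 'w"
  psipar :: "'a \<Rightarrow> bit"
  LW0 :: "'w \<Rightarrow> 'w"
  LWm1 :: "'w \<Rightarrow> 'w"
  gact :: "'w g_action"

text \<open>In \<open>twisted_field_data\<close> the grading of \<open>W\<close> is part of the data; it is not assumed to be the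
  decomposition into generalized eigenspaces of \<open>LW0\<close> and \<open>g\<close>, so the case in which it is one is
  covered.\<close>

definition g_weight_reps :: "complex set" where
  "g_weight_reps = {a. 0 \<le> Re a \<and> Re a < 1}"

definition PW :: "('i, 'a, 'v, 'w::ab_group_add) twisted_fields \<Rightarrow> complex set" where
  "PW T = {a \<in> g_weight_reps. \<exists>n s. whom T n s a \<noteq> {0}}"

definition phi_mode ::
    "('i, 'a, 'v, 'w) twisted_fields \<Rightarrow> 'i \<Rightarrow> complex \<Rightarrow> nat \<Rightarrow> 'w \<Rightarrow> 'w" where
  "phi_mode T i n k w = phi T i w (- n - 1, k)"

definition psi_mode ::
    "('i, 'a, 'v, 'w) twisted_fields \<Rightarrow> 'a \<Rightarrow> complex \<Rightarrow> nat \<Rightarrow> 'v \<Rightarrow> 'w" where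
  "psi_mode T a n k v = psi T a v (- n - 1, k)"

definition twisted_field_data ::
    "('v::ab_group_add) vertex_superalgebra \<Rightarrow> 'v g_action \<Rightarrow> ('i, 'v) gen_fields
      \<Rightarrow> ('i, 'a, 'v, 'w::ab_group_add) twisted_fields \<Rightarrow> bool" where
  "twisted_field_data V g G T \<longleftrightarrow>
     vector_space (wscale T) \<and>
     direct_sum (wscale T) (UNIV \<times> UNIV \<times> g_weight_reps) (\<lambda>(n, s, a). whom T n s a) \<and>
     (\<exists>R. \<forall>n s. \<forall>a\<in>g_weight_reps. Re n < R \<longrightarrow> whom T n s a = {0}) \<and>
     (\<forall>i\<in>gidx G.
        (\<forall>m. Vector_Spaces.linear (wscale T) (wscale T) (\<lambda>w. phi T i w m)) \<and>
        (\<forall>w. log_laurent (galpha G i) (phi T i w))) \<and>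
     (\<forall>a\<in>aidx T.
        (\<forall>m. Vector_Spaces.linear (vscale V) (wscale T) (\<lambda>v. psi T a v m)) \<and>
        (\<forall>\<alpha>\<in>PV V g. \<forall>v\<in>Vg V g \<alpha>. log_laurent \<alpha> (psi T a v))) \<and>
     Vector_Spaces.linear (wscale T) (wscale T) (LW0 T) \<and>
     Vector_Spaces.linear (wscale T) (wscale T) (LWm1 T) \<and>
     Vector_Spaces.linear (wscale T) (wscale T) (gop (gact T)) \<and> bij (gop (gact T)) \<and>
     exp_of_log (wscale T) (gact T)"

section \<open>Properties of twisted field data\<close>

definition L0_property ::
    "('v::ab_group_add) vertex_superalgebra \<Rightarrow> ('i, 'v) gen_fields
      \<Rightarrow> ('i, 'a, 'v, 'w::ab_group_add) twisted_fields \<Rightarrow> bool" where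
  "L0_property V G T \<longleftrightarrow>
     (\<exists>L0S L0N. jordan_parts (wscale T) (LW0 T) L0S L0N \<and>
       (\<forall>i\<in>gidx G. \<forall>w m.
          LW0 T (phi T i w m) - phi T i (LW0 T w) m
          = ser_xderiv (wscale T) (phi T i w) m + wscale T (gwt G i) (phi T i w m)) \<and>
       (\<forall>a\<in>aidx T. \<exists>wt. \<exists>b.
          (b = None \<longleftrightarrow> (\<forall>v m. L0N (psi T a v m) = 0)) \<and> set_option b \<subseteq> aidx T \<and>
          (\<forall>v m. LW0 T (psi T a v m) - psi T a (LV0 V v) m
             = ser_xderiv (wscale T) (psi T a v) m + wscale T wt (psi T a v m)
               + opt_field (psi T) b v m)))"

definition Lm1_property ::
    "('v::ab_group_add) vertex_superalgebra \<Rightarrow> ('i, 'v) gen_fields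
      \<Rightarrow> ('i, 'a, 'v, 'w::ab_group_add) twisted_fields \<Rightarrow> bool" where
  "Lm1_property V G T \<longleftrightarrow>
     (\<forall>i\<in>gidx G. \<forall>w m.
        LWm1 T (phi T i w m) - phi T i (LWm1 T w) m = ser_deriv (wscale T) (phi T i w) m) \<and>
     (\<forall>a\<in>aidx T. \<forall>v m.
        LWm1 T (psi T a v m) - psi T a (LVm1 V v) m = ser_deriv (wscale T) (psi T a v) m)"

definition creation_property ::
    "('v::ab_group_add) vertex_superalgebra
      \<Rightarrow> ('i, 'a, 'v, 'w::ab_group_add) twisted_fields \<Rightarrow> bool" where
  "creation_property V T \<longleftrightarrow>
     (\<forall>a\<in>aidx T.
        (\<forall>r k. psi T a (vacuum V) (r, k) \<noteq> 0 \<longrightarrow> r \<in> \<nat> \<and> k = 0) \<and>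
        (\<exists>n. \<exists>\<alpha>\<in>g_weight_reps. psi_mode T a (- 1) 0 (vacuum V) \<in> whom T n (psipar T a) \<alpha>))"

inductive_set generated_W ::
    "('i, 'v) gen_fields \<Rightarrow> ('i, 'a, 'v, 'w) twisted_fields \<Rightarrow> 'w set"
  for G T where
  "a \<in> aidx T \<Longrightarrow> psi_mode T a n l v \<in> generated_W G T"
| "w \<in> generated_W G T \<Longrightarrow> i \<in> gidx G \<Longrightarrow> phi_mode T i n l w \<in> generated_W G T"

definition spanning_property ::
    "('i, 'v) gen_fields \<Rightarrow> ('i, 'a, 'v, 'w::ab_group_add) twisted_fields \<Rightarrow> bool" where
  "spanning_property G T \<longleftrightarrow> module.span (wscale T) (generated_W G T) = UNIV"

definition g_action_property ::
    "('v::ab_group_add) vertex_superalgebra \<Rightarrow> 'v g_action \<Rightarrow> ('i, 'v) gen_fields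
      \<Rightarrow> ('i, 'a, 'v, 'w::ab_group_add) twisted_fields \<Rightarrow> bool" where
  "g_action_property V g G T \<longleftrightarrow>
     (let sc = wscale T; gW = gop (gact T); S = Sg (gact T); N = Ng (gact T);
          c = 2 * of_real pi * \<i>
      in
       (\<forall>i\<in>gidx G. \<forall>p z w r. z \<noteq> 0 \<longrightarrow>
          gW (branch sc (p + 1) z (phi T i (inv gW w)) r) = branch sc p z (phi T i w) r) \<and>
       (\<forall>i\<in>gidx G.
          phi T i = nil_pow sc log_x (\<lambda>w. - N w) \<odot> log_const_term (phi T i) \<odot> nil_pow sc log_x N) \<and>
       (\<forall>a\<in>aidx T.
          psi T a = log_const_term (psi T a) \<odot> nil_pow (vscale V) log_x (\<lambda>v. - Ng g v)) \<and>
       (\<forall>i\<in>gidx G. \<forall>p z w r. z \<noteq> 0 \<longrightarrow>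
          ss_exp sc c S (branch sc p z (phi T i (ss_exp sc (- c) S w)) r)
          = sc (exp (c * galpha G i)) (branch sc p z (phi T i w) r)) \<and>
       (\<forall>i\<in>gidx G. \<forall>p z w r. z \<noteq> 0 \<longrightarrow>
          N (branch sc p z (phi T i w) r) - branch sc p z (phi T i (N w)) r
          = branch sc p z (opt_field (phi T) (Nidx G i) w) r) \<and>
       (\<forall>a\<in>aidx T. \<exists>\<alpha>\<in>PW T. \<forall>n::nat.
          psi_mode T a (- of_nat n - 1) 0 (vacuum V) \<in> gen_eigenspace sc gW (exp (c * \<alpha>))))"

definition generalized_weak_commutativity ::
    "('v::ab_group_add) vertex_superalgebra \<Rightarrow> 'v g_action \<Rightarrow> ('i, 'v) gen_fields
      \<Rightarrow> ('i, 'a, 'v, 'w::ab_group_add) twisted_fields \<Rightarrow> bool" where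
  "generalized_weak_commutativity V g G T \<longleftrightarrow>
     (\<forall>i\<in>gidx G. \<forall>a\<in>aidx T. \<exists>M::nat. 0 < M \<and>
        scalar_ser (wscale T) (pow_x1_x2 (galpha G i + of_nat M))
          \<odot> nil_pow (wscale T) log_x1_x2 (Ng (gact T))
          \<odot> in_x1 (phi T i)
          \<odot> nil_pow (wscale T) log_x1_x2 (\<lambda>w. - Ng (gact T) w)
          \<odot> in_x2 (psi T a)
        = op_scale (wscale T) (koszul (gpar G i) (psipar T a))
            (scalar_ser (wscale T) (pow_mx2_x1 (galpha G i + of_nat M))
              \<odot> in_x2 (psi T a)
              \<odot> nil_pow (vscale V) log_mx2_x1 (Ng g)
              \<odot> in_x1 (vfield V (gvec G i))
              \<odot> nil_pow (vscale V) log_mx2_x1 (\<lambda>v. - Ng g v)))"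

end

theory Submission
  imports Defs
begin

text \<open>Write \<open>\<phi>\<^sup>i\<^sub>c\<close> for the field of the \<open>c\<close>-th iterated index \<open>N\<^sub>g(\<dots>N\<^sub>g(i))\<close>; then
  \<open>y\<^sup>N \<phi>\<^sup>i y\<^sup>-\<^sup>N = \<Sum> (log y)\<^sup>c/c! \<phi>\<^sup>i\<^sub>c\<close>, on \<open>V\<close> because \<open>N\<^sub>g\<close> is a derivation and
  on \<open>W\<close> by Property 5.  Property 7 thus becomes a relation whose left side is
  \<open>\<phi>\<^sup>i(x\<^sub>1) \<psi>\<^sup>a(x\<^sub>2) v\<close> plus terms with higher powers of \<open>x\<^sub>2/x\<^sub>1\<close> or \<open>log x\<^sub>1\<close>, and whose right
  side consists of terms \<open>\<psi>\<^sup>a(x\<^sub>2) \<phi>\<^sup>i\<^sub>c(x\<^sub>1) v\<close> with scalar coefficients independent of \<open>v\<close>.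
  Since \<open>\<psi>\<^sup>a(x\<^sub>2) v\<close> is truncated from below in \<open>x\<^sub>2\<close>, two inductions become possible.  First,
  the modes of the \<open>\<phi>\<^sup>i\<close> preserve the span of the modes of the \<open>\<psi>\<^sup>a\<close>, so this span is \<open>W\<close>.
  Second, applying the relation twice, in both orders, turns the commutator of \<open>\<phi>\<^sup>i\<close> and \<open>\<phi>\<^sup>j\<close> on
  \<open>\<psi>\<^sup>a(x\<^sub>2) v\<close> into one on \<open>V\<close>, which is killed by a power of \<open>x\<^sub>1 - x\<^sub>2\<close> by the Jacobi
  identity; the lower terms on the left vanish by induction.\<close>

section \<open>Linear algebra\<close>

text \<open>The exponent \<open>M\<close> of the theorem must serve all \<open>a\<close> at once,
  although the exponent in Property 7 varies with \<open>a\<close>, and the powers of x1 - x2 on its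
  two sides are expanded in opposite directions, so they cannot simply be cancelled. No cancellation
  is attempted: the relation is read one coefficient at a time, as an identity between finite sums
  whose scalars depend on \<open>i\<close> and \<open>a\<close> but not on \<open>v\<close>. Two
  uses of it, for \<open>i\<close> and for \<open>j\<close>, therefore produce the same products of
  scalars in either order, and a whole commutator can be carried from \<open>W\<close> to
  \<open>V\<close>. Its \<open>M\<close> is chosen in \<open>V\<close> and survives every step
  unchanged. The price is bookkeeping of cutoffs: they depend on the vector, which after one use of
  the relation is no longer \<open>v\<close> but a mode applied to \<open>v\<close>, so they stay
  free and are chosen in the right order. The logarithmic corrections involve other members of the
  chain, so everything is proved for the whole chain at once.\<close>

lemma (in vector_space) subspace_polynomial_coeffs:
  assumes X: "subspace X" and "infinite A" and "\<And>a. a \<in> A \<Longrightarrow> (\<Sum>k\<le>K. scale (a ^ k) (w k)) \<in> X"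
    and "k \<le> K"
  shows "w k \<in> X"
  using assms(2-)
proof (induction K arbitrary: A w k)
  case 0
  from \<open>infinite A\<close> obtain a where "a \<in> A" by (metis ex_in_conv finite.emptyI)
  with 0 show ?case by fastforce
next
  case (Suc K)
  from \<open>infinite A\<close> obtain a0 where a0: "a0 \<in> A" by (metis ex_in_conv finite.emptyI)
  \<comment> \<open>Dividing P(a) - P(a0) by a - a0 lowers the degree by one, where P is the given
    polynomial; \<open>w' j\<close> is the coefficient of a^j in the quotient, and the induction
    hypothesis applies to it on the infinite set without \<open>a0\<close>.\<close>
  define v where "v j k = scale (a0 ^ (k - Suc j)) (w k)" for j k
  define w' where "w' j = (\<Sum>k\<in>{Suc j..Suc K}. v j k)" for j
  have w': "w' j \<in> X" if "j \<le> K" for j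
  proof (rule Suc.IH[of "A - {a0}"])
    show "infinite (A - {a0})" using \<open>infinite A\<close> by simp
    fix a assume a: "a \<in> A - {a0}"
    have "scale (a ^ k - a0 ^ k) (w k) = scale (a - a0) (\<Sum>j<k. scale (a ^ j) (v j k))" for k
      by (simp add: power_diff_sumr2 v_def scale_sum_right scale_sum_left sum_distrib_left mult_ac)
    then have "(\<Sum>k\<le>Suc K. scale (a ^ k) (w k)) - (\<Sum>k\<le>Suc K. scale (a0 ^ k) (w k))
        = (\<Sum>k\<le>Suc K. scale (a - a0) (\<Sum>j<k. scale (a ^ j) (v j k)))"
      by (simp only: sum_subtractf[symmetric] scale_left_diff_distrib[symmetric])
    also have "\<dots> = scale (a - a0) (\<Sum>k\<le>Suc K. \<Sum>j<k. scale (a ^ j) (v j k))"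
      by (simp only: scale_sum_right)
    also have "(\<Sum>k\<le>Suc K. \<Sum>j<k. scale (a ^ j) (v j k))
        = (\<Sum>j\<le>K. \<Sum>k\<in>{Suc j..Suc K}. scale (a ^ j) (v j k))"
      by (subst (1 2) sum.Sigma, simp, simp, simp, simp)
        (rule sum.reindex_bij_witness[of _ "\<lambda>(j,k). (k,j)" "\<lambda>(k,j). (j,k)"]; auto)
    also have "\<dots> = (\<Sum>j\<le>K. scale (a ^ j) (w' j))"
      by (simp only: w'_def scale_sum_right)
    finally have "scale (a - a0) (\<Sum>j\<le>K. scale (a ^ j) (w' j)) \<in> X"
      using Suc.prems(2)[of a] Suc.prems(2)[OF a0] a subspace_diff[OF X] by (metis DiffD1)
    then have "scale (inverse (a - a0)) (scale (a - a0) (\<Sum>j\<le>K. scale (a ^ j) (w' j))) \<in> X"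
      using subspace_scale[OF X] by blast
    then show "(\<Sum>j\<le>K. scale (a ^ j) (w' j)) \<in> X" using a by simp
  qed (rule that)
  \<comment> \<open>The coefficients of the quotient satisfy Horner's recursion, which is solved
    here for those of P; for \<open>j = K\<close> the coefficient \<open>w' (Suc K)\<close> is an
    empty sum.\<close>
  have wS: "w (Suc j) \<in> X" if "j \<le> K" for j
  proof -
    have "{Suc j..Suc K} = insert (Suc j) {Suc (Suc j)..Suc K}" using that by auto
    then have "w' j = w (Suc j) + (\<Sum>k\<in>{Suc (Suc j)..Suc K}. v j k)"
      unfolding w'_def by (simp add: v_def)
    also have "(\<Sum>k\<in>{Suc (Suc j)..Suc K}. v j k) = scale a0 (w' (Suc j))"
      unfolding w'_def scale_sum_right
    proof (intro sum.cong refl)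
      fix k assume "k \<in> {Suc (Suc j)..Suc K}"
      then have "k - Suc j = Suc (k - Suc (Suc j))" by auto
      then show "v j k = scale a0 (v (Suc j) k)" by (simp add: v_def)
    qed
    finally have "w (Suc j) = w' j - scale a0 (w' (Suc j))" by simp
    moreover have "w' (Suc j) \<in> X"
      using w'[of "Suc j"] subspace_0[OF X] by (cases "Suc j \<le> K") (auto simp: w'_def)
    ultimately show ?thesis using w'[OF that] X by (metis subspace_diff subspace_scale)
  qed
  have "w 0 = (\<Sum>k\<le>Suc K. scale (a0 ^ k) (w k)) - (\<Sum>k\<le>K. scale (a0 ^ Suc k) (w (Suc k)))"
    by (subst sum.atMost_Suc_shift) simp
  then have "w 0 \<in> X" using Suc.prems(2)[OF a0] wS X
    by (metis (no_types, lifting) atMost_iff subspace_diff subspace_scale subspace_sum)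
  with wS \<open>k \<le> Suc K\<close> show ?case by (cases k) auto
qed

lemma funpow_zero_ge:
  fixes N :: "'v::zero \<Rightarrow> 'v"
  assumes "(N ^^ k) v = 0" "N 0 = 0" "k \<le> n"
  shows "(N ^^ n) v = 0"
proof -
  have "(N ^^ (m + k)) v = 0" for m by (induction m) (use assms in \<open>simp_all\<close>)
  from this[of "n - k"] show ?thesis using assms(3) by simp
qed

lemma linear_rules:
  assumes "Vector_Spaces.linear s1 s2 f"
  shows "f 0 = 0" "f (x + y) = f x + f y" "f (x - y) = f x - f y" "f (- x) = - f x"
    "f (s1 c x) = s2 c (f x)" "f (sum h I) = (\<Sum>i\<in>I. f (h i))"
proof -
  interpret Vector_Spaces.linear s1 s2 f by fact
  show "f 0 = 0" "f (x + y) = f x + f y" "f (x - y) = f x - f y" "f (- x) = - f x"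
    "f (s1 c x) = s2 c (f x)" "f (sum h I) = (\<Sum>i\<in>I. f (h i))"
    by (simp_all add: add diff neg scale sum zero)
qed

lemma linear_eq_on_span:
  assumes "Vector_Spaces.linear s1 s2 f" "Vector_Spaces.linear s1 s2 h"
    "\<And>x. x \<in> B \<Longrightarrow> f x = h x" "x \<in> module.span s1 B"
  shows "f x = h x"
proof -
  interpret f: Vector_Spaces.linear s1 s2 f by fact
  interpret vector_space_pair s1 s2 by unfold_locales
  show ?thesis using linear_eq_on[OF assms(1,2,4,3)] .
qed

text \<open>\<open>ss_exp\<close> is a definite description, so existence and uniqueness are both
  owed. A maximal independent set of eigenvectors is a basis, which defines the operator. It has the
  right value on every eigenvector because, by independence, only basis vectors of the same
  eigenvalue occur in its expansion. Uniqueness holds because eigenvectors span.\<close>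

lemma ss_exp_eigen:
  fixes sc :: "complex \<Rightarrow> 'v::ab_group_add \<Rightarrow> 'v"
  assumes vs: "vector_space sc" and ss: "semisimple_op sc S"
  shows "Vector_Spaces.linear sc sc (ss_exp sc c S)"
    and "S v = sc a v \<Longrightarrow> ss_exp sc c S v = sc (exp (c * a)) v"
proof -
  interpret vector_space sc by fact
  interpret P: vector_space_pair sc sc by unfold_locales
  let ?Q = "\<lambda>E. Vector_Spaces.linear sc sc E \<and> (\<forall>a v. S v = sc a v \<longrightarrow> E v = sc (exp (c * a)) v)"
  have lin: "Vector_Spaces.linear sc sc S" and span: "span {v. \<exists>a. S v = sc a v} = UNIV"
    using ss by (auto simp: semisimple_op_def)
  obtain B where B: "B \<subseteq> {v. \<exists>a. S v = sc a v}" "independent B" "{v. \<exists>a. S v = sc a v} \<subseteq> span B"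
    by (rule maximal_independent_subset)
  have spanB: "span B = UNIV" using span_minimal[OF B(3) subspace_span] span by auto
  have "\<forall>b\<in>B. \<exists>a. S b = sc a b" using B(1) by blast
  then obtain ev where ev: "\<And>b. b \<in> B \<Longrightarrow> S b = sc (ev b) b" by metis
  obtain E where E: "Vector_Spaces.linear sc sc E" "\<And>b. b \<in> B \<Longrightarrow> E b = sc (exp (c * ev b)) b"
    using P.linear_independent_extend[OF B(2), of "\<lambda>b. sc (exp (c * ev b)) b"] by metis
  have "E v = sc (exp (c * a)) v" if v: "S v = sc a v" for a v
  proof -
    let ?r = "representation B v"
    have fin: "finite {b. ?r b \<noteq> 0}" and inB: "\<And>b. ?r b \<noteq> 0 \<Longrightarrow> b \<in> B"
      using finite_representation representation_ne_zero by auto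
    have vr: "v = (\<Sum>b | ?r b \<noteq> 0. sc (?r b) b)"
      using sum_nonzero_representation_eq[OF B(2)] spanB by simp
    have "sc a v = (\<Sum>b | ?r b \<noteq> 0. sc (a * ?r b) b)"
      by (subst vr) (simp add: scale_sum_right)
    moreover have "S v = (\<Sum>b | ?r b \<noteq> 0. sc (ev b * ?r b) b)"
      by (subst vr) (use inB ev in \<open>simp add: linear_rules[OF lin] mult.commute\<close>)
    ultimately have z: "(\<Sum>b | ?r b \<noteq> 0. sc (ev b * ?r b - a * ?r b) b) = 0"
      using v by (simp add: scale_left_diff_distrib sum_subtractf)
    have "ev b = a" if "?r b \<noteq> 0" for b
    proof -
      have "ev b * ?r b - a * ?r b = 0"
        by (rule independentD[OF B(2) fin _ z]) (use inB that in auto)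
      then show ?thesis using that by simp
    qed
    moreover have "E v = (\<Sum>b | ?r b \<noteq> 0. sc (?r b) (sc (exp (c * ev b)) b))"
      by (subst vr) (use inB E in \<open>simp add: linear_rules[OF E(1)]\<close>)
    ultimately have "E v = (\<Sum>b | ?r b \<noteq> 0. sc (?r b) (sc (exp (c * a)) b))" by simp
    also have "\<dots> = sc (exp (c * a)) v"
      by (subst (3) vr) (simp add: scale_sum_right mult.commute)
    finally show ?thesis .
  qed
  with E have QE: "?Q E" by blast
  have "E' = E" if "?Q E'" for E'
    by (rule ext, rule linear_eq_on_span[of sc sc E' E "{v. \<exists>a. S v = sc a v}"])
      (use that QE span in \<open>auto, metis\<close>)
  then have "?Q (ss_exp sc c S)" unfolding ss_exp_def using QE by (rule theI[of ?Q, rotated])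
  then show "Vector_Spaces.linear sc sc (ss_exp sc c S)"
    and "S v = sc a v \<Longrightarrow> ss_exp sc c S v = sc (exp (c * a)) v" by blast+
qed

text \<open>The exponential series are summed over an index set that depends on the vector; a fixed
  range makes the sums for different vectors comparable.\<close>

lemma sum_nilpotent_bound:
  fixes h :: "nat \<Rightarrow> 'v::zero \<Rightarrow> 'u::ab_group_add" and N :: "'v \<Rightarrow> 'v"
  assumes "\<And>k. k > K \<Longrightarrow> (N ^^ k) v = 0" "\<And>k. h k 0 = 0"
  shows "(\<Sum>k | (N ^^ k) v \<noteq> 0. h k ((N ^^ k) v)) = (\<Sum>k\<le>K. h k ((N ^^ k) v))"
  by (rule sum.mono_neutral_left) (use assms not_less in auto)

lemma (in vector_space) linear_funpow:
  "Vector_Spaces.linear scale scale f \<Longrightarrow> Vector_Spaces.linear scale scale (f ^^ k)"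
proof (induction k)
  case 0
  have "f ^^ 0 = id" by simp
  then show ?case using linear_id by metis
next
  case (Suc k)
  then show ?case unfolding funpow.simps by (metis Vector_Spaces.linear_compose)
qed

lemma (in vector_space) funpow_linear_zero_ge:
  assumes "Vector_Spaces.linear scale scale N" "(N ^^ K) v = 0" "k \<ge> K"
  shows "(N ^^ k) v = 0"
  using assms funpow_zero_ge linear_rules(1) by metis

lemma nil_exp_sum:
  assumes "vector_space sc" "\<And>k. k > K \<Longrightarrow> (N ^^ k) v = 0"
  shows "nil_exp sc c N v = (\<Sum>k\<le>K. sc (c ^ k / fact k) ((N ^^ k) v))"
proof -
  interpret vector_space sc by fact
  show ?thesis unfolding nil_exp_def by (rule sum_nilpotent_bound) (use assms in auto)
qed

lemma nil_exp_add:
  fixes sc :: "complex \<Rightarrow> 'v::ab_group_add \<Rightarrow> 'v"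
  assumes vs: "vector_space sc" and N: "loc_nilpotent_op sc N"
  shows "nil_exp sc c N (nil_exp sc d N v) = nil_exp sc (c + d) N v"
proof -
  interpret vector_space sc by fact
  have lin: "Vector_Spaces.linear sc sc N" using N by (simp add: loc_nilpotent_op_def)
  note linr = linear_rules[OF linear_funpow[OF lin]]
  obtain K where K: "(N ^^ K) v = 0" using N by (auto simp: loc_nilpotent_op_def)
  have K': "(N ^^ k) v = 0" if "k > K" for k using funpow_linear_zero_ge[OF lin K] that by simp
  let ?w = "nil_exp sc d N v"
  have w: "?w = (\<Sum>k\<le>K. sc (d ^ k / fact k) ((N ^^ k) v))"
    by (rule nil_exp_sum[OF vs K'])
  have "(N ^^ k) ?w = (\<Sum>l\<le>K. sc (d ^ l / fact l) ((N ^^ (k + l)) v))" for k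
    unfolding w by (simp add: linr funpow_add)
  note Nw = this
  have "(N ^^ k) ?w = 0" if "k > K" for k
    unfolding Nw using K' that by simp
  then have "nil_exp sc c N ?w = (\<Sum>k\<le>K. sc (c ^ k / fact k) ((N ^^ k) ?w))"
    by (rule nil_exp_sum[OF vs])
  also have "\<dots> = (\<Sum>k\<le>K. \<Sum>l\<le>K. sc (c ^ k / fact k * (d ^ l / fact l)) ((N ^^ (k + l)) v))"
    unfolding Nw by (simp add: scale_sum_right)
  also have "\<dots> = (\<Sum>(k,l)\<in>{..K}\<times>{..K}. sc (c ^ k / fact k * (d ^ l / fact l)) ((N ^^ (k + l)) v))"
    by (simp add: sum.cartesian_product)
  \<comment> \<open>Nilpotency discards all pairs with \<open>k + l > K\<close>, so the square
    shrinks to a triangle and the binomial theorem applies degree by degree.\<close>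
  also have "\<dots> = (\<Sum>(k,l)\<in>{(k,l). k + l \<le> K}. sc (c ^ k / fact k * (d ^ l / fact l)) ((N ^^ (k + l)) v))"
  proof (rule sum.mono_neutral_right)
    show "\<forall>p\<in>{..K} \<times> {..K} - {(k, l). k + l \<le> K}.
        (case p of (k, l) \<Rightarrow> sc (c ^ k / fact k * (d ^ l / fact l)) ((N ^^ (k + l)) v)) = 0"
      using K' by (simp add: split_beta)
  qed auto
  also have "\<dots> = (\<Sum>n\<le>K. \<Sum>k\<le>n. sc (c ^ k / fact k * (d ^ (n - k) / fact (n - k))) ((N ^^ n) v))"
    by (subst sum.triangle_reindex_eq) simp
  also have "\<dots> = (\<Sum>n\<le>K. sc ((c + d) ^ n / fact n) ((N ^^ n) v))"
  proof (intro sum.cong refl)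
    fix n
    have "(c + d) ^ n / fact n = (\<Sum>k\<le>n. c ^ k / fact k * (d ^ (n - k) / fact (n - k)))"
      unfolding binomial_ring sum_divide_distrib
      by (intro sum.cong refl) (simp add: binomial_fact)
    then show "(\<Sum>k\<le>n. sc (c ^ k / fact k * (d ^ (n - k) / fact (n - k))) ((N ^^ n) v))
        = sc ((c + d) ^ n / fact n) ((N ^^ n) v)" by (simp add: scale_sum_left)
  qed
  also have "\<dots> = nil_exp sc (c + d) N v" by (rule nil_exp_sum[OF vs K', symmetric])
  finally show ?thesis .
qed

lemma nil_exp_funpow:
  fixes sc :: "complex \<Rightarrow> 'v::ab_group_add \<Rightarrow> 'v"
  assumes "vector_space sc" "loc_nilpotent_op sc N"
  shows "(nil_exp sc c N ^^ m) v = nil_exp sc (of_nat m * c) N v"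
proof (induction m)
  case 0
  have "nil_exp sc 0 N v = v"
  proof -
    interpret vector_space sc by fact
    obtain K where K: "(N ^^ K) v = 0" using assms by (auto simp: loc_nilpotent_op_def)
    have lin: "Vector_Spaces.linear sc sc N" using assms by (simp add: loc_nilpotent_op_def)
    have "nil_exp sc 0 N v = (\<Sum>k\<le>K. sc (0 ^ k / fact k) ((N ^^ k) v))"
      by (rule nil_exp_sum[OF assms(1)]) (use funpow_linear_zero_ge[OF lin K] in simp)
    also have "\<dots> = (\<Sum>k\<in>{0}. sc (0 ^ k / fact k) ((N ^^ k) v))"
      by (rule sum.mono_neutral_right) auto
    finally show ?thesis by simp
  qed
  then show ?case by simp
next
  case (Suc m)
  then show ?case by (simp add: nil_exp_add[OF assms] distrib_right)
qed

text \<open>The powers of \<open>e\<^sup>c\<^sup>N\<close> depend polynomially on the exponent, so \<open>N v\<close> is a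
  linear combination of the vectors \<open>e\<^sup>m\<^sup>c\<^sup>N v\<close>.\<close>
lemma nilpotent_preserves_subspace:
  fixes sc :: "complex \<Rightarrow> 'v::ab_group_add \<Rightarrow> 'v"
  assumes vs: "vector_space sc" and N: "loc_nilpotent_op sc N" and X: "module.subspace sc X"
    and inv: "\<And>v. v \<in> X \<Longrightarrow> nil_exp sc c N v \<in> X" and c: "c \<noteq> 0" and v: "v \<in> X"
  shows "N v \<in> X"
proof -
  interpret vector_space sc by fact
  have lin: "Vector_Spaces.linear sc sc N" using N by (simp add: loc_nilpotent_op_def)
  obtain K where K: "(N ^^ K) v = 0" using N by (auto simp: loc_nilpotent_op_def)
  have K': "(N ^^ k) v = 0" if "k > Suc K" for k using funpow_linear_zero_ge[OF lin K] that by simp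
  have "(nil_exp sc c N ^^ m) v \<in> X" for m by (induction m) (use inv v in auto)
  then have "nil_exp sc (of_nat m * c) N v \<in> X" for m by (simp add: nil_exp_funpow[OF vs N])
  then have "(\<Sum>k\<le>Suc K. sc (of_nat m ^ k) (sc (c ^ k / fact k) ((N ^^ k) v))) \<in> X" for m
    by (simp add: nil_exp_sum[OF vs K'] power_mult_distrib)
  then have P: "\<And>a. a \<in> range of_nat \<Longrightarrow> (\<Sum>k\<le>Suc K. sc (a ^ k) (sc (c ^ k / fact k) ((N ^^ k) v))) \<in> X"
    by blast
  have "sc (c ^ 1 / fact 1) ((N ^^ 1) v) \<in> X"
    by (rule subspace_polynomial_coeffs[OF X _ P]) (auto simp: range_inj_infinite inj_of_nat)
  from subspace_scale[OF X this, of "inverse c"] show ?thesis using c by simp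
qed

section \<open>Components in a direct sum\<close>

lemma direct_sum_eq_zeroD:
  assumes ds: "direct_sum sc J U" and vs: "vector_space sc"
    and f: "\<And>j. j \<in> J \<Longrightarrow> f j \<in> U j" "\<And>j. j \<notin> J \<Longrightarrow> f j = 0" "finite {j. f j \<noteq> 0}"
    and z: "(\<Sum>j | f j \<noteq> 0. f j) = 0"
  shows "f j = 0"
proof -
  interpret vector_space sc by fact
  let ?Q = "\<lambda>f. (\<forall>j\<in>J. f j \<in> U j) \<and> (\<forall>j. j \<notin> J \<longrightarrow> f j = 0) \<and>
               finite {j. f j \<noteq> 0} \<and> 0 = (\<Sum>j | f j \<noteq> 0. f j)"
  have ex1: "\<exists>!f. ?Q f" by (rule spec[OF conjunct2[OF ds[unfolded direct_sum_def]], of 0])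
  have "\<forall>j\<in>J. subspace (U j)" using ds by (simp add: direct_sum_def)
  then have Q0: "?Q (\<lambda>_. 0)" using subspace_0 by simp
  have "?Q f" using f z by simp
  from trans[OF the1_equality[OF ex1, OF this, symmetric] the1_equality[OF ex1, OF Q0]]
  have "f = (\<lambda>_. 0)" .
  then show ?thesis by simp
qed

lemma direct_sum_decomposition:
  assumes ds: "direct_sum sc J U"
  shows "\<exists>f. (\<forall>j\<in>J. f j \<in> U j) \<and> (\<forall>j. j \<notin> J \<longrightarrow> f j = 0) \<and>
               finite {j. f j \<noteq> 0} \<and> v = (\<Sum>j | f j \<noteq> 0. f j)"
proof (rule ex1_implies_ex)
  show "\<exists>!f. (\<forall>j\<in>J. f j \<in> U j) \<and> (\<forall>j. j \<notin> J \<longrightarrow> f j = 0) \<and>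
               finite {j. f j \<noteq> 0} \<and> v = (\<Sum>j | f j \<noteq> 0. f j)"
    by (rule spec[OF conjunct2[OF ds[unfolded direct_sum_def]], of v])
qed

section \<open>The nilpotent part of an automorphism is a derivation\<close>

locale vsa_with_automorphism =
  fixes V :: "('v::ab_group_add) vertex_superalgebra" and g :: "'v g_action"
  assumes V: "grading_restricted_vertex_superalgebra V" and g: "automorphism_with_log V g"
begin

abbreviation "sV \<equiv> vscale V"
abbreviation "NV \<equiv> Ng g"
abbreviation "tpi \<equiv> 2 * complex_of_real pi * \<i>"

sublocale V: vector_space sV
  using V by (simp add: grading_restricted_vertex_superalgebra_def)

lemma vs: "vector_space sV" by unfold_locales

lemma vmode_linear_left: "Vector_Spaces.linear sV sV (\<lambda>u. vmode V u n v)"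
  and vmode_linear_right: "Vector_Spaces.linear sV sV (vmode V u n)"
  using V by (auto simp: grading_restricted_vertex_superalgebra_def)

lemma NV_nil: "loc_nilpotent_op sV NV" and NV_linear: "Vector_Spaces.linear sV sV NV"
  and Sg_ss: "semisimple_op sV (Sg g)" and SN: "Sg g (NV v) = NV (Sg g v)"
  and gop_eq: "gop g v = ss_exp sV tpi (Sg g) (nil_exp sV tpi NV v)"
  using g by (auto simp: automorphism_with_log_def exp_of_log_def jordan_parts_def
      loc_nilpotent_op_def fun_eq_iff)

lemma Sg_Vg: "a \<in> PV V g \<Longrightarrow> v \<in> Vg V g a \<Longrightarrow> Sg g v = sV a v"
  using g by (auto simp: automorphism_with_log_def)

lemma Vg_direct_sum: "direct_sum sV (PV V g) (Vg V g)"
  using g by (auto simp: automorphism_with_log_def)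

lemma Vg_subspace: "a \<in> PV V g \<Longrightarrow> V.subspace (Vg V g a)"
  using Vg_direct_sum by (auto simp: direct_sum_def)

lemma gop_linear: "Vector_Spaces.linear sV sV (gop g)"
  and gop_vmode: "gop g (vmode V u n v) = vmode V (gop g u) n (gop g v)"
  and gop_vhom: "d \<in> half_ints \<Longrightarrow> v \<in> vhom V d s \<Longrightarrow> gop g v \<in> vhom V d s"
  using g by (auto simp: automorphism_with_log_def vsa_automorphism_def)

text \<open>\<open>Vg\<close> is a generalized eigenspace of \<open>gop g\<close>, whereas
  \<open>NV\<close> is only known to commute with \<open>Sg g\<close>. Since \<open>Sg g\<close> is
  the scalar \<open>j\<close> on the component of weight \<open>j\<close> and multiplies
  \<open>NV v\<close> by \<open>a\<close>, every component of \<open>NV v\<close> with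
  \<open>j \<noteq> a\<close> vanishes.\<close>

lemma NV_Vg:
  assumes a: "a \<in> PV V g" and v: "v \<in> Vg V g a"
  shows "NV v \<in> Vg V g a"
proof -
  obtain f where f: "\<And>j. j \<in> PV V g \<Longrightarrow> f j \<in> Vg V g j" "\<And>j. j \<notin> PV V g \<Longrightarrow> f j = 0"
    "finite {j. f j \<noteq> 0}" "NV v = (\<Sum>j | f j \<noteq> 0. f j)"
    using direct_sum_decomposition[OF Vg_direct_sum, of "NV v"] by blast
  have Sl: "Vector_Spaces.linear sV sV (Sg g)" using Sg_ss by (simp add: semisimple_op_def)
  define h where "h j = sV (j - a) (f j)" for j
  have "Sg g (NV v) = sV a (NV v)" using SN Sg_Vg[OF a v] linear_rules[OF NV_linear] by simp
  moreover have "Sg g (NV v) = (\<Sum>j | f j \<noteq> 0. sV j (f j))"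
    unfolding f(4) linear_rules[OF Sl] using f(1,2) Sg_Vg by (intro sum.cong) auto
  ultimately have "(\<Sum>j | f j \<noteq> 0. h j) = 0"
    by (simp add: h_def V.scale_left_diff_distrib sum_subtractf f(4) V.scale_sum_right)
  moreover have "(\<Sum>j | f j \<noteq> 0. h j) = (\<Sum>j | h j \<noteq> 0. h j)"
    using f(3) by (intro sum.mono_neutral_right) (auto simp: h_def)
  ultimately have "h j = 0" for j
    using f Vg_subspace V.subspace_scale
    by (intro direct_sum_eq_zeroD[OF Vg_direct_sum vs, of h j])
      (auto simp: h_def intro: finite_subset[OF _ f(3)])
  then have "f j = 0" if "j \<noteq> a" for j using that by (auto simp: h_def)
  then have "NV v = f a" unfolding f(4)
    by (subst sum.mono_neutral_left[of "{a}"]) (auto simp: sum.If_cases)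
  then show ?thesis using f(1)[OF a] by simp
qed

lemma NV_pow_Vg: "a \<in> PV V g \<Longrightarrow> v \<in> Vg V g a \<Longrightarrow> (NV ^^ k) v \<in> Vg V g a"
  by (induction k) (auto intro: NV_Vg)

lemma nil_exp_Vg:
  assumes a: "a \<in> PV V g" and v: "v \<in> Vg V g a"
  shows "nil_exp sV d NV v \<in> Vg V g a"
  unfolding nil_exp_def
  using NV_pow_Vg[OF a v] Vg_subspace[OF a] by (auto intro!: V.subspace_sum V.subspace_scale)

lemma gop_Vg:
  assumes a: "a \<in> PV V g" and v: "v \<in> Vg V g a"
  shows "gop g v = sV (exp (tpi * a)) (nil_exp sV tpi NV v)"
  unfolding gop_eq using ss_exp_eigen(2)[OF vs Sg_ss] Sg_Vg[OF a nil_exp_Vg[OF a v]] by blast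

text \<open>Only the automorphism is assumed to respect the grading. On \<open>Vg V g a\<close> it
  is a nonzero multiple of the exponential of \<open>NV\<close>, so this exponential preserves the
  homogeneous part, and \<open>NV\<close> is recovered from it.\<close>

lemma NV_vhom:
  assumes a: "a \<in> PV V g" and v: "v \<in> Vg V g a" "v \<in> vhom V n s" and n: "n \<in> half_ints"
  shows "NV v \<in> vhom V n s"
proof -
  have "\<forall>j\<in>half_ints \<times> UNIV. V.subspace ((\<lambda>(n, s). vhom V n s) j)"
    using V by (simp add: grading_restricted_vertex_superalgebra_def direct_sum_def)
  then have sub: "V.subspace (vhom V n s)" using n by auto
  have "NV v \<in> Vg V g a \<inter> vhom V n s"
  proof (rule nilpotent_preserves_subspace[OF vs NV_nil])
    show "V.subspace (Vg V g a \<inter> vhom V n s)" by (intro V.subspace_inter Vg_subspace a sub)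
    fix w assume w: "w \<in> Vg V g a \<inter> vhom V n s"
    have "sV (exp (- (tpi * a))) (gop g w) = nil_exp sV tpi NV w"
      using gop_Vg[OF a, of w] w by (simp flip: exp_add)
    then have "nil_exp sV tpi NV w \<in> vhom V n s"
      using gop_vhom[OF n, of w s] w V.subspace_scale[OF sub, of "gop g w" "exp (- (tpi * a))"] by simp
    then show "nil_exp sV tpi NV w \<in> Vg V g a \<inter> vhom V n s" using nil_exp_Vg[OF a] w by blast
  qed (use v in auto)
  then show ?thesis by blast
qed

text \<open>The operator e^(cN) - 1 is divisible by N, hence lowers the order of nilpotency by
  one.\<close>

lemma nil_exp_minus_self_nilpotent:
  assumes "(NV ^^ Suc d) v = 0"
  shows "(NV ^^ d) (nil_exp sV c NV v - v) = 0"
proof -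
  have K: "(NV ^^ k) v = 0" if "k > d" for k
    using V.funpow_linear_zero_ge[OF NV_linear assms] that by simp
  have "nil_exp sV c NV v = (\<Sum>k\<le>d. sV (c ^ k / fact k) ((NV ^^ k) v))"
    by (rule nil_exp_sum[OF vs K])
  also have "\<dots> = v + (\<Sum>k<d. sV (c ^ Suc k / fact (Suc k)) ((NV ^^ Suc k) v))"
    by (subst sum.atMost_shift) simp
  finally have "(NV ^^ d) (nil_exp sV c NV v - v)
      = (\<Sum>k<d. sV (c ^ Suc k / fact (Suc k)) ((NV ^^ (d + Suc k)) v))"
    by (simp add: linear_rules[OF V.linear_funpow[OF NV_linear]] funpow_add[unfolded comp_def, THEN fun_cong] del: funpow.simps add_Suc_right)
  then show ?thesis using K by (simp del: funpow.simps)
qed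

text \<open>With u' and v' obtained from u and v by e^(2 pi i N) - 1, the operator \<open>?D\<close>
  sends u_n v to a multiple of u'_n v + u_n v' + u'_n v'. In each term the sum of the two nilpotency
  orders has dropped, so iterating reaches zero.\<close>

lemma vmode_generalized_eigenvector:
  assumes ab: "a \<in> PV V g" "b \<in> PV V g" and uv: "u \<in> Vg V g a" "v \<in> Vg V g b"
  shows "\<exists>k. ((\<lambda>x. gop g x - sV (exp (tpi * (a + b))) x) ^^ k) (vmode V u n v) = 0"
proof -
  let ?D = "\<lambda>x. gop g x - sV (exp (tpi * (a + b))) x"
  interpret VV: vector_space_pair sV sV by unfold_locales
  have Dl: "Vector_Spaces.linear sV sV ?D"
    by (intro VV.linear_compose_sub gop_linear V.linear_scale_self)
  note D = linear_rules[OF V.linear_funpow[OF Dl]]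
  note vl = linear_rules[OF vmode_linear_left] and vr = linear_rules[OF vmode_linear_right]
  have *: "(?D ^^ k) (vmode V u n v) = 0"
    if "(NV ^^ d) u = 0" "(NV ^^ e) v = 0" "d + e \<le> k" "u \<in> Vg V g a" "v \<in> Vg V g b" for k d e u v
    using that
  proof (induction k arbitrary: d e u v)
    case 0
    then show ?case by (simp add: vl)
  next
    case (Suc k)
    show ?case
    proof (cases "d = 0 \<or> e = 0")
      case True
      then have "u = 0 \<or> v = 0" using Suc.prems by auto
      then have "vmode V u n v = 0" by (auto simp: vl vr)
      then show ?thesis using D(1)[of "Suc k"] by simp
    next
      case False
      then obtain d' e' where de: "d = Suc d'" "e = Suc e'" by (metis not0_implies_Suc)
      define u' where "u' = nil_exp sV tpi NV u - u"
      define v' where "v' = nil_exp sV tpi NV v - v"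
      have u': "(NV ^^ d') u' = 0" "u' \<in> Vg V g a"
        unfolding u'_def using nil_exp_minus_self_nilpotent Suc.prems de nil_exp_Vg ab Vg_subspace
        by (auto intro!: V.subspace_diff)
      have v': "(NV ^^ e') v' = 0" "v' \<in> Vg V g b"
        unfolding v'_def using nil_exp_minus_self_nilpotent Suc.prems de nil_exp_Vg ab Vg_subspace
        by (auto intro!: V.subspace_diff)
      have "gop g u = sV (exp (tpi * a)) (u + u')" "gop g v = sV (exp (tpi * b)) (v + v')"
        using gop_Vg ab Suc.prems by (auto simp: u'_def v'_def)
      then have "?D (vmode V u n v)
         = sV (exp (tpi * (a + b))) (vmode V u' n v + vmode V u n v' + vmode V u' n v')"
        by (simp add: gop_vmode vl vr distrib_left exp_add algebra_simps V.scale_right_distrib)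
      moreover have "(?D ^^ k) (vmode V u' n v) = 0"
        by (rule Suc.IH[OF u'(1) Suc.prems(2)]) (use Suc.prems u' de in auto)
      moreover have "(?D ^^ k) (vmode V u n v') = 0"
        by (rule Suc.IH[OF Suc.prems(1) v'(1)]) (use Suc.prems v' de in auto)
      moreover have "(?D ^^ k) (vmode V u' n v') = 0"
        by (rule Suc.IH[OF u'(1) v'(1)]) (use Suc.prems u' v' de in auto)
      ultimately show ?thesis by (simp add: funpow_Suc_right D del: funpow.simps)
    qed
  qed
  obtain d e where "(NV ^^ d) u = 0" "(NV ^^ e) v = 0"
    using NV_nil unfolding loc_nilpotent_op_def by blast
  with * uv show ?thesis by blast
qed

lemma gop_vmode_Vg:
  assumes ab: "a \<in> PV V g" "b \<in> PV V g" and uv: "u \<in> Vg V g a" "v \<in> Vg V g b"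
  shows "gop g (vmode V u n v) = sV (exp (tpi * (a + b))) (nil_exp sV tpi NV (vmode V u n v))"
proof (cases "vmode V u n v = 0")
  case True
  have "nil_exp sV tpi NV 0 = 0"
    using nil_exp_sum[OF vs, where v = 0 and K = 0] linear_rules(1)[OF V.linear_funpow[OF NV_linear]]
    by simp
  then show ?thesis using True linear_rules(1)[OF gop_linear] by simp
next
  case False
  let ?l = "exp (tpi * (a + b))"
  let ?D = "\<lambda>x. gop g x - sV ?l x"
  \<comment> \<open>The real part of \<open>a + b\<close> may lie in [1, 2), while members of
    \<open>PV\<close> have real part in [0, 1); subtracting 1 does not change the
    exponential.\<close>
  define c where "c = (if Re (a + b) < 1 then a + b else a + b - 1)"
  have l: "exp (tpi * c) = ?l"
  proof -
    have "exp (tpi * (a + b - 1)) = ?l * exp (- tpi)"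
      by (simp flip: exp_add add: algebra_simps)
    then show ?thesis by (simp add: c_def exp_minus)
  qed
  obtain k where k: "(?D ^^ k) (vmode V u n v) = 0"
    using vmode_generalized_eigenvector[OF ab uv] by blast
  \<comment> \<open>The last nonzero iterate is a genuine eigenvector, as membership of
    \<open>c\<close> in \<open>PV\<close> demands.\<close>
  define m where "m = (LEAST k. (?D ^^ k) (vmode V u n v) = 0)"
  have m: "(?D ^^ m) (vmode V u n v) = 0" unfolding m_def using k by (rule LeastI)
  have "m \<noteq> 0" using m False by (metis funpow_0)
  then obtain m' where m': "m = Suc m'" by (metis not0_implies_Suc)
  have "(?D ^^ m') (vmode V u n v) \<noteq> 0"
    using not_less_Least[of m' "\<lambda>k. (?D ^^ k) (vmode V u n v) = 0"] m' by (simp add: m_def[symmetric])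
  moreover have "gop g ((?D ^^ m') (vmode V u n v)) = sV ?l ((?D ^^ m') (vmode V u n v))"
    using m m' by simp
  moreover have "0 \<le> Re c" "Re c < 1" using ab by (auto simp: c_def PV_def)
  ultimately have c: "c \<in> PV V g" unfolding PV_def using l by auto
  have "vmode V u n v \<in> Vg V g c" unfolding Vg_def gen_eigenspace_def l using k by blast
  from gop_Vg[OF c this] show ?thesis by (simp add: l)
qed

text \<open>The scalars of the semisimple part cancel, so the exponential of 2 pi i N is
  multiplicative on modes, and so are its powers. Both sides for the m-th power are polynomials in
  m, and their linear coefficients give the Leibniz rule.\<close>

lemma NV_vmode_Vg:
  assumes ab: "a \<in> PV V g" "b \<in> PV V g" and uv: "u \<in> Vg V g a" "v \<in> Vg V g b"
  shows "NV (vmode V u n v) = vmode V (NV u) n v + vmode V u n (NV v)"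
proof -
  note vl = linear_rules[OF vmode_linear_left] and vr = linear_rules[OF vmode_linear_right]
  let ?E = "nil_exp sV tpi NV"
  have E: "?E (vmode V u n v) = vmode V (?E u) n (?E v)"
    if "u \<in> Vg V g a" "v \<in> Vg V g b" for u v
  proof -
    have "sV (exp (tpi * (a + b))) (?E (vmode V u n v)) = sV (exp (tpi * (a + b))) (vmode V (?E u) n (?E v))"
      unfolding gop_vmode_Vg[OF ab that, symmetric] gop_vmode gop_Vg[OF ab(1) that(1)] gop_Vg[OF ab(2) that(2)]
      by (simp add: vl vr distrib_left exp_add)
    then show ?thesis by simp
  qed
  have Em: "(?E ^^ m) u \<in> Vg V g a" "(?E ^^ m) v \<in> Vg V g b" for m
    by (induction m) (use uv ab nil_exp_Vg in auto)
  have "(?E ^^ m) (vmode V u n v) = vmode V ((?E ^^ m) u) n ((?E ^^ m) v)" for m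
    by (induction m) (use E Em in auto)
  then have E': "nil_exp sV (of_nat m * tpi) NV (vmode V u n v)
      = vmode V (nil_exp sV (of_nat m * tpi) NV u) n (nil_exp sV (of_nat m * tpi) NV v)" for m
    by (simp add: nil_exp_funpow[OF vs NV_nil])
  obtain d1 d2 d3 where d: "(NV ^^ d1) u = 0" "(NV ^^ d2) v = 0" "(NV ^^ d3) (vmode V u n v) = 0"
    using NV_nil unfolding loc_nilpotent_op_def by metis
  \<comment> \<open>\<open>K\<close> truncates all three exponentials as well as the product of two
    of them by total degree; \<open>Suc\<close> ensures that degree 1 lies in the range.\<close>
  define K where "K = Suc (d1 + d2 + d3)"
  have K: "(NV ^^ k) u = 0" "(NV ^^ k) v = 0" "(NV ^^ k) (vmode V u n v) = 0" if "k > K" for k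
    using V.funpow_linear_zero_ge[OF NV_linear] d that by (auto simp: K_def)
  have K2: "(NV ^^ k) u = 0 \<or> (NV ^^ l) v = 0" if "k + l > K" for k l
    using V.funpow_linear_zero_ge[OF NV_linear d(1), of k] V.funpow_linear_zero_ge[OF NV_linear d(2), of l]
      that by (force simp: K_def)
  have E1: "nil_exp sV d NV u = (\<Sum>k\<le>K. sV (d ^ k / fact k) ((NV ^^ k) u))"
    and E2: "nil_exp sV d NV v = (\<Sum>k\<le>K. sV (d ^ k / fact k) ((NV ^^ k) v))"
    and E3: "nil_exp sV d NV (vmode V u n v)
      = (\<Sum>k\<le>K. sV (d ^ k / fact k) ((NV ^^ k) (vmode V u n v)))" for d
    by (rule nil_exp_sum[OF vs], erule K)+
  \<comment> \<open>\<open>W p\<close> is the coefficient of m^p in the difference of the two sides;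
    \<open>W 1\<close> is 2 pi i times the defect of the derivation rule.\<close>
  define W where "W p = sV (tpi ^ p / fact p) ((NV ^^ p) (vmode V u n v))
    - (\<Sum>k\<le>p. sV (tpi ^ p / (fact k * fact (p - k))) (vmode V ((NV ^^ k) u) n ((NV ^^ (p - k)) v)))" for p
  have "(\<Sum>p\<le>K. sV (of_nat m ^ p) (W p)) = 0" for m
  proof -
    let ?x = "of_nat m :: complex"
    have "vmode V (nil_exp sV (?x * tpi) NV u) n (nil_exp sV (?x * tpi) NV v)
      = (\<Sum>k\<le>K. \<Sum>l\<le>K. sV ((?x * tpi) ^ k / fact k * ((?x * tpi) ^ l / fact l)) (vmode V ((NV ^^ k) u) n ((NV ^^ l) v)))"
      unfolding E1 E2 vl(5,6)
      by (simp add: vr V.scale_sum_right)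
    also have "\<dots> = (\<Sum>(k,l)\<in>{..K}\<times>{..K}. sV ((?x * tpi) ^ k / fact k * ((?x * tpi) ^ l / fact l)) (vmode V ((NV ^^ k) u) n ((NV ^^ l) v)))"
      by (simp add: sum.cartesian_product)
    also have "\<dots> = (\<Sum>(k,l)\<in>{(k,l). k + l \<le> K}. sV ((?x * tpi) ^ k / fact k * ((?x * tpi) ^ l / fact l)) (vmode V ((NV ^^ k) u) n ((NV ^^ l) v)))"
    proof (rule sum.mono_neutral_right)
      show "\<forall>p\<in>{..K} \<times> {..K} - {(k, l). k + l \<le> K}. (case p of (k, l) \<Rightarrow>
         sV ((?x * tpi) ^ k / fact k * ((?x * tpi) ^ l / fact l)) (vmode V ((NV ^^ k) u) n ((NV ^^ l) v))) = 0"
      proof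
        fix p assume "p \<in> {..K} \<times> {..K} - {(k, l). k + l \<le> K}"
        then show "(case p of (k, l) \<Rightarrow>
         sV ((?x * tpi) ^ k / fact k * ((?x * tpi) ^ l / fact l)) (vmode V ((NV ^^ k) u) n ((NV ^^ l) v))) = 0"
          using K2[of "fst p" "snd p"] by (auto simp: vl vr split_beta)
      qed
    qed auto
    also have "\<dots> = (\<Sum>p\<le>K. \<Sum>k\<le>p. sV ((?x * tpi) ^ k / fact k * ((?x * tpi) ^ (p - k) / fact (p - k))) (vmode V ((NV ^^ k) u) n ((NV ^^ (p - k)) v)))"
      by (rule sum.triangle_reindex_eq)
    also have "\<dots> = (\<Sum>p\<le>K. \<Sum>k\<le>p. sV ((?x * tpi) ^ p / (fact k * fact (p - k))) (vmode V ((NV ^^ k) u) n ((NV ^^ (p - k)) v)))"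
      by (intro sum.cong refl) (simp flip: power_add)
    finally have "(\<Sum>p\<le>K. sV ((?x * tpi) ^ p / fact p) ((NV ^^ p) (vmode V u n v))) = \<dots>"
      using E'[of m] unfolding E3 by simp
    then show ?thesis
      by (simp add: W_def V.scale_right_diff_distrib sum_subtractf V.scale_sum_right power_mult_distrib
          times_divide_eq_right)
  qed
  then have P: "(\<Sum>p\<le>K. sV (x ^ p) (W p)) \<in> {0}" if "x \<in> range of_nat" for x using that by blast
  have "W 1 \<in> {0}"
    by (rule V.subspace_polynomial_coeffs[OF V.subspace_single_0 _ P])
      (auto simp: range_inj_infinite inj_of_nat K_def)
  then have "sV tpi (NV (vmode V u n v) - (vmode V (NV u) n v + vmode V u n (NV v))) = 0"
    by (simp add: W_def V.scale_right_diff_distrib V.scale_right_distrib algebra_simps)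
  then show ?thesis by simp
qed

lemma NV_vmode:
  assumes a: "a \<in> PV V g" and u: "u \<in> Vg V g a"
  shows "NV (vmode V u n v) = vmode V (NV u) n v + vmode V u n (NV v)"
proof -
  obtain f where f: "\<And>j. j \<in> PV V g \<Longrightarrow> f j \<in> Vg V g j" "\<And>j. j \<notin> PV V g \<Longrightarrow> f j = 0"
    "finite {j. f j \<noteq> 0}" "v = (\<Sum>j | f j \<noteq> 0. f j)"
    using direct_sum_decomposition[OF Vg_direct_sum, of "v"] by blast
  have "NV (vmode V u n (f j)) = vmode V (NV u) n (f j) + vmode V u n (NV (f j))" if "f j \<noteq> 0" for j
    using that f(1,2) NV_vmode_Vg[OF a _ u, of j "f j" n] by blast
  then show ?thesis unfolding f(4)
    by (simp add: linear_rules[OF vmode_linear_right] linear_rules[OF NV_linear] sum.distrib)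
qed

lemma vfield_eq: "vfield V u v (r, k) = (if k = 0 \<and> r \<in> \<int> then vmode V u (- \<lfloor>Re r\<rfloor> - 1) v else 0)"
  by (simp add: vfield_def vmode_def)

lemma vfield_linear_right: "Vector_Spaces.linear sV sV (\<lambda>v. vfield V u v m)"
proof (cases m)
  case (Pair r k)
  interpret VV: vector_space_pair sV sV by unfold_locales
  show ?thesis
  proof (cases "k = 0 \<and> r \<in> \<int>")
    case True
    then show ?thesis using vmode_linear_right[of u] by (simp add: Pair vfield_eq)
  next
    case False
    then show ?thesis using VV.linear_zero unfolding Pair vfield_eq by (simp only: if_False)
  qed
qed

lemma NV_vfield:
  assumes a: "a \<in> PV V g" and u: "u \<in> Vg V g a"
  shows "NV (vfield V u v m) - vfield V u (NV v) m = vfield V (NV u) v m"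
  using NV_vmode[OF a u] linear_rules(1)[OF NV_linear] by (cases m) (simp add: vfield_eq)

end

section \<open>Weak commutativity in coefficients\<close>

text \<open>The coefficient of \<open>(x\<^sub>1 - x\<^sub>2)\<^sup>M (F\<^sub>1(x\<^sub>1) F\<^sub>2(x\<^sub>2) - e F\<^sub>2(x\<^sub>2) F\<^sub>1(x\<^sub>1))\<close>
  at \<open>x\<^sub>1\<^bsup>r+M\<^esup> (log x\<^sub>1)\<^sup>k x\<^sub>2\<^sup>s (log x\<^sub>2)\<^sup>l\<close>.\<close>

definition comm_coeff :: "(complex \<Rightarrow> 'w \<Rightarrow> 'w) \<Rightarrow> nat \<Rightarrow> complex \<Rightarrow> ('w \<Rightarrow> mono1 \<Rightarrow> 'w)
    \<Rightarrow> ('w \<Rightarrow> mono1 \<Rightarrow> 'w) \<Rightarrow> mono1 \<Rightarrow> mono1 \<Rightarrow> 'w \<Rightarrow> 'w::ab_group_add" where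
  "comm_coeff sc M e F1 F2 m1 m2 w =
     (\<Sum>n\<le>M. sc ((- 1) ^ n * of_nat (M choose n))
        (F1 (F2 w (fst m2 - of_nat n, snd m2)) (fst m1 + of_nat n, snd m1)
         - sc e (F2 (F1 w (fst m1 + of_nat n, snd m1)) (fst m2 - of_nat n, snd m2))))"

context vsa_with_automorphism begin

section \<open>Weak commutativity in V from the Jacobi identity\<close>

lemma vmode_eventually_zero: "\<exists>M0::nat. \<forall>n\<ge>int M0. vmode V u n v = 0"
proof (intro exI allI impI)
  fix n assume "n \<ge> int (nat (- fls_subdegree (vertex_op V u v)))"
  then show "vmode V u n v = 0" unfolding vmode_def by (intro fls_eq0_below_subdegree) linarith
qed

text \<open>In the Jacobi identity take \<open>l = M\<close>: the right side contains only the modes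
  u_(M+i) v, which vanish, and the binomial coefficients cut both sums on the left at
  \<open>M\<close>. Reversing the second sum by i -> M - i aligns the two orders.\<close>

lemma vmode_weak_commutativity:
  assumes u: "u \<in> parity_space V s" and v: "v \<in> parity_space V t"
    and M: "\<And>n. n \<ge> int M \<Longrightarrow> vmode V u n v = 0"
  shows "(\<Sum>i\<le>M. sV ((- 1) ^ i * of_nat (M choose i))
        (vmode V u (m + int M - int i) (vmode V v (n + int i) w)
         - sV (koszul s t) (vmode V v (n + int i) (vmode V u (m + int M - int i) w)))) = 0"
proof -
  define P where "P i = sV ((- 1) ^ i * (of_int (int M) gchoose i))
      (vmode V u (m + int M - int i) (vmode V v (n + int i) w))" for i
  define Q where "Q i = sV ((- 1) powi int M * koszul s t * (- 1) ^ i * (of_int (int M) gchoose i))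
      (vmode V v (n + int M - int i) (vmode V u (m + int i) w))" for i
  define R where "R i = sV (of_int m gchoose i)
      (vmode V (vmode V u (int M + int i) v) (m + n - int i) w)" for i
  have "jacobi_identity V" using V by (simp add: grading_restricted_vertex_superalgebra_def)
  with u v have "(\<Sum>i | P i \<noteq> 0. P i) - (\<Sum>i | Q i \<noteq> 0. Q i) = (\<Sum>i | R i \<noteq> 0. R i)"
    unfolding jacobi_identity_def P_def Q_def R_def Let_def by blast
  moreover have "R i = 0" for i
    unfolding R_def using M[of "int M + int i"] linear_rules(1)[OF vmode_linear_left] by simp
  moreover have "P i = 0" "Q i = 0" if "i > M" for i
    using that by (auto simp: P_def Q_def simp flip: binomial_gbinomial)
  then have "(\<Sum>i | P i \<noteq> 0. P i) = (\<Sum>i\<le>M. P i)" "(\<Sum>i | Q i \<noteq> 0. Q i) = (\<Sum>i\<le>M. Q i)"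
    by (auto intro!: sum.mono_neutral_left simp: not_less[symmetric])
  moreover have "(\<Sum>i\<le>M. Q i) = (\<Sum>i\<le>M. Q (M - i))"
    by (rule sum.reindex_bij_witness[of _ "\<lambda>i. M - i" "\<lambda>i. M - i"]) auto
  ultimately have "(\<Sum>i\<le>M. P i - Q (M - i)) = 0" by (simp add: sum_subtractf)
  moreover have "P i - Q (M - i) = sV ((- 1) ^ i * of_nat (M choose i))
        (vmode V u (m + int M - int i) (vmode V v (n + int i) w)
         - sV (koszul s t) (vmode V v (n + int i) (vmode V u (m + int M - int i) w)))"
    if "i \<le> M" for i
  proof -
    have "(- 1 :: complex) ^ M * (- 1) ^ (M - i) = (- 1) ^ i"
      using that by (simp add: power_add[symmetric] uminus_power_if)
    then have "Q (M - i) = sV ((- 1) ^ i * of_nat (M choose i) * koszul s t)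
      (vmode V v (n + int i) (vmode V u (m + int M - int i) w))"
      using that by (simp add: Q_def binomial_symmetric[of i] of_nat_diff algebra_simps
          flip: binomial_gbinomial)
    then show ?thesis
      by (simp add: P_def V.scale_right_diff_distrib flip: binomial_gbinomial)
  qed
  ultimately show ?thesis by simp
qed

lemma vfield_weak_commutativity:
  assumes u: "u \<in> parity_space V s" and v: "v \<in> parity_space V t"
    and M: "\<And>n. n \<ge> int M \<Longrightarrow> vmode V u n v = 0"
  shows "comm_coeff sV M (koszul s t) (vfield V u) (vfield V v) m1 m2 w = 0"
proof -
  obtain r k r' k' where m: "m1 = (r, k)" "m2 = (r', k')" by (cases m1, cases m2)
  note vl = linear_rules[OF vmode_linear_left] and vr = linear_rules[OF vmode_linear_right]
  show ?thesis
  proof (cases "k = 0 \<and> k' = 0 \<and> r \<in> \<int> \<and> r' \<in> \<int>")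
    case False
    have "r' - of_nat n \<in> \<int> \<longleftrightarrow> r' \<in> \<int>" "r + of_nat n \<in> \<int> \<longleftrightarrow> r \<in> \<int>" for n
      by (metis Ints_add Ints_diff Ints_of_nat diff_add_cancel add_diff_cancel)+
    with False show ?thesis
      by (auto simp: m comm_coeff_def vfield_eq vl vr intro!: sum.neutral)
  next
    case True
    then obtain p q where "r = of_int p" "r' = of_int q" by (auto elim!: Ints_cases)
    \<comment> \<open>The exponent r corresponds to the mode -r - 1, so adding n to the exponent of
      x1 lowers the mode; the index \<open>m\<close> of the preceding lemma is therefore
      \<open>- p - 1 - int M\<close>.\<close>
    moreover have "- \<lfloor>Re (of_int p + of_nat n)\<rfloor> - 1 = (- p - 1 - int M) + int M - int n"
      "- \<lfloor>Re (of_int q - of_nat n)\<rfloor> - 1 = (- q - 1) + int n" for n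
      using floor_of_int[of "p + int n", where ?'a = real] floor_of_int[of "q - int n", where ?'a = real]
      by (simp_all del: floor_of_int)
    moreover have "(\<Sum>n\<le>M. sV ((- 1) ^ n * of_nat (M choose n))
        (vmode V u ((- p - 1 - int M) + int M - int n) (vmode V v ((- q - 1) + int n) w)
         - sV (koszul s t) (vmode V v ((- q - 1) + int n)
             (vmode V u ((- p - 1 - int M) + int M - int n) w)))) = 0"
      by (rule vmode_weak_commutativity[OF u v M])
    ultimately show ?thesis using True
      by (simp only: m comm_coeff_def vfield_eq fst_conv snd_conv Ints_of_int Ints_of_nat Ints_add
          Ints_diff simp_thms if_True)
  qed
qed

end

section \<open>The chain of fields generated by the nilpotent part\<close>

primrec Nidx_iter :: "('i, 'v) gen_fields \<Rightarrow> 'i \<Rightarrow> nat \<Rightarrow> 'i option" where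
  "Nidx_iter G i 0 = Some i"
| "Nidx_iter G i (Suc c) = Option.bind (Nidx_iter G i c) (Nidx G)"

lemma Nidx_iter_add: "Nidx_iter G i c = Some j \<Longrightarrow> Nidx_iter G i (c + d) = Nidx_iter G j d"
  by (induction d) auto

locale twisted_setting = vsa_with_automorphism V g
  for V :: "('v::ab_group_add) vertex_superalgebra" and g :: "'v g_action" +
  fixes G :: "('i, 'v) gen_fields" and T :: "('i, 'a, 'v, 'w::ab_group_add) twisted_fields"
  assumes gen: "generating_fields V g G"
    and data: "twisted_field_data V g G T"
    and spanning: "spanning_property G T"
    and g_action: "g_action_property V g G T"
    and weak_comm: "generalized_weak_commutativity V g G T"
begin

abbreviation "sW \<equiv> wscale T"
abbreviation "NW \<equiv> Ng (gact T)"

sublocale W: vector_space sW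
  using data by (simp add: twisted_field_data_def)

lemma ws: "vector_space sW" by unfold_locales

lemma NW_nil: "loc_nilpotent_op sW NW"
  and NW_linear: "Vector_Spaces.linear sW sW NW"
  using data by (auto simp: twisted_field_data_def exp_of_log_def jordan_parts_def
      loc_nilpotent_op_def)

lemma phi_linear: "i \<in> gidx G \<Longrightarrow> Vector_Spaces.linear sW sW (\<lambda>w. phi T i w m)"
  and phi_log_laurent: "i \<in> gidx G \<Longrightarrow> log_laurent (galpha G i) (phi T i w)"
  and psi_linear: "a \<in> aidx T \<Longrightarrow> Vector_Spaces.linear sV sW (\<lambda>v. psi T a v m)"
  and psi_log_laurent: "a \<in> aidx T \<Longrightarrow> b \<in> PV V g \<Longrightarrow> v \<in> Vg V g b \<Longrightarrow> log_laurent b (psi T a v)"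
  using data unfolding twisted_field_data_def by blast+

lemma gvec_in:
  assumes "i \<in> gidx G"
  shows "gwt G i \<in> half_ints" "gvec G i \<in> vhom V (gwt G i) (gpar G i)" "galpha G i \<in> PV V g"
    "gvec G i \<in> Vg V g (galpha G i)"
    "Nidx G i = None \<Longrightarrow> NV (gvec G i) = 0"
    "Nidx G i = Some j \<Longrightarrow> j \<in> gidx G \<and> NV (gvec G i) = gvec G j \<and> NV (gvec G i) \<noteq> 0"
  using gen assms by (auto simp: generating_fields_def)

lemma Nidx_iter_gvec:
  assumes "i \<in> gidx G" "Nidx_iter G i c = Some j"
  shows "j \<in> gidx G \<and> (NV ^^ c) (gvec G i) = gvec G j"
  using assms(2)
proof (induction c arbitrary: j)
  case 0
  then show ?case using assms(1) by simp
next
  case (Suc c)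
  then obtain j' where j': "Nidx_iter G i c = Some j'" "Nidx G j' = Some j"
    by (auto simp: bind_eq_Some_conv)
  then show ?case using Suc.IH[OF j'(1)] gvec_in(6)[of j' j] by simp
qed

lemma Nidx_iter_None_ge: "Nidx_iter G i c = None \<Longrightarrow> d \<ge> c \<Longrightarrow> Nidx_iter G i d = None"
  by (induction d) (auto simp: le_Suc_eq)

text \<open>If the K-th iterated index still exists, its vector is N^K of the original one, that is
  0; but \<open>Nidx\<close> is defined only where N of the vector is nonzero, so the next index is
  undefined.\<close>

lemma Nidx_iter_terminates:
  assumes i: "i \<in> gidx G"
  shows "\<exists>C. \<forall>c>C. Nidx_iter G i c = None"
proof -
  obtain K where K: "(NV ^^ K) (gvec G i) = 0" using NV_nil unfolding loc_nilpotent_op_def by blast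
  have "Nidx_iter G i (Suc K) = None"
  proof (cases "Nidx_iter G i K")
    case (Some j)
    with Nidx_iter_gvec[OF i Some] K have "j \<in> gidx G" "gvec G j = 0" by auto
    then have "Nidx G j = None" using gvec_in(6)[of j] linear_rules(1)[OF NV_linear]
      by (metis not_None_eq)
    then show ?thesis using Some by simp
  qed simp
  then show ?thesis using Nidx_iter_None_ge[of i "Suc K"] by (metis Suc_leI)
qed

definition chain_phi :: "'i \<Rightarrow> nat \<Rightarrow> 'w \<Rightarrow> mono1 \<Rightarrow> 'w" where
  "chain_phi i c = opt_field (phi T) (Nidx_iter G i c)"

text \<open>Formed from vectors instead of indices: where the iterated index is undefined the vector
  is 0 and so is the field, without a case distinction.\<close>

definition chain_vfield :: "'i \<Rightarrow> nat \<Rightarrow> 'v \<Rightarrow> mono1 \<Rightarrow> 'v" where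
  "chain_vfield i c = vfield V ((NV ^^ c) (gvec G i))"

lemma opt_phi_linear:
  assumes "set_option j \<subseteq> gidx G"
  shows "Vector_Spaces.linear sW sW (\<lambda>w. opt_field (phi T) j w m)"
proof -
  interpret WW: vector_space_pair sW sW by unfold_locales
  show ?thesis using assms phi_linear WW.linear_zero by (cases j) (auto simp: opt_field_def)
qed

lemma chain_phi_linear: "i \<in> gidx G \<Longrightarrow> Vector_Spaces.linear sW sW (\<lambda>w. chain_phi i c w m)"
  unfolding chain_phi_def by (rule opt_phi_linear) (use Nidx_iter_gvec in auto)

lemma log_branch_1: "log_branch p 1 = tpi * of_int p"
  using Arg2pi_eq_0[of 1] by (simp add: log_branch_def)

lemma branch_eq_sum:
  assumes "\<And>k. k > K \<Longrightarrow> F (r, k) = 0"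
  shows "branch sW p z F r = (\<Sum>k\<le>K. sW (exp (r * log_branch p z) * log_branch p z ^ k) (F (r, k)))"
  unfolding branch_def
  by (rule sum.mono_neutral_left) (use assms in \<open>auto simp: not_less[symmetric]\<close>)

lemma opt_phi_log_bound:
  assumes "set_option j \<subseteq> gidx G"
  shows "\<exists>K. \<forall>r k. K < k \<longrightarrow> opt_field (phi T) j w (r, k) = 0"
  using assms phi_log_laurent by (cases j) (auto simp: opt_field_def log_laurent_def)

text \<open>The branches determine the coefficients, since a polynomial vanishing at all points
  \<open>2\<pi>ip\<close> is zero.\<close>
lemma NW_phi:
  assumes i: "i \<in> gidx G"
  shows "NW (phi T i w m) - phi T i (NW w) m = opt_field (phi T) (Nidx G i) w m"
proof -
  have ad: "\<forall>i\<in>gidx G. \<forall>p z w r. z \<noteq> 0 \<longrightarrow>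
      NW (branch sW p z (phi T i w) r) - branch sW p z (phi T i (NW w)) r
      = branch sW p z (opt_field (phi T) (Nidx G i) w) r"
    using g_action unfolding g_action_property_def Let_def by (elim conjE)
  obtain r k where m: "m = (r, k)" by (cases m)
  have ni: "set_option (Nidx G i) \<subseteq> gidx G" using gvec_in(6)[OF i] by auto
  obtain K1 where K1: "\<forall>r k. K1 < k \<longrightarrow> phi T i w (r, k) = 0"
    using opt_phi_log_bound[of "Some i" w] i by (auto simp: opt_field_def)
  obtain K2 where K2: "\<forall>r k. K2 < k \<longrightarrow> phi T i (NW w) (r, k) = 0"
    using opt_phi_log_bound[of "Some i" "NW w"] i by (auto simp: opt_field_def)
  obtain K3 where K3: "\<forall>r k. K3 < k \<longrightarrow> opt_field (phi T) (Nidx G i) w (r, k) = 0"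
    using opt_phi_log_bound[OF ni] by blast
  define K where "K = K1 + K2 + K3 + k"
  define D where "D k = NW (phi T i w (r, k)) - phi T i (NW w) (r, k)
      - opt_field (phi T) (Nidx G i) w (r, k)" for k
  let ?A = "range (\<lambda>p::nat. log_branch (int p) 1)"
  have "(\<Sum>k\<le>K. sW (x ^ k) (D k)) \<in> {0}" if "x \<in> ?A" for x
  proof -
    from that obtain p where x: "x = log_branch p 1" by blast
    have "NW (branch sW p 1 (phi T i w) r) - branch sW p 1 (phi T i (NW w)) r
        = branch sW p 1 (opt_field (phi T) (Nidx G i) w) r"
      using ad i by simp
    moreover have "branch sW p 1 (phi T i w) r = (\<Sum>k\<le>K. sW (exp (r * x) * x ^ k) (phi T i w (r, k)))"
      unfolding x by (rule branch_eq_sum) (use K1 in \<open>simp add: K_def\<close>)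
    moreover have "branch sW p 1 (phi T i (NW w)) r = (\<Sum>k\<le>K. sW (exp (r * x) * x ^ k) (phi T i (NW w) (r, k)))"
      unfolding x by (rule branch_eq_sum) (use K2 in \<open>simp add: K_def\<close>)
    moreover have "branch sW p 1 (opt_field (phi T) (Nidx G i) w) r
        = (\<Sum>k\<le>K. sW (exp (r * x) * x ^ k) (opt_field (phi T) (Nidx G i) w (r, k)))"
      unfolding x by (rule branch_eq_sum) (use K3 in \<open>simp add: K_def\<close>)
    ultimately have "(\<Sum>k\<le>K. sW (exp (r * x) * x ^ k) (D k)) = 0"
      by (simp add: D_def linear_rules[OF NW_linear] W.scale_right_diff_distrib sum_subtractf)
    \<comment> \<open>The exponent \<open>r\<close> is fixed, so \<open>exp (r * x)\<close> is a
      common nonzero factor; without it a polynomial in \<open>x\<close> with coefficients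
      \<open>D k\<close> remains.\<close>
    then have "sW (exp (r * x)) (\<Sum>k\<le>K. sW (x ^ k) (D k)) = 0"
      by (simp add: W.scale_sum_right)
    then show ?thesis by simp
  qed
  moreover have "infinite ?A"
    by (rule range_inj_infinite) (auto intro!: injI simp: log_branch_1)
  ultimately have "D k \<in> {0}"
    using W.subspace_polynomial_coeffs[OF W.subspace_single_0, of ?A D K k] by (simp add: K_def)
  then show ?thesis by (simp add: D_def m)
qed

lemma NW_chain_phi:
  assumes i: "i \<in> gidx G"
  shows "NW (chain_phi i c w m) - chain_phi i c (NW w) m = chain_phi i (Suc c) w m"
  using NW_phi[of _ w m] Nidx_iter_gvec[OF i] linear_rules(1)[OF NW_linear]
  by (cases "Nidx_iter G i c") (auto simp: chain_phi_def opt_field_def)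

lemma NV_pow_gvec:
  assumes i: "i \<in> gidx G"
  shows "(NV ^^ c) (gvec G i) \<in> vhom V (gwt G i) (gpar G i)" "(NV ^^ c) (gvec G i) \<in> Vg V g (galpha G i)"
  by (induction c) (use gvec_in[OF i] NV_Vg NV_vhom in auto)

lemma NV_chain_vfield:
  assumes i: "i \<in> gidx G"
  shows "NV (chain_vfield i c v m) - chain_vfield i c (NV v) m = chain_vfield i (Suc c) v m"
  using NV_vfield[OF gvec_in(3)[OF i] NV_pow_gvec(2)[OF i]] by (simp add: chain_vfield_def)

lemma chain_terminates:
  assumes i: "i \<in> gidx G"
  shows "\<exists>C. \<forall>c>C. (\<forall>w m. chain_phi i c w m = 0) \<and> (\<forall>v m. chain_vfield i c v m = 0)"
proof -
  obtain C where C: "\<forall>c>C. Nidx_iter G i c = None" using Nidx_iter_terminates[OF i] by blast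
  obtain K where K: "(NV ^^ K) (gvec G i) = 0" using NV_nil unfolding loc_nilpotent_op_def by blast
  have "chain_vfield i c v m = 0" if "c > C + K" for c v m
    using V.funpow_linear_zero_ge[OF NV_linear K, of c] that linear_rules(1)[OF vmode_linear_left]
    by (cases m) (simp add: chain_vfield_def vfield_eq)
  then show ?thesis using C by (intro exI[of _ "C + K"]) (auto simp: chain_phi_def opt_field_def)
qed

text \<open>At most finitely many pairs \<open>c\<close>, \<open>d\<close> give nonzero fields, so
  one \<open>M\<close> bounds the truncation for all of them, and \<open>NV\<close> preserves
  parity, so the sign is constant along the chains. This \<open>M\<close> becomes the exponent in
  the theorem.\<close>

lemma chain_vfield_weak_commutativity:
  assumes ij: "i \<in> gidx G" "j \<in> gidx G"
  shows "\<exists>M>0. \<forall>c d m1 m2 v.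
    comm_coeff sV M (koszul (gpar G i) (gpar G j)) (chain_vfield i c) (chain_vfield j d) m1 m2 v = 0"
proof -
  have par: "(NV ^^ c) (gvec G i) \<in> parity_space V (gpar G i)" if "i \<in> gidx G" for i c
    unfolding parity_space_def using NV_pow_gvec(1)[OF that] gvec_in(1)[OF that]
    by (intro V.span_base) blast
  obtain C where C: "(NV ^^ C) (gvec G i) = 0" using NV_nil unfolding loc_nilpotent_op_def by blast
  obtain D where D: "(NV ^^ D) (gvec G j) = 0" using NV_nil unfolding loc_nilpotent_op_def by blast
  let ?u = "\<lambda>c. (NV ^^ c) (gvec G i)" and ?v = "\<lambda>d. (NV ^^ d) (gvec G j)"
  define m where "m c d = (SOME m0::nat. \<forall>n\<ge>int m0. vmode V (?u c) n (?v d) = 0)" for c d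
  have m: "\<forall>n\<ge>int (m c d). vmode V (?u c) n (?v d) = 0" for c d
    unfolding m_def by (rule someI_ex[OF vmode_eventually_zero])
  define M where "M = Suc (\<Sum>c\<le>C. \<Sum>d\<le>D. m c d)"
  have "vmode V (?u c) n (?v d) = 0" if n: "n \<ge> int M" for c d n
  proof (cases "c \<le> C \<and> d \<le> D")
    case True
    have "m c d \<le> (\<Sum>d\<le>D. m c d)" using True by (intro member_le_sum) auto
    also have "\<dots> \<le> (\<Sum>c\<le>C. \<Sum>d\<le>D. m c d)" using True by (intro member_le_sum[of c]) auto
    finally have "m c d \<le> M" by (simp add: M_def)
    then have "int (m c d) \<le> n" using n by linarith
    then show ?thesis using m[of c d] by blast
  next
    case False
    then have "?u c = 0 \<or> ?v d = 0"
      using V.funpow_linear_zero_ge[OF NV_linear C, of c] V.funpow_linear_zero_ge[OF NV_linear D, of d]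
      by auto
    then show ?thesis
      using linear_rules(1)[OF vmode_linear_left] linear_rules(1)[OF vmode_linear_right] by auto
  qed
  then have "comm_coeff sV M (koszul (gpar G i) (gpar G j)) (chain_vfield i c) (chain_vfield j d) m1 m2 v = 0"
    for c d m1 m2 v
    unfolding chain_vfield_def by (intro vfield_weak_commutativity par ij)
  then show ?thesis by (intro exI[of _ M]) (auto simp: M_def)
qed

section \<open>Lower truncation of the fields\<close>

lemma vfield_truncated: "\<exists>R. \<forall>m. Re (fst m) < R \<longrightarrow> vfield V u v m = 0"
proof (intro exI allI impI)
  fix m :: mono1 assume "Re (fst m) < of_int (fls_subdegree (vertex_op V u v))"
  then show "vfield V u v m = 0"
    by (cases m) (auto simp: vfield_def floor_less_iff intro!: fls_eq0_below_subdegree)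
qed

text \<open>Truncation is given on each \<open>Vg\<close> separately; a general \<open>v\<close> has
  finitely many components, and the least of their bounds works.\<close>

lemma psi_truncated:
  assumes a: "a \<in> aidx T"
  shows "\<exists>R. \<forall>m. Re (fst m) < R \<longrightarrow> psi T a v m = 0"
proof -
  obtain f where f: "\<forall>j\<in>PV V g. f j \<in> Vg V g j" "\<forall>j. j \<notin> PV V g \<longrightarrow> f j = 0"
    "finite {j. f j \<noteq> 0}" "v = (\<Sum>j | f j \<noteq> 0. f j)"
    using direct_sum_decomposition[OF Vg_direct_sum, of v] by blast
  have "\<exists>R. \<forall>r k. Re r < R \<longrightarrow> psi T a (f j) (r, k) = 0" if "f j \<noteq> 0" for j
    using psi_log_laurent[OF a, of j "f j"] f that unfolding log_laurent_def by blast
  then obtain R where R: "Re r < R j \<Longrightarrow> psi T a (f j) (r, k) = 0" if "f j \<noteq> 0" for j r k by metis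
  define R0 where "R0 = Min (insert 0 (R ` {j. f j \<noteq> 0}))"
  have "psi T a v m = 0" if "Re (fst m) < R0" for m
  proof -
    have "R0 \<le> R j" if "f j \<noteq> 0" for j unfolding R0_def using that f(3) by (intro Min_le) auto
    then have "psi T a (f j) m = 0" if "f j \<noteq> 0" for j
      using R[OF that, of "fst m" "snd m"] that \<open>Re (fst m) < R0\<close> by fastforce
    then show ?thesis unfolding f(4) linear_rules[OF psi_linear[OF a]] by simp
  qed
  then show ?thesis by blast
qed

end

section \<open>Series supported on a cone\<close>

text \<open>The series \<open>\<Sum> f\<^sub>s\<^sub>,\<^sub>j (x\<^sub>2/x\<^sub>1)\<^sup>s (log x\<^sub>1)\<^sup>j\<close>; all scalar series that occur have
  this form up to a shift and up to exchanging the variables.\<close>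

abbreviation coeff2 :: "complex fps fps \<Rightarrow> nat \<Rightarrow> nat \<Rightarrow> complex" where
  "coeff2 f s j \<equiv> fps_nth (fps_nth f s) j"

abbreviation cone :: "nat \<Rightarrow> nat \<Rightarrow> mono2" where
  "cone s j \<equiv> ((- of_nat s, j), (of_nat s, 0))"

definition cone_series :: "complex fps fps \<Rightarrow> mono2 \<Rightarrow> complex" where
  "cone_series f = (\<lambda>((r, k), (s, l)).
     if l = 0 \<and> s \<in> \<nat> \<and> r = - s then coeff2 f (nat \<lfloor>Re s\<rfloor>) k else 0)"

lemma cone_series_cone [simp]: "cone_series f (cone s j) = coeff2 f s j"
  by (simp add: cone_series_def)

lemma cone_series_nonzeroE:
  assumes "cone_series f m \<noteq> 0"
  obtains s j where "m = cone s j"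
  using assms by (cases m) (auto simp: cone_series_def Nats_def split: if_splits)

lemma cone_add: "cone s j + cone s' j' = cone (s + s') (j + j')"
  by simp

lemma coeff2_mult:
  "coeff2 (f * h) n p = (\<Sum>s\<le>n. \<Sum>j\<le>p. coeff2 f s j * coeff2 h (n - s) (p - j))"
  by (simp add: fps_mult_nth fps_sum_nth atMost_atLeast0)

text \<open>Cone series are power series in x2/x1 and log x1. A cone monomial splits into two cone
  monomials in finitely many ways, so the product is that of the ring
  \<open>complex fps fps\<close>, and powers and distributivity come for free.\<close>

lemma ser_mult_cone_series: "ser_mult (cone_series f) (cone_series h) = cone_series (f * h)"
proof
  fix m
  show "ser_mult (cone_series f) (cone_series h) m = cone_series (f * h) m"
  proof (cases "\<exists>n p. m = cone n p")
    case False
    have ne: "x + y \<noteq> m" if "cone_series f x \<noteq> 0" "cone_series h y \<noteq> 0" for x y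
    proof -
      obtain s j where x: "x = cone s j" using \<open>cone_series f x \<noteq> 0\<close> by (rule cone_series_nonzeroE)
      obtain s' j' where y: "y = cone s' j'" using \<open>cone_series h y \<noteq> 0\<close> by (rule cone_series_nonzeroE)
      show ?thesis using False unfolding x y cone_add by blast
    qed
    have empty: "{(x, y). x + y = m \<and> cone_series f x * cone_series h y \<noteq> 0} = {}"
    proof (rule equals0I)
      fix z assume "z \<in> {(x, y). x + y = m \<and> cone_series f x * cone_series h y \<noteq> 0}"
      then obtain x y where "x + y = m" "cone_series f x \<noteq> 0" "cone_series h y \<noteq> 0" by auto
      with ne show False by blast
    qed
    have "cone_series (f * h) m = 0" using False by (meson cone_series_nonzeroE)
    then show ?thesis unfolding ser_mult_def empty by simp
  next
    case True
    then obtain n p where m: "m = cone n p" by blast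
    let ?h = "\<lambda>(s, j). (cone s j, cone (n - s) (p - j))"
    let ?D = "{..n} \<times> {..p}"
    have inj: "inj_on ?h ?D" by (auto simp: inj_on_def)
    have "ser_mult (cone_series f) (cone_series h) m
        = (\<Sum>(x, y)\<in>?h ` ?D. cone_series f x * cone_series h y)"
      unfolding ser_mult_def
    proof (rule sum.mono_neutral_left)
      show "{(x, y). x + y = m \<and> cone_series f x * cone_series h y \<noteq> 0} \<subseteq> ?h ` ?D"
      proof
        fix z assume "z \<in> {(x, y). x + y = m \<and> cone_series f x * cone_series h y \<noteq> 0}"
        then obtain x y where z: "z = (x, y)" and eq: "x + y = m"
          and nz: "cone_series f x \<noteq> 0" "cone_series h y \<noteq> 0" by auto
        obtain s j where x: "x = cone s j" using nz(1) by (rule cone_series_nonzeroE)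
        obtain s' j' where y: "y = cone s' j'" using nz(2) by (rule cone_series_nonzeroE)
        from eq have "n = s + s'" "p = j + j'"
          unfolding x y m cone_add prod.inject of_nat_eq_iff by auto
        then show "z \<in> ?h ` ?D"
          unfolding z x y by (intro image_eqI[of _ _ "(s, j)"]) auto
      qed
      show "\<forall>i\<in>?h ` ?D - {(x, y). x + y = m \<and> cone_series f x * cone_series h y \<noteq> 0}.
          (case i of (x, y) \<Rightarrow> cone_series f x * cone_series h y) = 0"
      proof
        fix z
        assume z: "z \<in> ?h ` ?D - {(x, y). x + y = m \<and> cone_series f x * cone_series h y \<noteq> 0}"
        then have "z \<in> ?h ` ?D" by blast
        then obtain s j where sj: "s \<le> n" "j \<le> p" and z': "z = (cone s j, cone (n - s) (p - j))"
          by (elim imageE) (auto simp del: of_nat_diff)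
        have "cone s j + cone (n - s) (p - j) = m" unfolding cone_add m using sj by simp
        with z show "(case z of (x, y) \<Rightarrow> cone_series f x * cone_series h y) = 0"
          unfolding z' Diff_iff mem_Collect_eq prod.case by blast
      qed
    qed auto
    also have "\<dots> = (\<Sum>(s, j)\<in>?D. coeff2 f s j * coeff2 h (n - s) (p - j))"
      by (subst sum.reindex[OF inj], intro sum.cong refl) (auto simp del: of_nat_diff)
    also have "\<dots> = cone_series (f * h) m"
      by (simp only: m cone_series_cone coeff2_mult sum.cartesian_product)
    finally show ?thesis .
  qed
qed

lemma ser_pow_cone_series: "ser_pow (cone_series f) k = cone_series (f ^ k)"
proof (induction k)
  case 0
  show ?case
    by (auto simp: fun_eq_iff cone_series_def zero_prod_def Nats_def)
next
  case (Suc k)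
  then show ?case by (simp add: ser_mult_cone_series)
qed

text \<open>The operator coefficient of y^N at (x2/x1)^s (log x1)^j, with \<open>f\<close> standing
  for log y.\<close>

definition nil_coeff ::
    "(complex \<Rightarrow> 'v \<Rightarrow> 'v) \<Rightarrow> complex fps fps \<Rightarrow> ('v \<Rightarrow> 'v) \<Rightarrow> nat \<Rightarrow> nat \<Rightarrow> 'v \<Rightarrow> 'v::ab_group_add" where
  "nil_coeff sc f N s j v = (\<Sum>k | (N ^^ k) v \<noteq> 0. sc (coeff2 (f ^ k) s j / fact k) ((N ^^ k) v))"

lemma nil_pow_cone: "nil_pow sc (cone_series f) N v (cone s j) = nil_coeff sc f N s j v"
  by (simp only: nil_pow_def nil_coeff_def ser_pow_cone_series cone_series_cone)

lemma nil_pow_nonzeroE: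
  assumes "vector_space sc" "nil_pow sc (cone_series f) N v m \<noteq> 0"
  obtains s j where "m = cone s j"
proof -
  interpret vector_space sc by fact
  obtain k where "sc (ser_pow (cone_series f) k m / fact k) ((N ^^ k) v) \<noteq> 0"
    using assms(2) sum.not_neutral_contains_not_neutral unfolding nil_pow_def by blast
  then have "cone_series (f ^ k) m \<noteq> 0" by (auto simp: ser_pow_cone_series)
  then show thesis using that by (elim cone_series_nonzeroE)
qed

lemma nil_coeff_eq_sum:
  assumes "vector_space sc" "\<And>k. k > K \<Longrightarrow> (N ^^ k) v = 0"
  shows "nil_coeff sc f N s j v = (\<Sum>k\<le>K. sc (coeff2 (f ^ k) s j / fact k) ((N ^^ k) v))"
proof -
  interpret vector_space sc by fact
  show ?thesis unfolding nil_coeff_def by (rule sum_nilpotent_bound) (use assms in auto)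
qed

lemma nil_coeff_linear:
  assumes vs: "vector_space sc" and N: "loc_nilpotent_op sc N"
  shows "Vector_Spaces.linear sc sc (nil_coeff sc f N s j)"
proof -
  interpret vector_space sc by fact
  have lin: "Vector_Spaces.linear sc sc N" using N by (simp add: loc_nilpotent_op_def)
  note Nk = linear_rules[OF linear_funpow[OF lin]]
  have nil: "\<exists>K. \<forall>k>K. (N ^^ k) v = 0" for v
    using N funpow_linear_zero_ge[OF lin] unfolding loc_nilpotent_op_def by (metis less_imp_le)
  show ?thesis
    unfolding Vector_Spaces.linear_def module_hom_def module_hom_axioms_def
  proof (intro conjI allI vs)
    fix v w
    obtain K1 K2 where K: "\<forall>k>K1. (N ^^ k) v = 0" "\<forall>k>K2. (N ^^ k) w = 0" using nil by metis
    then have "(N ^^ k) v = 0" "(N ^^ k) w = 0" "(N ^^ k) (v + w) = 0" if "k > K1 + K2" for k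
      using that by (simp_all add: Nk)
    note S = nil_coeff_eq_sum[OF vs this(1)] nil_coeff_eq_sum[OF vs this(2)] nil_coeff_eq_sum[OF vs this(3)]
    show "nil_coeff sc f N s j (v + w) = nil_coeff sc f N s j v + nil_coeff sc f N s j w"
      by (simp add: S Nk scale_right_distrib sum.distrib)
  next
    fix c v
    obtain K where K: "\<forall>k>K. (N ^^ k) v = 0" using nil by metis
    then have "(N ^^ k) v = 0" "(N ^^ k) (sc c v) = 0" if "k > K" for k
      using that by (simp_all add: Nk)
    note S = nil_coeff_eq_sum[OF vs this(1)] nil_coeff_eq_sum[OF vs this(2)]
    show "nil_coeff sc f N s j (sc c v) = sc c (nil_coeff sc f N s j v)"
      by (simp add: S Nk scale_sum_right mult.commute)
  qed unfold_locales
qed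

text \<open>The left factor lives on the cone shifted by x1^b, so \<open>s\<close> and
  \<open>j\<close> determine both monomials of a contributing pair, and \<open>j\<close> cannot
  exceed \<open>k\<close>. Only \<open>s\<close> needs the bound \<open>S\<close>; it also secures
  finiteness, since \<open>op_comp\<close> would assign 0 to an infinite family.\<close>

lemma op_comp_cone:
  fixes A :: "'u::ab_group_add \<Rightarrow> mono2 \<Rightarrow> 'w::ab_group_add"
  assumes A: "\<And>w s j. A w ((b - of_nat s, j), (of_nat s, 0)) = a s j w"
    and A0: "\<And>w m. A w m \<noteq> 0 \<Longrightarrow> \<exists>s j. m = ((b - of_nat s, j), (of_nat s, 0))"
    and S: "\<And>s j. s > S \<Longrightarrow> a s j (B v ((r - b + of_nat s, k - j), (t - of_nat s, l))) = 0"
  shows "(A \<odot> B) v ((r, k), (t, l))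
    = (\<Sum>s\<le>S. \<Sum>j\<le>k. a s j (B v ((r - b + of_nat s, k - j), (t - of_nat s, l))))"
proof -
  let ?h = "\<lambda>(s, j). (((b - of_nat s, j), (of_nat s, 0)), ((r - b + of_nat s, k - j), (t - of_nat s, l)))"
  let ?D = "{..S} \<times> {..k}"
  have inj: "inj_on ?h ?D" by (auto simp: inj_on_def)
  have "(A \<odot> B) v ((r, k), (t, l)) = (\<Sum>(p, q)\<in>?h ` ?D. A (B v q) p)"
    unfolding op_comp_def
  proof (rule sum.mono_neutral_left)
    show "{(p, q). p + q = ((r, k), (t, l)) \<and> A (B v q) p \<noteq> 0} \<subseteq> ?h ` ?D"
    proof clarify
      fix x1 x2 x3 x4 y1 y2 y3 y4
      assume eq: "((x1, x2), x3, x4) + ((y1, y2), y3, y4) = ((r, k), (t, l))"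
        and nz: "A (B v ((y1, y2), y3, y4)) ((x1, x2), x3, x4) \<noteq> 0"
      from A0[OF nz] obtain s j where x: "((x1, x2), x3, x4) = ((b - of_nat s, j), (of_nat s, 0))" by blast
      have y: "((y1, y2), y3, y4) = ((r - b + of_nat s, k - j), (t - of_nat s, l))" and j: "j \<le> k"
        using eq unfolding x by (auto simp: algebra_simps)
      have "s \<le> S" using S[of s j] nz unfolding x y A by (metis not_less)
      then show "(((x1, x2), x3, x4), ((y1, y2), y3, y4)) \<in> ?h ` ?D"
        unfolding x y using j by (intro image_eqI[of _ _ "(s, j)"]) auto
    qed
    show "\<forall>i\<in>?h ` ?D - {(p, q). p + q = ((r, k), (t, l)) \<and> A (B v q) p \<noteq> 0}.
        (case i of (p, q) \<Rightarrow> A (B v q) p) = 0"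
      by auto
  qed auto
  also have "\<dots> = (\<Sum>(s, j)\<in>?D. a s j (B v ((r - b + of_nat s, k - j), (t - of_nat s, l))))"
    by (subst sum.reindex[OF inj], intro sum.cong refl) (auto simp: A)
  also have "\<dots> = (\<Sum>s\<le>S. \<Sum>j\<le>k. a s j (B v ((r - b + of_nat s, k - j), (t - of_nat s, l))))"
    by (simp add: sum.cartesian_product)
  finally show ?thesis .
qed

lemma op_comp_nil_pow:
  assumes vs: "vector_space sc" and N: "loc_nilpotent_op sc N"
    and S: "\<And>s j. s > S \<Longrightarrow> B v ((r + of_nat s, j), (t - of_nat s, l)) = 0"
  shows "(nil_pow sc (cone_series f) N \<odot> B) v ((r, k), (t, l))
    = (\<Sum>s\<le>S. \<Sum>j\<le>k. nil_coeff sc f N s j (B v ((r + of_nat s, k - j), (t - of_nat s, l))))"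
proof -
  have "(nil_pow sc (cone_series f) N \<odot> B) v ((r, k), (t, l))
    = (\<Sum>s\<le>S. \<Sum>j\<le>k. nil_coeff sc f N s j (B v ((r - 0 + of_nat s, k - j), (t - of_nat s, l))))"
  proof (rule op_comp_cone)
    fix w s j
    show "nil_pow sc (cone_series f) N w ((0 - of_nat s, j), (of_nat s, 0)) = nil_coeff sc f N s j w"
      using nil_pow_cone[of sc f N w s j] by simp
    fix m assume "nil_pow sc (cone_series f) N w m \<noteq> 0"
    then show "\<exists>s j. m = ((0 - of_nat s, j), (of_nat s, 0))"
      using nil_pow_nonzeroE[OF vs] by (metis diff_0)
  qed (use S linear_rules(1)[OF nil_coeff_linear[OF vs N]] in auto)
  then show ?thesis by simp
qed

lemma op_comp_in_x1:
  assumes F0: "\<And>m. F 0 m = 0"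
    and B: "\<And>q. B v (q, (t, l)) \<noteq> 0 \<Longrightarrow> \<exists>s\<le>S. \<exists>j. q = (- of_nat s, j)"
  shows "(in_x1 F \<odot> B) v ((r, k), (t, l))
    = (\<Sum>s\<le>S. \<Sum>j\<le>k. F (B v ((- of_nat s, j), (t, l))) (r + of_nat s, k - j))"
proof -
  let ?h = "\<lambda>(s, j). (((r + of_nat s, k - j), (0, 0)), ((- of_nat s, j), (t, l)))"
  let ?D = "{..S} \<times> {..k}"
  have inj: "inj_on ?h ?D" by (auto simp: inj_on_def)
  have "(in_x1 F \<odot> B) v ((r, k), (t, l)) = (\<Sum>(p, q)\<in>?h ` ?D. in_x1 F (B v q) p)"
    unfolding op_comp_def
  proof (rule sum.mono_neutral_left)
    show "{(p, q). p + q = ((r, k), (t, l)) \<and> in_x1 F (B v q) p \<noteq> 0} \<subseteq> ?h ` ?D"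
    proof clarify
      fix x1 x2 x3 x4 y1 y2 y3 y4
      assume eq: "((x1, x2), x3, x4) + ((y1, y2), y3, y4) = ((r, k), (t, l))"
        and nz: "in_x1 F (B v ((y1, y2), y3, y4)) ((x1, x2), x3, x4) \<noteq> 0"
      have x: "x3 = 0" "x4 = 0" using nz by (auto simp: in_x1_def zero_prod_def split: if_splits)
      with eq have y34: "y3 = t" "y4 = l" by auto
      have "B v ((y1, y2), (t, l)) \<noteq> 0" using nz F0 y34 by (auto simp: in_x1_def split: if_splits)
      from B[OF this] obtain s j where s: "s \<le> S" and y: "y1 = - of_nat s" "y2 = j" by auto
      with eq have "x1 = r + of_nat s" "x2 = k - j" "j \<le> k" by (auto simp: algebra_simps)
      then show "(((x1, x2), x3, x4), ((y1, y2), y3, y4)) \<in> ?h ` ?D"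
        using s x y y34 by (intro image_eqI[of _ _ "(s, j)"]) auto
    qed
    show "\<forall>i\<in>?h ` ?D - {(p, q). p + q = ((r, k), (t, l)) \<and> in_x1 F (B v q) p \<noteq> 0}.
        (case i of (p, q) \<Rightarrow> in_x1 F (B v q) p) = 0"
      by auto
  qed auto
  also have "\<dots> = (\<Sum>(s, j)\<in>?D. F (B v ((- of_nat s, j), (t, l))) (r + of_nat s, k - j))"
    by (subst sum.reindex[OF inj], intro sum.cong refl) (auto simp: in_x1_def zero_prod_def)
  also have "\<dots> = (\<Sum>s\<le>S. \<Sum>j\<le>k. F (B v ((- of_nat s, j), (t, l))) (r + of_nat s, k - j))"
    by (simp add: sum.cartesian_product)
  finally show ?thesis .
qed

text \<open>A field in x2 leaves the x1-part of the monomial untouched, so the x1-part already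
  determines which cone monomial of the right factor enters: a single pair contributes.\<close>

lemma op_comp_in_x2:
  assumes F0: "\<And>m. F 0 m = 0" and B: "\<And>q. B v q \<noteq> 0 \<Longrightarrow> \<exists>s j. q = cone s j"
  shows "(in_x2 F \<odot> B) v ((- of_nat s, j), (r, k)) = F (B v (cone s j)) (r - of_nat s, k)"
    and "(in_x2 F \<odot> B) v ((t, l), (r, k)) \<noteq> 0 \<Longrightarrow> \<exists>s. t = - of_nat s"
proof -
  have *: "q = cone s j \<and> p = ((0, 0), (r - of_nat s, k))"
    if eq: "p + q = ((- of_nat s, j), (r, k))" and nz: "in_x2 F (B v q) p \<noteq> 0" for p q s j
  proof -
    have p0: "fst p = 0" using nz by (auto simp: in_x2_def split: if_splits prod.splits)
    have "B v q \<noteq> 0" using nz F0 by (auto simp: in_x2_def split: if_splits prod.splits)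
    from B[OF this] obtain s' j' where q: "q = cone s' j'" by blast
    show ?thesis using eq p0 unfolding q by (cases p) (auto simp: algebra_simps zero_prod_def)
  qed
  show "(in_x2 F \<odot> B) v ((- of_nat s, j), (r, k)) = F (B v (cone s j)) (r - of_nat s, k)"
  proof -
    have "(in_x2 F \<odot> B) v ((- of_nat s, j), (r, k))
      = (\<Sum>(p, q)\<in>{(((0, 0), (r - of_nat s, k)), cone s j)}. in_x2 F (B v q) p)"
      unfolding op_comp_def
    proof (rule sum.mono_neutral_left)
      show "{(p, q). p + q = ((- of_nat s, j), (r, k)) \<and> in_x2 F (B v q) p \<noteq> 0}
          \<subseteq> {(((0, 0), (r - of_nat s, k)), cone s j)}"
      proof
        fix z assume "z \<in> {(p, q). p + q = ((- of_nat s, j), (r, k)) \<and> in_x2 F (B v q) p \<noteq> 0}"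
        then have "fst z + snd z = ((- of_nat s, j), (r, k))" "in_x2 F (B v (snd z)) (fst z) \<noteq> 0"
          by (simp_all add: split_beta)
        from *[OF this] show "z \<in> {(((0, 0), (r - of_nat s, k)), cone s j)}"
          by (metis prod.collapse singletonI)
      qed
    qed auto
    then show ?thesis by (simp add: in_x2_def zero_prod_def)
  qed
  assume "(in_x2 F \<odot> B) v ((t, l), (r, k)) \<noteq> 0"
  then obtain p q where eq: "p + q = ((t, l), (r, k))" and nz: "in_x2 F (B v q) p \<noteq> 0"
    unfolding op_comp_def by (elim sum.not_neutral_contains_not_neutral) blast
  have p0: "fst p = 0" using nz by (auto simp: in_x2_def split: if_splits prod.splits)
  have "B v q \<noteq> 0" using nz F0 by (auto simp: in_x2_def split: if_splits prod.splits)
  from B[OF this] obtain s' j' where q: "q = cone s' j'" by blast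
  show "\<exists>s. t = - of_nat s" using eq p0 unfolding q by (cases p) auto
qed

text \<open>Regrouping by the totals n = s + s' and p = j + j'; the terms with s + s' beyond
  \<open>S\<close> vanish, which makes the square in s, s' a triangle.\<close>

lemma sum_convolution:
  fixes H :: "nat \<Rightarrow> nat \<Rightarrow> nat \<Rightarrow> nat \<Rightarrow> 'w::comm_monoid_add"
  assumes "\<And>s j s' j'. s + s' > S \<Longrightarrow> H s j s' j' = 0"
  shows "(\<Sum>s\<le>S. \<Sum>j\<le>k. \<Sum>s'\<le>S. \<Sum>j'\<le>k - j. H s j s' j')
    = (\<Sum>n\<le>S. \<Sum>p\<le>k. \<Sum>s\<le>n. \<Sum>j\<le>p. H s j (n - s) (p - j))"
proof -
  have "(\<Sum>s\<le>S. \<Sum>j\<le>k. \<Sum>s'\<le>S. \<Sum>j'\<le>k - j. H s j s' j')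
    = (\<Sum>(s, j, s', j')\<in>(SIGMA s:{..S}. SIGMA j:{..k}. SIGMA s':{..S}. {..k - j}). H s j s' j')"
    by (simp add: sum.Sigma split_beta)
  also have "\<dots> = (\<Sum>(n, p, s, j)\<in>(SIGMA n:{..S}. SIGMA p:{..k}. SIGMA s:{..n}. {..p}). H s j (n - s) (p - j))"
    by (rule sum.reindex_bij_witness_not_neutral[of
          "{x \<in> (SIGMA s:{..S}. SIGMA j:{..k}. SIGMA s':{..S}. {..k - j}). S < fst x + fst (snd (snd x))}" "{}"
          _ "\<lambda>(n, p, s, j). (s, j, n - s, p - j)" "\<lambda>(s, j, s', j'). (s + s', j + j', s, j)"])
      (use assms in \<open>auto\<close>)
  also have "\<dots> = (\<Sum>n\<le>S. \<Sum>p\<le>k. \<Sum>s\<le>n. \<Sum>j\<le>p. H s j (n - s) (p - j))"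
    by (simp add: sum.Sigma split_beta)
  finally show ?thesis .
qed

section \<open>Conjugation by a nilpotent power\<close>

text \<open>Leibniz rule for iterated commutators: moving one N across \<open>F c\<close> gives
  \<open>F c\<close> followed by N' plus \<open>F (Suc c)\<close>, and Pascal's rule collects the
  terms.\<close>

lemma funpow_ad_expansion:
  assumes vs: "vector_space sc" and N: "Vector_Spaces.linear sc sc N"
    and ad: "\<And>c u. N (F c u) = F c (N' u) + F (Suc c) u"
  shows "(N ^^ a) (F c u) = (\<Sum>i\<le>a. sc (of_nat (a choose i)) (F (c + i) ((N' ^^ (a - i)) u)))"
proof (induction a arbitrary: c u)
  case 0
  interpret vector_space sc by fact
  show ?case by simp
next
  case (Suc a)
  interpret vector_space sc by fact
  let ?Z = "\<lambda>i n. F (c + i) ((N' ^^ n) u)"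
  have "(N ^^ Suc a) (F c u) = (N ^^ a) (F c (N' u)) + (N ^^ a) (F (Suc c) u)"
    by (simp add: funpow_Suc_right ad linear_rules[OF linear_funpow[OF N]] del: funpow.simps)
  also have "\<dots> = (\<Sum>i\<le>a. sc (of_nat (a choose i)) (?Z i (Suc a - i)))
      + (\<Sum>i\<le>a. sc (of_nat (a choose i)) (?Z (Suc i) (a - i)))"
    unfolding Suc.IH
    by (intro arg_cong2[where f = "(+)"] sum.cong refl)
      (auto simp: Suc_diff_le funpow_Suc_right simp del: funpow.simps)
  also have "(\<Sum>i\<le>a. sc (of_nat (a choose i)) (?Z i (Suc a - i)))
      = (\<Sum>i\<le>Suc a. sc (of_nat (a choose i)) (?Z i (Suc a - i)))"
    by (simp add: binomial_eq_0)
  also have "\<dots> = ?Z 0 (Suc a) + (\<Sum>i\<le>a. sc (of_nat (a choose Suc i)) (?Z (Suc i) (a - i)))"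
    by (subst sum.atMost_Suc_shift) (simp del: funpow.simps)
  also have "\<dots> + (\<Sum>i\<le>a. sc (of_nat (a choose i)) (?Z (Suc i) (a - i)))
      = ?Z 0 (Suc a) + (\<Sum>i\<le>a. sc (of_nat (Suc a choose Suc i)) (?Z (Suc i) (a - i)))"
    by (simp add: scale_left_distrib sum.distrib algebra_simps del: funpow.simps)
  also have "\<dots> = (\<Sum>i\<le>Suc a. sc (of_nat (Suc a choose i)) (?Z i (Suc a - i)))"
    by (subst sum.atMost_Suc_shift) (simp del: funpow.simps)
  finally show ?case .
qed

text \<open>The expansion of (1 - 1)^n divided by n!; it removes every power of N' left over by a
  conjugation.\<close>

lemma alternating_fact_sum:
  "(\<Sum>b\<le>n. (- 1) ^ b / (fact b * fact (n - b)) :: complex) = (if n = 0 then 1 else 0)"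
proof (cases "n = 0")
  case False
  have "(\<Sum>b\<le>n. (- 1) ^ b / (fact b * fact (n - b)) :: complex)
      = (\<Sum>b\<le>n. (- 1) ^ b * of_nat (n choose b)) / fact n"
    unfolding sum_divide_distrib by (intro sum.cong refl) (simp add: binomial_fact)
  then show ?thesis using False choose_alternating_sum[of n, where 'a = complex] by simp
qed simp

text \<open>\<open>y\<^sup>N F y\<^sup>-\<^sup>N = \<Sum> (log y)\<^sup>c / c! (ad N)\<^sup>c F\<close>, where \<open>F c\<close> is \<open>(ad N)\<^sup>c F\<close>.\<close>
lemma nil_coeff_conjugation:
  assumes vs: "vector_space sc" and vs': "vector_space sc'"
    and N: "loc_nilpotent_op sc N" and N': "loc_nilpotent_op sc' N'"
    and F: "\<And>c. Vector_Spaces.linear sc' sc (F c)"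
    and ad: "\<And>c u. N (F c u) - F c (N' u) = F (Suc c) u"
    and C: "\<And>c u. c > C \<Longrightarrow> F c u = 0"
  shows "(\<Sum>s\<le>n. \<Sum>j\<le>p. nil_coeff sc f N s j (F 0 (nil_coeff sc' f (\<lambda>w. - N' w) (n - s) (p - j) w)))
    = (\<Sum>c\<le>C. sc (coeff2 (f ^ c) n p / fact c) (F c w))"
proof -
  interpret vector_space sc by fact
  interpret V': vector_space sc' by fact
  have Nl: "Vector_Spaces.linear sc sc N" and Nl': "Vector_Spaces.linear sc' sc' N'"
    using N N' by (auto simp: loc_nilpotent_op_def)
  note Fr = linear_rules[OF F]
  note N'r = linear_rules[OF V'.linear_funpow[OF Nl']]
  note nr = linear_rules[OF nil_coeff_linear[OF vs N]]
  have ad': "N (F c u) = F c (N' u) + F (Suc c) u" for c u using ad[of c u] by (simp add: algebra_simps)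
  note exp = funpow_ad_expansion[where sc = sc and N = N and F = F and N' = N', OF vs Nl ad']
  obtain K where K: "(N' ^^ K) w = 0" using N' by (auto simp: loc_nilpotent_op_def)
  have K': "(N' ^^ k) w = 0" if "k > K" for k
    using V'.funpow_linear_zero_ge[OF Nl' K] that by simp
  \<comment> \<open>After the commutator expansion, a term with a > C + K has more than C
    commutators or more than K powers of N', so it vanishes.\<close>
  define A where "A = C + K"
  have minus: "((\<lambda>w. - N' w) ^^ b) u = sc' ((- 1) ^ b) ((N' ^^ b) u)" for b u
    by (induction b) (simp_all add: linear_rules[OF Nl'] V'.scale_minus_left)
  have E': "nil_coeff sc' f (\<lambda>w. - N' w) s j w
      = (\<Sum>b\<le>A. sc' (coeff2 (f ^ b) s j / fact b * (- 1) ^ b) ((N' ^^ b) w))" for s j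
  proof -
    have "((\<lambda>w. - N' w) ^^ b) w = 0" if "b > A" for b using K' that by (simp add: minus A_def)
    from nil_coeff_eq_sum[OF vs' this, of A] show ?thesis by (simp add: minus)
  qed
  have NFN: "(N ^^ a) (F 0 ((N' ^^ b) w))
      = (\<Sum>i\<le>a. sc (of_nat (a choose i)) (F i ((N' ^^ (a - i + b)) w)))" for a b
    unfolding exp by (simp only: funpow_add comp_apply add_0)
  have "(N ^^ a) (F 0 ((N' ^^ b) w)) = 0" if "a > A" for a b
    unfolding NFN
  proof (rule sum.neutral, rule ballI)
    fix i assume "i \<in> {..a}"
    show "sc (of_nat (a choose i)) (F i ((N' ^^ (a - i + b)) w)) = 0"
      using C[of i] K'[of "a - i + b"] that Fr(1)[of i] by (cases "i > C") (auto simp: A_def)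
  qed
  then have E: "nil_coeff sc f N s j (F 0 ((N' ^^ b) w))
      = (\<Sum>a\<le>A. sc (coeff2 (f ^ a) s j / fact a) ((N ^^ a) (F 0 ((N' ^^ b) w))))" for s j b
    by (rule nil_coeff_eq_sum[OF vs])
  let ?g = "\<lambda>a b. (- 1) ^ b / (fact a * fact b) :: complex"
  have "nil_coeff sc f N s j (F 0 (nil_coeff sc' f (\<lambda>w. - N' w) s' j' w))
    = (\<Sum>b\<le>A. \<Sum>a\<le>A. sc (?g a b * (coeff2 (f ^ a) s j * coeff2 (f ^ b) s' j')) ((N ^^ a) (F 0 ((N' ^^ b) w))))"
    for s j s' j'
    unfolding E' Fr(6) Fr(5) nr(6) nr(5) E scale_sum_right
    by (intro sum.cong refl) (simp add: mult_ac)
  then have "(\<Sum>s\<le>n. \<Sum>j\<le>p. nil_coeff sc f N s j (F 0 (nil_coeff sc' f (\<lambda>w. - N' w) (n - s) (p - j) w)))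
    = (\<Sum>s\<le>n. \<Sum>j\<le>p. \<Sum>b\<le>A. \<Sum>a\<le>A. sc (?g a b * (coeff2 (f ^ a) s j * coeff2 (f ^ b) (n - s) (p - j))) ((N ^^ a) (F 0 ((N' ^^ b) w))))"
    by simp
  also have "\<dots> = (\<Sum>b\<le>A. \<Sum>a\<le>A. \<Sum>s\<le>n. \<Sum>j\<le>p. sc (?g a b * (coeff2 (f ^ a) s j * coeff2 (f ^ b) (n - s) (p - j))) ((N ^^ a) (F 0 ((N' ^^ b) w))))"
    by (simp only: sum.swap[where A = "{..p}"] sum.swap[where A = "{..n}" and B = "{..A}"])
  also have "\<dots> = (\<Sum>b\<le>A. \<Sum>a\<le>A. sc (?g a b * coeff2 (f ^ (a + b)) n p) ((N ^^ a) (F 0 ((N' ^^ b) w))))"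
    by (simp only: power_add coeff2_mult scale_sum_left sum_distrib_left)
  also have "\<dots> = (\<Sum>b\<le>A. \<Sum>a\<le>A. \<Sum>i\<le>a. sc ((- 1) ^ b / (fact b * fact (a - i)) * (coeff2 (f ^ (a + b)) n p / fact i)) (F i ((N' ^^ (a - i + b)) w)))"
    unfolding NFN scale_sum_right
    by (intro sum.cong refl) (simp add: binomial_fact field_simps)
  also have "\<dots> = (\<Sum>(b, a, i)\<in>(SIGMA b:{..A}. SIGMA a:{..A}. {..a}). sc ((- 1) ^ b / (fact b * fact (a - i)) * (coeff2 (f ^ (a + b)) n p / fact i)) (F i ((N' ^^ (a - i + b)) w)))"
    by (simp add: sum.Sigma split_beta, intro sum.cong refl) auto
  \<comment> \<open>The new index m = a - i + b is the total power of N'. For fixed i and m the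
    exponent a + b = i + m of \<open>f\<close> no longer depends on b, so the sum over b is purely
    numerical and leaves only m = 0.\<close>
  also have "\<dots> = (\<Sum>(i, m, b)\<in>(SIGMA i:{..C}. SIGMA m:{..K}. {..m}). sc ((- 1) ^ b / (fact b * fact (m - b)) * (coeff2 (f ^ (i + m)) n p / fact i)) (F i ((N' ^^ m) w)))"
  proof (rule sum.reindex_bij_witness_not_neutral[of
        "{x \<in> (SIGMA b:{..A}. SIGMA a:{..A}. {..a}). snd (snd x) > C \<or> fst (snd x) - snd (snd x) + fst x > K}" "{}"
        _ "\<lambda>(i, m, b). (b, i + m - b, i)" "\<lambda>(b, a, i). (i, a - i + b, b)"], goal_cases)
    case (7 x)
    then show ?case using C K' Fr(1) by auto
  qed (auto simp: A_def)
  also have "\<dots> = (\<Sum>i\<le>C. \<Sum>m\<le>K. sc ((\<Sum>b\<le>m. (- 1) ^ b / (fact b * fact (m - b))) * (coeff2 (f ^ (i + m)) n p / fact i)) (F i ((N' ^^ m) w)))"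
    by (simp only: scale_sum_left sum_distrib_right) (simp add: sum.Sigma split_beta)
  also have "\<dots> = (\<Sum>i\<le>C. \<Sum>m\<in>{0}. sc ((\<Sum>b\<le>m. (- 1) ^ b / (fact b * fact (m - b))) * (coeff2 (f ^ (i + m)) n p / fact i)) (F i ((N' ^^ m) w)))"
  proof (rule sum.cong[OF refl])
    fix i
    show "(\<Sum>m\<le>K. sc ((\<Sum>b\<le>m. (- 1) ^ b / (fact b * fact (m - b))) * (coeff2 (f ^ (i + m)) n p / fact i)) (F i ((N' ^^ m) w)))
      = (\<Sum>m\<in>{0}. sc ((\<Sum>b\<le>m. (- 1) ^ b / (fact b * fact (m - b))) * (coeff2 (f ^ (i + m)) n p / fact i)) (F i ((N' ^^ m) w)))"
      by (rule sum.mono_neutral_right) (auto simp: alternating_fact_sum)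
  qed
  finally show ?thesis by simp
qed

section \<open>The scalar series\<close>

text \<open>The expansion of (1 - x2/x1)^b, that is (x1 - x2)^b with the factor x1^b
  removed.\<close>

definition binom_series :: "complex \<Rightarrow> complex fps fps" where
  "binom_series b = Abs_fps (\<lambda>s. fps_const ((- 1) ^ s * (b gchoose s)))"

text \<open>The series log x1 + c + log(1 - x2/x1). The value c = 0 gives log(x1 - x2), and c = pi i
  gives log(-x2 + x1) once the variables are exchanged.\<close>

definition log_series :: "complex \<Rightarrow> complex fps fps" where
  "log_series c = Abs_fps (\<lambda>s. if s = 0 then fps_X + fps_const c else fps_const (- 1 / of_nat s))"

lemma coeff2_binom_series: "coeff2 (binom_series b) s j = (if j = 0 then (- 1) ^ s * (b gchoose s) else 0)"
  by (simp add: binom_series_def)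

lemma coeff2_log_series: "coeff2 (log_series c) s j =
    (if s = 0 then (if j = 1 then 1 else if j = 0 then c else 0) else if j = 0 then - 1 / of_nat s else 0)"
  by (simp add: log_series_def fps_X_def)

lemma coeff2_00_mult: "coeff2 (f * h) 0 0 = coeff2 f 0 0 * coeff2 h 0 0"
  by (simp add: coeff2_mult)

lemma coeff2_00_power: "coeff2 (f ^ c) 0 0 = coeff2 f 0 0 ^ c"
  by (induction c) (simp_all add: coeff2_00_mult)

lemma log_x1_x2_eq: "log_x1_x2 = cone_series (log_series 0)"
  by (auto simp: fun_eq_iff log_x1_x2_def cone_series_def coeff2_log_series elim!: Nats_cases)

lemma log_mx2_x1_swap: "(\<lambda>m. log_mx2_x1 (prod.swap m)) = cone_series (log_series (of_real pi * \<i>))"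
  by (auto simp: fun_eq_iff log_mx2_x1_def cone_series_def coeff2_log_series elim!: Nats_cases)

lemma pow_x1_x2_shifted_cone:
  "pow_x1_x2 b ((b - of_nat s, j), (of_nat s, 0)) = coeff2 (binom_series b) s j"
  by (simp add: pow_x1_x2_def coeff2_binom_series)

lemma pow_x1_x2_nonzero: "pow_x1_x2 b m \<noteq> 0 \<Longrightarrow> \<exists>s j. m = ((b - of_nat s, j), (of_nat s, 0))"
  by (cases m) (auto simp: pow_x1_x2_def split: if_splits elim!: Nats_cases)

text \<open>From e^(pi i (b - s)) = e^(pi i b) (-1)^s: the sign is the one built into
  \<open>binom_series\<close>, so the two expansions of the power differ only by the exchange of
  variables and a constant.\<close>

lemma pow_mx2_x1_shifted_cone:
  "pow_mx2_x1 b (prod.swap ((b - of_nat s, j), (of_nat s, 0)))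
    = exp (of_real pi * \<i> * b) * coeff2 (binom_series b) s j"
proof -
  have "exp (of_real pi * \<i> * (b - of_nat s)) = exp (of_real pi * \<i> * b) * exp (- (of_real pi * \<i>)) ^ s"
    by (simp add: exp_of_nat_mult[symmetric] exp_add[symmetric] algebra_simps)
  then show ?thesis by (simp add: pow_mx2_x1_def coeff2_binom_series exp_minus)
qed

lemma pow_mx2_x1_nonzero:
  "pow_mx2_x1 b (prod.swap m) \<noteq> 0 \<Longrightarrow> \<exists>s j. m = ((b - of_nat s, j), (of_nat s, 0))"
  by (cases m) (auto simp: pow_mx2_x1_def split: if_splits elim!: Nats_cases)

section \<open>Exchanging the two variables, which brings expansions in powers of x1 into cone
  form\<close>

lemma op_comp_swap:
  fixes A :: "'u \<Rightarrow> mono2 \<Rightarrow> 'w::comm_monoid_add" and B :: "'v \<Rightarrow> mono2 \<Rightarrow> 'u"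
  shows "(A \<odot> B) v (prod.swap m)
    = ((\<lambda>w m. A w (prod.swap m)) \<odot> (\<lambda>w m. B w (prod.swap m))) v m"
proof -
  have eq: "p + q = prod.swap m \<longleftrightarrow> prod.swap p + prod.swap q = m" for p q :: mono2
    by (cases p, cases q, cases m) auto
  show ?thesis
    unfolding op_comp_def
    by (rule sum.reindex_bij_witness[of _ "map_prod prod.swap prod.swap" "map_prod prod.swap prod.swap"])
      (auto simp: eq split_beta simp del: split_paired_All split_paired_Ex)
qed

lemma ser_mult_swap:
  fixes f h :: "mono2 \<Rightarrow> complex"
  shows "ser_mult f h (prod.swap m) = ser_mult (\<lambda>m. f (prod.swap m)) (\<lambda>m. h (prod.swap m)) m"
proof -
  have eq: "p + q = prod.swap m \<longleftrightarrow> prod.swap p + prod.swap q = m" for p q :: mono2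
    by (cases p, cases q, cases m) auto
  show ?thesis
    unfolding ser_mult_def
    by (rule sum.reindex_bij_witness[of _ "map_prod prod.swap prod.swap" "map_prod prod.swap prod.swap"])
      (auto simp: eq split_beta simp del: split_paired_All split_paired_Ex)
qed

lemma ser_pow_swap:
  fixes f :: "mono2 \<Rightarrow> complex"
  shows "ser_pow f k (prod.swap m) = ser_pow (\<lambda>m. f (prod.swap m)) k m"
  by (induction k arbitrary: m) (auto simp: ser_mult_swap zero_prod_def)

lemma nil_pow_swap:
  fixes f :: "mono2 \<Rightarrow> complex"
  shows "nil_pow sc f N w (prod.swap m) = nil_pow sc (\<lambda>m. f (prod.swap m)) N w m"
  by (simp add: nil_pow_def ser_pow_swap)

lemma in_x_swap: "in_x1 F v (prod.swap m) = in_x2 F v m" "in_x2 F v (prod.swap m) = in_x1 F v m"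
  by (cases m, simp add: in_x1_def in_x2_def)+

section \<open>Coefficients of the generalized weak commutativity relation\<close>

lemma in_x2_shift_eq:
  "in_x2 X v ((r, k), m) = (if r = 0 \<and> k = 0 then X v m else 0)"
  by (simp add: in_x2_def zero_prod_def)

text \<open>The product is truncated from below in \<open>x\<^sub>2\<close>, which bounds all expansions.\<close>
lemma coeff_conjugated_product:
  fixes X :: "'v \<Rightarrow> mono1 \<Rightarrow> 'w::ab_group_add"
  assumes vs: "vector_space sc" and N: "loc_nilpotent_op sc N"
    and F: "\<And>c m. Vector_Spaces.linear sc sc (\<lambda>w. F c w m)"
    and ad: "\<And>c w m. N (F c w m) - F c (N w) m = F (Suc c) w m"
    and C: "\<And>c w m. c > C \<Longrightarrow> F c w m = 0"
    and R: "\<And>m. Re (fst m) < R \<Longrightarrow> X v m = 0" and S: "Re t - of_nat S < R"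
  shows "(scalar_ser sc (pow_x1_x2 b) \<odot> nil_pow sc (cone_series f) N \<odot> in_x1 (F 0)
        \<odot> nil_pow sc (cone_series f) (\<lambda>w. - N w) \<odot> in_x2 X) v ((r + b, k), (t, l))
    = (\<Sum>s\<le>S. \<Sum>j\<le>k. \<Sum>c\<le>C. sc (coeff2 (binom_series b * f ^ c) s j / fact c)
        (F c (X v (t - of_nat s, l)) (r + of_nat s, k - j)))"
proof -
  interpret vector_space sc by fact
  have Nl: "Vector_Spaces.linear sc sc N" using N by (simp add: loc_nilpotent_op_def)
  have minus: "((\<lambda>w. - N w) ^^ b) u = sc ((- 1) ^ b) ((N ^^ b) u)" for b u
    by (induction b) (simp_all add: linear_rules[OF Nl] scale_minus_left)
  interpret P: vector_space_pair sc sc by unfold_locales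
  have N': "loc_nilpotent_op sc (\<lambda>w. - N w)"
    using N P.linear_compose_neg[OF Nl] unfolding loc_nilpotent_op_def minus by (metis scale_zero_right)
  note Fr = linear_rules[OF F]
  let ?n1 = "nil_coeff sc f N" and ?n2 = "nil_coeff sc f (\<lambda>w. - N w)"
  note n1 = linear_rules[OF nil_coeff_linear[OF vs N]] and n2 = linear_rules[OF nil_coeff_linear[OF vs N']]
  have X0: "X v (t' - of_nat s, l) = 0" if "Re t' - of_nat S < R" "s > S" for t' s
    using R[of "(t' - of_nat s, l)"] that by simp
  \<comment> \<open>The product associates to the right; \<open>B4\<close>, \<open>B3\<close>,
    \<open>B2\<close> are its successive tails, evaluated from the inside out.\<close>
  define B4 where "B4 = nil_pow sc (cone_series f) (\<lambda>w. - N w) \<odot> in_x2 X"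
  define B3 where "B3 = in_x1 (F 0) \<odot> B4"
  define B2 where "B2 = nil_pow sc (cone_series f) N \<odot> B3"
  \<comment> \<open>Stated for all \<open>t'\<close> below the cutoff, because the outer factors
    lower the exponent of x2 before this tail is evaluated.\<close>
  have B4: "B4 v ((r, k), (t', l)) = (\<Sum>s\<le>S. \<Sum>j\<le>k. ?n2 s j
      (if r + of_nat s = 0 \<and> k - j = 0 then X v (t' - of_nat s, l) else 0))"
    if t': "Re t' - of_nat S < R" for r k t'
    unfolding B4_def
    by (subst op_comp_nil_pow[OF vs N', where S = S]) (auto simp: in_x2_shift_eq X0[OF t'])
  have B4_nz: "\<exists>s\<le>S. \<exists>j. q = (- of_nat s, j)" if t': "Re t' - of_nat S < R" and nz: "B4 v (q, (t', l)) \<noteq> 0" for q t'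
  proof -
    obtain r k where q: "q = (r, k)" by (cases q)
    obtain s where "s \<le> S" "r + of_nat s = 0"
      using nz unfolding q B4[OF t'] by (elim sum.not_neutral_contains_not_neutral) (auto simp: n2 split: if_splits)
    then show ?thesis unfolding q by (auto simp: add_eq_0_iff)
  qed
  have B4_cone: "B4 v ((- of_nat s, j), (t', l)) = ?n2 s j (X v (t' - of_nat s, l))"
    if t': "Re t' - of_nat S < R" and s: "s \<le> S" for s j t'
  proof -
    have "B4 v ((- of_nat s, j), (t', l)) = (\<Sum>s'\<le>S. if s' = s then ?n2 s j (X v (t' - of_nat s, l)) else 0)"
      unfolding B4[OF t']
    proof (rule sum.cong[OF refl])
      fix s'
      have "?n2 s' j' (if - of_nat s + of_nat s' = (0 :: complex) \<and> j - j' = 0 then X v (t' - of_nat s', l) else 0)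
        = (if j' = j then if s' = s then ?n2 s j (X v (t' - of_nat s, l)) else 0 else 0)" if "j' \<le> j" for j'
        using that by (auto simp: n2)
      then show "(\<Sum>j'\<le>j. ?n2 s' j' (if - of_nat s + of_nat s' = (0 :: complex) \<and> j - j' = 0 then X v (t' - of_nat s', l) else 0))
        = (if s' = s then ?n2 s j (X v (t' - of_nat s, l)) else 0)" by simp
    qed
    then show ?thesis using s by simp
  qed
  have B3: "B3 v ((r, k), (t', l)) = (\<Sum>s\<le>S. \<Sum>j\<le>k. F 0 (?n2 s j (X v (t' - of_nat s, l))) (r + of_nat s, k - j))"
    if t': "Re t' - of_nat S < R" for r k t'
    unfolding B3_def using B4_cone[OF t']
    by (subst op_comp_in_x1[where S = S]) (auto simp: Fr intro: B4_nz[OF t'])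
  have B3_0: "B3 v ((r, k), (t' - of_nat s, l)) = 0" if t': "Re t' - of_nat S < R" and s: "s > S" for r k t' s
    using X0[OF t', of "s + s'" for s'] that by (subst B3) (auto simp: diff_diff_eq n2 Fr simp flip: of_nat_add)
  have B2: "B2 v ((r, k), (t', l)) = (\<Sum>s\<le>S. \<Sum>j\<le>k. \<Sum>c\<le>C. sc (coeff2 (f ^ c) s j / fact c)
        (F c (X v (t' - of_nat s, l)) (r + of_nat s, k - j)))"
    if t': "Re t' - of_nat S < R" for r k t'
  proof -
    have "B2 v ((r, k), (t', l)) = (\<Sum>s\<le>S. \<Sum>j\<le>k. ?n1 s j (B3 v ((r + of_nat s, k - j), (t' - of_nat s, l))))"
      unfolding B2_def by (rule op_comp_nil_pow[OF vs N]) (rule B3_0[OF t'])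
    also have "\<dots> = (\<Sum>s\<le>S. \<Sum>j\<le>k. \<Sum>s'\<le>S. \<Sum>j'\<le>k - j. ?n1 s j
        (F 0 (?n2 s' j' (X v (t' - of_nat (s + s'), l))) (r + of_nat (s + s'), k - (j + j'))))"
      using t' by (subst B3) (auto simp: n1 diff_diff_eq add_ac)
    also have "\<dots> = (\<Sum>n\<le>S. \<Sum>p\<le>k. \<Sum>s\<le>n. \<Sum>j\<le>p. ?n1 s j
        (F 0 (?n2 (n - s) (p - j) (X v (t' - of_nat (s + (n - s)), l))) (r + of_nat (s + (n - s)), k - (j + (p - j)))))"
      by (rule sum_convolution) (simp only: X0[OF t'] n1 n2 Fr)
    also have "\<dots> = (\<Sum>n\<le>S. \<Sum>p\<le>k. \<Sum>s\<le>n. \<Sum>j\<le>p. ?n1 s j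
        (F 0 (?n2 (n - s) (p - j) (X v (t' - of_nat n, l))) (r + of_nat n, k - p)))"
      by (intro sum.cong refl) simp
    also have "\<dots> = (\<Sum>n\<le>S. \<Sum>p\<le>k. \<Sum>c\<le>C. sc (coeff2 (f ^ c) n p / fact c)
        (F c (X v (t' - of_nat n, l)) (r + of_nat n, k - p)))"
    proof (rule sum.cong[OF refl], rule sum.cong[OF refl])
      fix n p
      show "(\<Sum>s\<le>n. \<Sum>j\<le>p. ?n1 s j (F 0 (?n2 (n - s) (p - j) (X v (t' - of_nat n, l))) (r + of_nat n, k - p)))
        = (\<Sum>c\<le>C. sc (coeff2 (f ^ c) n p / fact c) (F c (X v (t' - of_nat n, l)) (r + of_nat n, k - p)))"
        by (rule nil_coeff_conjugation[where F = "\<lambda>c w. F c w (r + of_nat n, k - p)", OF vs vs N N F ad C])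
    qed
    finally show ?thesis .
  qed
  have B2_0: "B2 v ((r, k), (t - of_nat s, l)) = 0" if s: "s > S" for r k s
    using X0[OF S, of "s + s'" for s'] that S by (subst B2) (auto simp: diff_diff_eq Fr simp flip: of_nat_add)
  have "(scalar_ser sc (pow_x1_x2 b) \<odot> B2) v ((r + b, k), (t, l))
    = (\<Sum>s\<le>S. \<Sum>j\<le>k. sc (coeff2 (binom_series b) s j) (B2 v ((r + b - b + of_nat s, k - j), (t - of_nat s, l))))"
    by (rule op_comp_cone)
      (auto simp: scalar_ser_def pow_x1_x2_shifted_cone B2_0 intro: pow_x1_x2_nonzero)
  also have "\<dots> = (\<Sum>s\<le>S. \<Sum>j\<le>k. \<Sum>s'\<le>S. \<Sum>j'\<le>k - j. \<Sum>c\<le>C.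
       sc (coeff2 (binom_series b) s j * (coeff2 (f ^ c) s' j' / fact c))
        (F c (X v (t - of_nat (s + s'), l)) (r + of_nat (s + s'), k - (j + j'))))"
    using S by (subst B2) (auto simp: scale_sum_right diff_diff_eq add_ac)
  also have "\<dots> = (\<Sum>n\<le>S. \<Sum>p\<le>k. \<Sum>s\<le>n. \<Sum>j\<le>p. \<Sum>c\<le>C.
       sc (coeff2 (binom_series b) s j * (coeff2 (f ^ c) (n - s) (p - j) / fact c))
        (F c (X v (t - of_nat (s + (n - s)), l)) (r + of_nat (s + (n - s)), k - (j + (p - j)))))"
    by (rule sum_convolution) (simp add: X0[OF S] Fr del: of_nat_add)
  also have "\<dots> = (\<Sum>n\<le>S. \<Sum>p\<le>k. \<Sum>s\<le>n. \<Sum>j\<le>p. \<Sum>c\<le>C.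
       sc (coeff2 (binom_series b) s j * (coeff2 (f ^ c) (n - s) (p - j) / fact c))
        (F c (X v (t - of_nat n, l)) (r + of_nat n, k - p)))"
    by (intro sum.cong refl) simp
  also have "\<dots> = (\<Sum>n\<le>S. \<Sum>p\<le>k. \<Sum>c\<le>C. \<Sum>s\<le>n. \<Sum>j\<le>p.
       sc (coeff2 (binom_series b) s j * (coeff2 (f ^ c) (n - s) (p - j) / fact c))
        (F c (X v (t - of_nat n, l)) (r + of_nat n, k - p)))"
    by (simp only: sum.swap[where B = "{..C}"])
  also have "\<dots> = (\<Sum>n\<le>S. \<Sum>p\<le>k. \<Sum>c\<le>C. sc (coeff2 (binom_series b * f ^ c) n p / fact c)
        (F c (X v (t - of_nat n, l)) (r + of_nat n, k - p)))"
    by (simp only: coeff2_mult scale_sum_left sum_divide_distrib times_divide_eq_right)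
  finally show ?thesis unfolding B2_def B3_def B4_def .
qed

text \<open>The mirror image: the variables are exchanged, and the truncation is that of the field of \<open>V\<close>.\<close>
lemma coeff_product_conjugated:
  fixes X :: "'v::ab_group_add \<Rightarrow> mono1 \<Rightarrow> 'w::ab_group_add" and Y :: "nat \<Rightarrow> 'v \<Rightarrow> mono1 \<Rightarrow> 'v"
  assumes ws: "vector_space scW" and vs: "vector_space sc" and N: "loc_nilpotent_op sc N"
    and Y: "\<And>c m. Vector_Spaces.linear sc sc (\<lambda>w. Y c w m)"
    and X: "\<And>m. Vector_Spaces.linear sc scW (\<lambda>w. X w m)"
    and ad: "\<And>c w m. N (Y c w m) - Y c (N w) m = Y (Suc c) w m"
    and C: "\<And>c w m. c > C \<Longrightarrow> Y c w m = 0"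
    and R: "\<And>c m. Re (fst m) < R \<Longrightarrow> Y c v m = 0" and S: "Re r - of_nat S < R"
    and A: "\<And>w s j. A w ((b - of_nat s, j), (of_nat s, 0)) = scW (e * coeff2 (binom_series b) s j) w"
    and A_nz: "\<And>w m. A w m \<noteq> 0 \<Longrightarrow> \<exists>s j. m = ((b - of_nat s, j), (of_nat s, 0))"
  shows "(A \<odot> in_x1 X \<odot> nil_pow sc (cone_series f) N \<odot> in_x2 (Y 0)
        \<odot> nil_pow sc (cone_series f) (\<lambda>w. - N w)) v ((t, l), (r, k))
    = (\<Sum>s\<le>S. \<Sum>j\<le>l. \<Sum>c\<le>C. scW (e * (coeff2 (binom_series b * f ^ c) s j / fact c))
        (X (Y c v (r - of_nat s, k)) (t - b + of_nat s, l - j)))"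
proof -
  interpret vector_space sc by fact
  interpret W: vector_space scW by fact
  have Nl: "Vector_Spaces.linear sc sc N" using N by (simp add: loc_nilpotent_op_def)
  have minus: "((\<lambda>w. - N w) ^^ b) u = sc ((- 1) ^ b) ((N ^^ b) u)" for b u
    by (induction b) (simp_all add: linear_rules[OF Nl] scale_minus_left)
  interpret P: vector_space_pair sc sc by unfold_locales
  have N': "loc_nilpotent_op sc (\<lambda>w. - N w)"
    using N P.linear_compose_neg[OF Nl] unfolding loc_nilpotent_op_def minus by (metis scale_zero_right)
  note Yr = linear_rules[OF Y] and Xr = linear_rules[OF X]
  let ?n1 = "nil_coeff sc f N" and ?n2 = "nil_coeff sc f (\<lambda>w. - N w)"
  note n1 = linear_rules[OF nil_coeff_linear[OF vs N]] and n2 = linear_rules[OF nil_coeff_linear[OF vs N']]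
  define E where "E = nil_pow sc (cone_series f) (\<lambda>w. - N w)"
  define B3 where "B3 = in_x2 (Y 0) \<odot> E"
  define B2 where "B2 = nil_pow sc (cone_series f) N \<odot> B3"
  define B1 where "B1 = in_x1 X \<odot> B2"
  have E_nz: "\<exists>s j. q = cone s j" if "E v q \<noteq> 0" for q
    using that nil_pow_nonzeroE[OF vs] unfolding E_def by metis
  have E_cone: "E v (cone s j) = ?n2 s j v" for s j unfolding E_def by (rule nil_pow_cone)
  have B3_cone: "B3 v ((- of_nat s, j), (r, k)) = Y 0 (?n2 s j v) (r - of_nat s, k)" for s j r k
    unfolding B3_def E_cone[symmetric] by (rule op_comp_in_x2(1)) (auto simp: Yr E_nz)
  have B3_nz: "\<exists>s. t = - of_nat s" if "B3 v ((t, l), (r, k)) \<noteq> 0" for t l r k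
    by (rule op_comp_in_x2(2)[OF _ _ that[unfolded B3_def]]) (auto simp: Yr E_nz)
  have B2_cone: "B2 v ((- of_nat n, p), (r, k))
      = (\<Sum>c\<le>C. sc (coeff2 (f ^ c) n p / fact c) (Y c v (r - of_nat n, k)))" for n p r k
  proof -
    have "B2 v ((- of_nat n, p), (r, k))
        = (\<Sum>s\<le>n. \<Sum>j\<le>p. ?n1 s j (B3 v ((- of_nat n + of_nat s, p - j), (r - of_nat s, k))))"
      unfolding B2_def
    proof (rule op_comp_nil_pow[OF vs N])
      \<comment> \<open>The bound comes from the support here: \<open>B3\<close> contains only
        powers -s' of the first variable with s' a natural number, so nothing remains beyond
        \<open>n\<close>.\<close>
      fix s j assume s: "s > n"
      have "- of_nat n + of_nat s = (of_nat (s - n) :: complex)" using s by (simp add: of_nat_diff)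
      moreover have "(of_nat (s - n) :: complex) \<noteq> - of_nat s'" for s'
        using s by (metis add_eq_0_iff2 of_nat_add of_nat_eq_0_iff add_is_0 zero_less_diff less_irrefl)
      ultimately show "B3 v ((- of_nat n + of_nat s, j), (r - of_nat s, k)) = 0"
        using B3_nz by metis
    qed
    also have "\<dots> = (\<Sum>s\<le>n. \<Sum>j\<le>p. ?n1 s j (Y 0 (?n2 (n - s) (p - j) v) (r - of_nat n, k)))"
    proof (intro sum.cong refl)
      fix s j assume "s \<in> {..n}"
      then have "- of_nat n + of_nat s = - (of_nat (n - s) :: complex)" "r - of_nat s - of_nat (n - s) = r - of_nat n"
        by (simp_all add: of_nat_diff)
      then show "?n1 s j (B3 v ((- of_nat n + of_nat s, p - j), (r - of_nat s, k)))
          = ?n1 s j (Y 0 (?n2 (n - s) (p - j) v) (r - of_nat n, k))"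
        by (simp only: B3_cone)
    qed
    also have "\<dots> = (\<Sum>c\<le>C. sc (coeff2 (f ^ c) n p / fact c) (Y c v (r - of_nat n, k)))"
      by (rule nil_coeff_conjugation[where F = "\<lambda>c w. Y c w (r - of_nat n, k)", OF vs vs N N Y ad C])
    finally show ?thesis .
  qed
  have B2_nz: "\<exists>s. t = - of_nat s" if "B2 v ((t, l), (r, k)) \<noteq> 0" for t l r k
  proof -
    have nz: "(nil_pow sc (cone_series f) N \<odot> B3) v ((t, l), (r, k)) \<noteq> 0"
      using that unfolding B2_def .
    obtain p q where pq: "p + q = ((t, l), (r, k))" "nil_pow sc (cone_series f) N (B3 v q) p \<noteq> 0"
      using nz unfolding op_comp_def by (elim sum.not_neutral_contains_not_neutral) blast
    obtain s j where p: "p = cone s j" using pq(2) by (rule nil_pow_nonzeroE[OF vs])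
    have "nil_pow sc (cone_series f) N 0 p = 0" unfolding p nil_pow_cone by (rule n1)
    then have "B3 v q \<noteq> 0" using pq(2) by metis
    then obtain s' where "fst (fst q) = - of_nat s'" using B3_nz by (metis prod.collapse)
    then have "t = - of_nat (s + s')" using pq(1) p by (cases q) auto
    then show ?thesis by blast
  qed
  have B1: "B1 v ((t, l), (r', k)) = (\<Sum>s\<le>S. \<Sum>j\<le>l. \<Sum>c\<le>C. scW (coeff2 (f ^ c) s j / fact c)
        (X (Y c v (r' - of_nat s, k)) (t + of_nat s, l - j)))"
    if r': "Re r' - of_nat S < R" for t l r'
  proof -
    have Y0: "Y c v (r' - of_nat s, k) = 0" if "s > S" for s c
      using R[of "(r' - of_nat s, k)"] that r' by simp
    have "B1 v ((t, l), (r', k)) = (\<Sum>s\<le>S. \<Sum>j\<le>l. X (B2 v ((- of_nat s, j), (r', k))) (t + of_nat s, l - j))"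
      unfolding B1_def
    proof (rule op_comp_in_x1)
      fix q assume nz: "B2 v (q, (r', k)) \<noteq> 0"
      obtain t' l' where q: "q = (t', l')" by (cases q)
      obtain s where s: "t' = - of_nat s" using B2_nz nz unfolding q by blast
      have "s \<le> S"
      proof (rule ccontr)
        assume "\<not> s \<le> S"
        then have "B2 v (q, (r', k)) = 0" unfolding q s B2_cone by (simp add: Y0)
        with nz show False by simp
      qed
      then show "\<exists>s\<le>S. \<exists>j. q = (- of_nat s, j)" using s q by blast
    qed (rule Xr)
    then show ?thesis by (simp add: B2_cone Xr)
  qed
  have XY0: "X (Y c v (r - of_nat s, k)) m = 0" if "s > S" for s c m
    using R[of "(r - of_nat s, k)"] that S by (simp add: Xr)
  have B1_0: "B1 v ((t, l), (r - of_nat s, k)) = 0" if s: "s > S" for t l s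
    using XY0[of "s + s'" for s'] that S by (subst B1) (auto simp: diff_diff_eq simp flip: of_nat_add)
  have "(A \<odot> B1) v ((t, l), (r, k))
    = (\<Sum>s\<le>S. \<Sum>j\<le>l. scW (e * coeff2 (binom_series b) s j) (B1 v ((t - b + of_nat s, l - j), (r - of_nat s, k))))"
    by (rule op_comp_cone[where a = "\<lambda>s j. scW (e * coeff2 (binom_series b) s j)"])
      (auto simp: A B1_0 intro: A_nz)
  also have "\<dots> = (\<Sum>s\<le>S. \<Sum>j\<le>l. \<Sum>s'\<le>S. \<Sum>j'\<le>l - j. \<Sum>c\<le>C.
       scW (e * coeff2 (binom_series b) s j * (coeff2 (f ^ c) s' j' / fact c))
        (X (Y c v (r - of_nat (s + s'), k)) (t - b + of_nat (s + s'), l - (j + j'))))"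
    using S by (subst B1) (auto simp: W.scale_sum_right diff_diff_eq add_ac)
  also have "\<dots> = (\<Sum>n\<le>S. \<Sum>p\<le>l. \<Sum>s\<le>n. \<Sum>j\<le>p. \<Sum>c\<le>C.
       scW (e * coeff2 (binom_series b) s j * (coeff2 (f ^ c) (n - s) (p - j) / fact c))
        (X (Y c v (r - of_nat (s + (n - s)), k)) (t - b + of_nat (s + (n - s)), l - (j + (p - j)))))"
    by (rule sum_convolution) (simp add: XY0 del: of_nat_add)
  also have "\<dots> = (\<Sum>n\<le>S. \<Sum>p\<le>l. \<Sum>s\<le>n. \<Sum>j\<le>p. \<Sum>c\<le>C.
       scW (e * coeff2 (binom_series b) s j * (coeff2 (f ^ c) (n - s) (p - j) / fact c))
        (X (Y c v (r - of_nat n, k)) (t - b + of_nat n, l - p)))"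
    by (intro sum.cong refl) simp
  also have "\<dots> = (\<Sum>n\<le>S. \<Sum>p\<le>l. \<Sum>c\<le>C. \<Sum>s\<le>n. \<Sum>j\<le>p.
       scW (e * coeff2 (binom_series b) s j * (coeff2 (f ^ c) (n - s) (p - j) / fact c))
        (X (Y c v (r - of_nat n, k)) (t - b + of_nat n, l - p)))"
    by (simp only: sum.swap[where B = "{..C}"])
  also have "\<dots> = (\<Sum>n\<le>S. \<Sum>p\<le>l. \<Sum>c\<le>C. scW (e * (coeff2 (binom_series b * f ^ c) n p / fact c))
        (X (Y c v (r - of_nat n, k)) (t - b + of_nat n, l - p)))"
    by (simp only: coeff2_mult W.scale_sum_left sum_divide_distrib sum_distrib_left times_divide_eq_right mult.assoc)
  finally show ?thesis unfolding B1_def B2_def B3_def E_def .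
qed

context twisted_setting begin

text \<open>The coefficient of Property 7 at x1^(r+b) (log x1)^k x2^t (log x2)^l. The scalars
  \<open>A\<close> and \<open>B\<close> are fixed before \<open>v\<close>, while \<open>S\<close>
  and \<open>Q\<close> may be any cutoffs large enough for given truncation bounds of
  \<open>v\<close>; this freedom lets relations with different vectors share one range.\<close>

definition field_relation :: "'i \<Rightarrow> 'a \<Rightarrow> complex \<Rightarrow> nat \<Rightarrow> (nat \<Rightarrow> nat \<Rightarrow> nat \<Rightarrow> complex)
    \<Rightarrow> (nat \<Rightarrow> nat \<Rightarrow> nat \<Rightarrow> complex) \<Rightarrow> bool" where
  "field_relation i a b C A B \<longleftrightarrow>
    (\<forall>v R R' S Q r k t l. (\<forall>m. Re (fst m) < R \<longrightarrow> psi T a v m = 0)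
      \<longrightarrow> (\<forall>c m. Re (fst m) < R' \<longrightarrow> chain_vfield i c v m = 0)
      \<longrightarrow> Re t - of_nat S < R \<longrightarrow> Re (r + b) - of_nat Q < R'
      \<longrightarrow> (\<Sum>s\<le>S. \<Sum>j\<le>k. \<Sum>c\<le>C. sW (A c s j)
            (chain_phi i c (psi T a v (t - of_nat s, l)) (r + of_nat s, k - j)))
        = (\<Sum>q\<le>Q. \<Sum>j\<le>l. \<Sum>c\<le>C. sW (B c q j)
            (psi T a (chain_vfield i c v (r + b - of_nat q, k)) (t - b + of_nat q, l - j))))"

text \<open>The leading scalars on the left are normalized because the binomial series starts with 1
  and log(x1 - x2) has no constant term. On the right log(-x2 + x1) has the constant term pi i, and
  no such normalization of \<open>B\<close> is claimed.\<close>

lemma field_relation_exists: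
  assumes i: "i \<in> gidx G" and a: "a \<in> aidx T"
  shows "\<exists>b C A B. field_relation i a b C A B \<and> A 0 0 0 = 1 \<and> (\<forall>c>0. A c 0 0 = 0)"
proof -
  obtain M where M: "scalar_ser sW (pow_x1_x2 (galpha G i + of_nat M))
          \<odot> nil_pow sW log_x1_x2 NW
          \<odot> in_x1 (phi T i)
          \<odot> nil_pow sW log_x1_x2 (\<lambda>w. - NW w)
          \<odot> in_x2 (psi T a)
        = op_scale sW (koszul (gpar G i) (psipar T a))
            (scalar_ser sW (pow_mx2_x1 (galpha G i + of_nat M))
              \<odot> in_x2 (psi T a)
              \<odot> nil_pow sV log_mx2_x1 NV
              \<odot> in_x1 (vfield V (gvec G i))
              \<odot> nil_pow sV log_mx2_x1 (\<lambda>v. - NV v))"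
    using weak_comm i a unfolding generalized_weak_commutativity_def by blast
  define b where "b = galpha G i + of_nat M"
  define f1 where "f1 = log_series 0"
  define f2 where "f2 = log_series (of_real pi * \<i>)"
  define e where "e = koszul (gpar G i) (psipar T a)"
  define e' where "e' = exp (of_real pi * \<i> * b)"
  obtain C where C: "chain_phi i c w m = 0" "chain_vfield i c v m = 0" if "c > C" for c w v m
    using chain_terminates[OF i] by blast
  have phi0: "chain_phi i 0 = phi T i" by (simp add: chain_phi_def opt_field_def)
  have vf0: "chain_vfield i 0 = vfield V (gvec G i)" by (simp add: chain_vfield_def)
  let ?A = "\<lambda>c s j. coeff2 (binom_series b * f1 ^ c) s j / fact c"
  let ?B = "\<lambda>c s j. e * (e' * (coeff2 (binom_series b * f2 ^ c) s j / fact c))"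
  let ?shift = "\<lambda>w m. scalar_ser sW (pow_mx2_x1 b) w (prod.swap m)"
  show ?thesis
  proof (rule exI[of _ b], rule exI[of _ C], rule exI[of _ ?A], rule exI[of _ ?B], intro conjI allI impI)
    show "?A 0 0 0 = 1" by (simp add: coeff2_00_mult coeff2_binom_series)
    show "?A c 0 0 = 0" if "c > 0" for c
      using that by (simp add: coeff2_00_mult coeff2_00_power f1_def coeff2_log_series)
    show "field_relation i a b C ?A ?B"
      unfolding field_relation_def
    proof (intro allI impI)
      fix v R R' S Q r k t l
      assume "\<forall>m. Re (fst m) < R \<longrightarrow> psi T a v m = 0"
        and "\<forall>c m. Re (fst m) < R' \<longrightarrow> chain_vfield i c v m = 0"
        and S: "Re t - of_nat S < R" and Q: "Re (r + b) - of_nat Q < R'"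
      then have R: "\<And>m. Re (fst m) < R \<Longrightarrow> psi T a v m = 0"
        and R': "\<And>c m. Re (fst m) < R' \<Longrightarrow> chain_vfield i c v m = 0" by blast+
      have "(\<Sum>s\<le>S. \<Sum>j\<le>k. \<Sum>c\<le>C. sW (?A c s j)
              (chain_phi i c (psi T a v (t - of_nat s, l)) (r + of_nat s, k - j)))
        = (scalar_ser sW (pow_x1_x2 b) \<odot> nil_pow sW (cone_series f1) NW \<odot> in_x1 (chain_phi i 0)
          \<odot> nil_pow sW (cone_series f1) (\<lambda>w. - NW w) \<odot> in_x2 (psi T a)) v ((r + b, k), (t, l))"
        by (rule coeff_conjugated_product[where F = "chain_phi i" and sc = sW and N = NW and X = "psi T a", symmetric, OF ws NW_nil
              chain_phi_linear[OF i] NW_chain_phi[OF i] C(1) R S])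
      also have "\<dots> = sW e ((scalar_ser sW (pow_mx2_x1 b)
                \<odot> in_x2 (psi T a)
                \<odot> nil_pow sV log_mx2_x1 NV
                \<odot> in_x1 (vfield V (gvec G i))
                \<odot> nil_pow sV log_mx2_x1 (\<lambda>v. - NV v)) v (prod.swap ((t, l), (r + b, k))))"
        unfolding phi0 using fun_cong[OF fun_cong[OF M], of v "((r + b, k), (t, l))"]
        by (simp only: f1_def log_x1_x2_eq[symmetric] b_def[symmetric] op_scale_def e_def[symmetric] swap_simp)
      \<comment> \<open>After the exchange \<open>psi T a\<close> stands in the first variable and
        the field of \<open>V\<close> in the second, and all scalar series are in cone form.\<close>
      also have "\<dots> = sW e ((?shift \<odot> in_x1 (psi T a) \<odot> nil_pow sV (cone_series f2) NV
          \<odot> in_x2 (chain_vfield i 0) \<odot> nil_pow sV (cone_series f2) (\<lambda>v. - NV v)) v ((t, l), (r + b, k)))"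
        by (simp only: op_comp_swap in_x_swap nil_pow_swap log_mx2_x1_swap f2_def vf0)
      also have "(?shift \<odot> in_x1 (psi T a) \<odot> nil_pow sV (cone_series f2) NV
          \<odot> in_x2 (chain_vfield i 0) \<odot> nil_pow sV (cone_series f2) (\<lambda>v. - NV v)) v ((t, l), (r + b, k))
        = (\<Sum>q\<le>Q. \<Sum>j\<le>l. \<Sum>c\<le>C. sW (e' * (coeff2 (binom_series b * f2 ^ c) q j / fact c))
              (psi T a (chain_vfield i c v (r + b - of_nat q, k)) (t - b + of_nat q, l - j)))"
      proof (rule coeff_product_conjugated[where Y = "chain_vfield i" and R = R', OF ws vs NV_nil])
        fix w s j m
        show "?shift w ((b - of_nat s, j), (of_nat s, 0)) = sW (e' * coeff2 (binom_series b) s j) w"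
          unfolding scalar_ser_def pow_mx2_x1_shifted_cone e'_def ..
        show "?shift w m \<noteq> 0 \<Longrightarrow> \<exists>s j. m = ((b - of_nat s, j), (of_nat s, 0))"
          unfolding scalar_ser_def by (rule pow_mx2_x1_nonzero) auto
        show "Vector_Spaces.linear sV sV (\<lambda>w. chain_vfield i c w m)" for c m
          unfolding chain_vfield_def by (rule vfield_linear_right)
      qed (use psi_linear[OF a] NV_chain_vfield[OF i] C(2) R' Q in auto)
      finally show "(\<Sum>s\<le>S. \<Sum>j\<le>k. \<Sum>c\<le>C. sW (?A c s j)
              (chain_phi i c (psi T a v (t - of_nat s, l)) (r + of_nat s, k - j)))
          = (\<Sum>q\<le>Q. \<Sum>j\<le>l. \<Sum>c\<le>C. sW (?B c q j)
              (psi T a (chain_vfield i c v (r + b - of_nat q, k)) (t - b + of_nat q, l - j)))"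
        by (simp add: W.scale_sum_right)
    qed
  qed
qed

end

lemma (in vector_space) subspace_sum_isolate:
  assumes "subspace X" "finite D" "x0 \<in> D" "sum f D \<in> X" "\<And>x. x \<in> D \<Longrightarrow> x \<noteq> x0 \<Longrightarrow> f x \<in> X"
  shows "f x0 \<in> X"
proof -
  have "f x0 = sum f D - sum f (D - {x0})" using assms(2,3) by (simp add: sum.remove)
  moreover have "sum f (D - {x0}) \<in> X" using assms by (intro subspace_sum) auto
  ultimately show ?thesis using assms(1,4) subspace_diff by metis
qed

lemma comm_coeff_linear:
  assumes vs: "vector_space sc" and F1: "\<And>m. Vector_Spaces.linear sc sc (\<lambda>w. F1 w m)"
    and F2: "\<And>m. Vector_Spaces.linear sc sc (\<lambda>w. F2 w m)"
  shows "comm_coeff sc M e F1 F2 m1 m2 (x + y)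
      = comm_coeff sc M e F1 F2 m1 m2 x + comm_coeff sc M e F1 F2 m1 m2 y"
    and "comm_coeff sc M e F1 F2 m1 m2 (sc c x) = sc c (comm_coeff sc M e F1 F2 m1 m2 x)"
    and "comm_coeff sc M e F1 F2 m1 m2 0 = 0"
proof -
  interpret vector_space sc by fact
  note r = linear_rules[OF F1] linear_rules[OF F2]
  show "comm_coeff sc M e F1 F2 m1 m2 (x + y)
      = comm_coeff sc M e F1 F2 m1 m2 x + comm_coeff sc M e F1 F2 m1 m2 y"
    by (simp add: comm_coeff_def r scale_right_distrib scale_right_diff_distrib
        flip: sum.distrib) (simp add: algebra_simps)
  show "comm_coeff sc M e F1 F2 m1 m2 (sc c x) = sc c (comm_coeff sc M e F1 F2 m1 m2 x)"
    by (simp add: comm_coeff_def r scale_sum_right scale_right_diff_distrib mult_ac)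
  show "comm_coeff sc M e F1 F2 m1 m2 0 = 0"
    by (simp add: comm_coeff_def r)
qed

context twisted_setting begin

text \<open>A bound uniform in \<open>c\<close> and in finitely many vectors: the second use of the
  relation acts on several modes of \<open>v\<close> simultaneously.\<close>

lemma chain_vfield_truncated:
  assumes i: "i \<in> gidx G" and U: "finite U"
  shows "\<exists>R. \<forall>u\<in>U. \<forall>c m. Re (fst m) < R \<longrightarrow> chain_vfield i c u m = 0"
proof -
  obtain C where C: "chain_vfield i c v m = 0" if "c > C" for c v m
    using chain_terminates[OF i] by blast
  have "\<forall>c u. \<exists>R. \<forall>m. Re (fst m) < R \<longrightarrow> chain_vfield i c u m = 0"
    unfolding chain_vfield_def using vfield_truncated by blast
  then obtain R where R: "\<And>c u m. Re (fst m) < R c u \<Longrightarrow> chain_vfield i c u m = 0" by metis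
  define R0 where "R0 = Min (insert 0 ((\<lambda>(c, u). R c u) ` ({..C} \<times> U)))"
  have "chain_vfield i c u m = 0" if u: "u \<in> U" and m: "Re (fst m) < R0" for u c m
  proof (cases "c \<le> C")
    case True
    have "R0 \<le> R c u" unfolding R0_def using True u U by (intro Min_le) auto
    then show ?thesis using R[of m c u] m by simp
  qed (use C in simp)
  then show ?thesis by blast
qed

lemma psi_truncated_finite:
  assumes a: "a \<in> aidx T" and U: "finite U"
  shows "\<exists>R. \<forall>u\<in>U. \<forall>m. Re (fst m) < R \<longrightarrow> psi T a u m = 0"
proof -
  have "\<forall>u. \<exists>R. \<forall>m. Re (fst m) < R \<longrightarrow> psi T a u m = 0" using psi_truncated[OF a] by blast
  then obtain R where R: "\<And>u m. Re (fst m) < R u \<Longrightarrow> psi T a u m = 0" by metis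
  define R0 where "R0 = Min (insert 0 (R ` U))"
  have "psi T a u m = 0" if u: "u \<in> U" and m: "Re (fst m) < R0" for u m
  proof -
    have "R0 \<le> R u" unfolding R0_def using u U by (intro Min_le) auto
    then show ?thesis using R[of m u] m by simp
  qed
  then show ?thesis by blast
qed

lemma eventually_Re_diff_less: "\<forall>\<^sub>F S in sequentially. x - real S < y"
  using eventually_gt_at_top[of "nat \<lceil>x - y\<rceil>"]
  by eventually_elim linarith

section \<open>The space is spanned by the modes of the twist fields\<close>

definition psi_span :: "'w set" where
  "psi_span = W.span {psi T a v m | a v m. a \<in> aidx T}"

text \<open>The leading term of the relation expresses \<open>\<phi>\<^sup>i(x\<^sub>1)\<psi>\<^sup>a(x\<^sub>2)v\<close> by terms of smaller
  exponent of \<open>x\<^sub>2\<close> or of \<open>log x\<^sub>1\<close>, modulo the span of the \<open>\<psi>\<^sup>a\<close>-modes.\<close>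
lemma phi_psi_in_psi_span:
  assumes a: "a \<in> aidx T" and R: "\<And>m. Re (fst m) < R \<Longrightarrow> psi T a v m = 0"
  shows "i \<in> gidx G \<Longrightarrow> Re t - R + real k < real n \<Longrightarrow> phi T i (psi T a v (t, l)) (r, k) \<in> psi_span"
proof (induction n arbitrary: i t k r l)
  case 0
  then have "psi T a v (t, l) = 0" using R[of "(t, l)"] by simp
  then show ?case using linear_rules(1)[OF phi_linear[OF 0(1)]] by (simp add: psi_span_def W.span_zero)
next
  case (Suc n)
  note i = Suc.prems(1)
  have sub: "W.subspace psi_span" by (simp add: psi_span_def)
  have psi_in: "psi T a u m \<in> psi_span" for u m
    unfolding psi_span_def using a by (intro W.span_base) blast
  obtain b C A B where rel: "field_relation i a b C A B" and A: "A 0 0 0 = 1" "\<And>c. c > 0 \<Longrightarrow> A c 0 0 = 0"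
    using field_relation_exists[OF i a] by blast
  obtain R' where R': "\<And>c m. Re (fst m) < R' \<Longrightarrow> chain_vfield i c v m = 0"
    using chain_vfield_truncated[OF i, of "{v}"] by blast
  obtain S where S: "Re t - real S < R" using eventually_Re_diff_less eventually_happens'[OF sequentially_bot] by metis
  obtain Q where Q: "Re (r + b) - real Q < R'" using eventually_Re_diff_less eventually_happens'[OF sequentially_bot] by metis
  let ?f = "\<lambda>(s, j, c). sW (A c s j) (chain_phi i c (psi T a v (t - of_nat s, l)) (r + of_nat s, k - j))"
  have "sum ?f ({..S} \<times> {..k} \<times> {..C}) = (\<Sum>s\<le>S. \<Sum>j\<le>k. \<Sum>c\<le>C. sW (A c s j)
            (chain_phi i c (psi T a v (t - of_nat s, l)) (r + of_nat s, k - j)))"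
    by (simp add: sum.cartesian_product)
  also have "\<dots> = (\<Sum>q\<le>Q. \<Sum>j\<le>l. \<Sum>c\<le>C. sW (B c q j)
            (psi T a (chain_vfield i c v (r + b - of_nat q, k)) (t - b + of_nat q, l - j)))"
    using rel R R' S Q unfolding field_relation_def by blast
  also have "\<dots> \<in> psi_span" by (intro W.subspace_sum sub W.subspace_scale psi_in)
  finally have tot: "sum ?f ({..S} \<times> {..k} \<times> {..C}) \<in> psi_span" .
  have "?f (0, 0, 0) \<in> psi_span"
  proof (rule W.subspace_sum_isolate[OF sub _ _ tot])
    fix x assume x: "x \<in> {..S} \<times> {..k} \<times> {..C}" "x \<noteq> (0, 0, 0)"
    obtain s j c where x': "x = (s, j, c)" by (cases x)
    have "sW (A c s j) (chain_phi i c (psi T a v (t - of_nat s, l)) (r + of_nat s, k - j)) \<in> psi_span"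
    proof (cases "s = 0 \<and> j = 0")
      case True
      then have "A c s j = 0" using x x' A(2) by auto
      then show ?thesis using W.subspace_0[OF sub] by simp
    next
      case False
      have "chain_phi i c (psi T a v (t - of_nat s, l)) (r + of_nat s, k - j) \<in> psi_span"
      proof (cases "Nidx_iter G i c")
        case None
        then show ?thesis using W.subspace_0[OF sub] by (simp add: chain_phi_def opt_field_def)
      next
        case (Some i')
        have "real (k - j) = real k - real j" using x x' by (simp add: of_nat_diff)
        moreover have "real s + real j \<ge> 1" using False by linarith
        ultimately have "Re (t - of_nat s) - R + real (k - j) < real n" using Suc.prems(2) by simp
        then show ?thesis using Suc.IH[of i'] Nidx_iter_gvec[OF i Some] Some
          by (simp add: chain_phi_def opt_field_def)
      qed
      then show ?thesis by (rule W.subspace_scale[OF sub])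
    qed
    then show "?f x \<in> psi_span" by (simp add: x')
  qed auto
  then show ?case by (simp add: A(1) chain_phi_def opt_field_def)
qed

lemma psi_span_UNIV: "psi_span = UNIV"
proof -
  have sub: "W.subspace psi_span" by (simp add: psi_span_def)
  have step: "phi T i w m \<in> psi_span" if i: "i \<in> gidx G" and w: "w \<in> psi_span" for i w m
  proof -
    note lin = linear_rules[OF phi_linear[OF i]]
    have "W.subspace {w. phi T i w m \<in> psi_span}"
      by (rule W.subspaceI) (auto simp: lin W.subspace_0[OF sub] W.subspace_add[OF sub] W.subspace_scale[OF sub])
    moreover have "{psi T a v m | a v m. a \<in> aidx T} \<subseteq> {w. phi T i w m \<in> psi_span}"
    proof clarify
      fix a v t l assume a: "a \<in> aidx T"
      obtain R where R: "\<And>m. Re (fst m) < R \<Longrightarrow> psi T a v m = 0" using psi_truncated[OF a] by blast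
      obtain r k where m: "m = (r, k)" by (cases m)
      obtain n where n: "Re t - R + real k < real n" using reals_Archimedean2 by blast
      show "phi T i (psi T a v (t, l)) m \<in> psi_span"
        unfolding m by (rule phi_psi_in_psi_span[OF a R i n])
    qed
    ultimately have "psi_span \<subseteq> {w. phi T i w m \<in> psi_span}"
      unfolding psi_span_def by (intro W.span_minimal) (simp_all add: psi_span_def)
    then show ?thesis using w by blast
  qed
  have "w \<in> psi_span" if "w \<in> generated_W G T" for w
    using that
  proof induction
    case (1 a n l v)
    then show ?case unfolding psi_span_def psi_mode_def by (intro W.span_base) blast
  next
    case (2 w i n l)
    then show ?case unfolding phi_mode_def using step by blast
  qed
  then have "W.span (generated_W G T) \<subseteq> psi_span" by (intro W.span_minimal sub) blast
  then show ?thesis using spanning by (simp add: spanning_property_def top.extremum_unique)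
qed

section \<open>Transport of weak commutativity\<close>

lemma field_relation_twice:
  assumes ri: "field_relation i a b C A B" and rj: "field_relation j a b' C' A' B'"
    and i: "i \<in> gidx G" and j: "j \<in> gidx G" and a: "a \<in> aidx T"
  shows "\<forall>\<^sub>F Q in sequentially. \<forall>\<^sub>F S in sequentially.
    (\<Sum>s\<le>S. \<Sum>p\<le>k. \<Sum>c\<le>C. \<Sum>s'\<le>S. \<Sum>p'\<le>k'. \<Sum>c'\<le>C'. sW (A c s p * A' c' s' p')
      (chain_phi i c (chain_phi j c' (psi T a v (t - of_nat s - of_nat s', l)) (r' + of_nat s', k' - p'))
        (r + of_nat s, k - p)))
    = (\<Sum>q'\<le>Q. \<Sum>p'\<le>l. \<Sum>c'\<le>C'. \<Sum>q\<le>Q. \<Sum>p\<le>l - p'. \<Sum>c\<le>C. sW (B c q p * B' c' q' p')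
      (psi T a (chain_vfield i c (chain_vfield j c' v (r' + b' - of_nat q', k')) (r + b - of_nat q, k))
        (t - b' + of_nat q' - b + of_nat q, l - p' - p)))"
proof -
  obtain R where R: "\<And>m. Re (fst m) < R \<Longrightarrow> psi T a v m = 0" using psi_truncated[OF a] by blast
  obtain R' where R': "\<And>c m. Re (fst m) < R' \<Longrightarrow> chain_vfield j c v m = 0"
    using chain_vfield_truncated[OF j, of "{v}"] by blast
  obtain Q1 where Q1: "Re (r' + b') - real Q1 < R'"
    using eventually_Re_diff_less eventually_happens'[OF sequentially_bot] by metis
  let ?u = "\<lambda>q' c'. chain_vfield j c' v (r' + b' - of_nat q', k')"
  define U where "U = insert 0 ((\<lambda>(q', c'). ?u q' c') ` ({..Q1} \<times> {..C'}))"
  have U: "finite U" by (simp add: U_def)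
  have uU: "?u q' c' \<in> U" if "c' \<le> C'" for q' c'
  proof (cases "q' \<le> Q1")
    case False
    then have "?u q' c' = 0" using Q1 by (intro R') simp
    then show ?thesis by (simp add: U_def)
  qed (use that in \<open>auto simp: U_def\<close>)
  obtain R2 where R2: "\<And>u c m. u \<in> U \<Longrightarrow> Re (fst m) < R2 \<Longrightarrow> chain_vfield i c u m = 0"
    using chain_vfield_truncated[OF i U] by blast
  obtain R3 where R3: "\<And>u m. u \<in> U \<Longrightarrow> Re (fst m) < R3 \<Longrightarrow> psi T a u m = 0"
    using psi_truncated_finite[OF a U] by blast
  have Pl: "chain_phi i c (\<Sum>x\<in>X. h x) m = (\<Sum>x\<in>X. chain_phi i c (h x) m)"
    "chain_phi i c (sW d w) m = sW d (chain_phi i c w m)" for c m d w and X :: "nat set" and h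
    by (simp_all add: linear_rules(5,6)[OF chain_phi_linear[OF i]])
  have evQ: "\<forall>\<^sub>F Q in sequentially. Re (r' + b') - real Q < R' \<and> Re (r + b) - real Q < R2"
    by (intro eventually_conj eventually_Re_diff_less)
  show ?thesis
    using evQ
  proof eventually_elim
    case (elim Q)
    have evS: "\<forall>\<^sub>F S in sequentially. Re t - real S < R \<and> Re (t - b' + of_nat Q) - real S < R3"
      by (intro eventually_conj eventually_Re_diff_less)
    show ?case
      using evS
    proof eventually_elim
      case (elim S)
      note S = elim and Q = \<open>Re (r' + b') - real Q < R' \<and> Re (r + b) - real Q < R2\<close>
      let ?LS = "\<lambda>f. (\<Sum>s\<le>S. \<Sum>p\<le>k. \<Sum>c\<le>C. f s p c :: 'w)"
      let ?RS = "\<lambda>f. (\<Sum>q'\<le>Q. \<Sum>p'\<le>l. \<Sum>c'\<le>C'. f q' p' c' :: 'w)"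
      have "?LS (\<lambda>s p c. \<Sum>s'\<le>S. \<Sum>p'\<le>k'. \<Sum>c'\<le>C'. sW (A c s p * A' c' s' p')
        (chain_phi i c (chain_phi j c' (psi T a v (t - of_nat s - of_nat s', l)) (r' + of_nat s', k' - p'))
          (r + of_nat s, k - p)))
        = ?LS (\<lambda>s p c. sW (A c s p) (chain_phi i c
            (\<Sum>s'\<le>S. \<Sum>p'\<le>k'. \<Sum>c'\<le>C'. sW (A' c' s' p')
              (chain_phi j c' (psi T a v ((t - of_nat s) - of_nat s', l)) (r' + of_nat s', k' - p')))
            (r + of_nat s, k - p)))"
        by (simp only: Pl W.scale_sum_right W.scale_scale)
      also have "\<dots> = ?LS (\<lambda>s p c. sW (A c s p) (chain_phi i c
            (?RS (\<lambda>q' p' c'. sW (B' c' q' p') (psi T a (?u q' c') ((t - of_nat s) - b' + of_nat q', l - p'))))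
            (r + of_nat s, k - p)))"
      proof -
        have "(\<Sum>s'\<le>S. \<Sum>p'\<le>k'. \<Sum>c'\<le>C'. sW (A' c' s' p')
              (chain_phi j c' (psi T a v ((t - of_nat s) - of_nat s', l)) (r' + of_nat s', k' - p')))
           = ?RS (\<lambda>q' p' c'. sW (B' c' q' p') (psi T a (?u q' c') ((t - of_nat s) - b' + of_nat q', l - p')))" for s
          using rj[unfolded field_relation_def, rule_format, where R = R and R' = R' and v = v
              and t = "t - of_nat s" and S = S and r = r' and Q = Q and k = k' and l = l] R R' S Q by simp
        then show ?thesis by simp
      qed
      also have "\<dots> = ?LS (\<lambda>s p c. ?RS (\<lambda>q' p' c'. sW (B' c' q' p') (sW (A c s p)
            (chain_phi i c (psi T a (?u q' c') (t - b' + of_nat q' - of_nat s, l - p')) (r + of_nat s, k - p)))))"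
        by (simp only: Pl W.scale_sum_right W.scale_scale mult.commute[of "A _ _ _"])
          (simp add: algebra_simps)
      also have "\<dots> = ?RS (\<lambda>q' p' c'. ?LS (\<lambda>s p c. sW (B' c' q' p') (sW (A c s p)
            (chain_phi i c (psi T a (?u q' c') (t - b' + of_nat q' - of_nat s, l - p')) (r + of_nat s, k - p)))))"
        by (simp only: sum.swap[where A = "{..C}" and B = "{..Q}"]
          sum.swap[where A = "{..C}" and B = "{..l}"]
          sum.swap[where A = "{..C}" and B = "{..C'}"]
          sum.swap[where A = "{..k}" and B = "{..Q}"]
          sum.swap[where A = "{..k}" and B = "{..l}"]
          sum.swap[where A = "{..k}" and B = "{..C'}"]
          sum.swap[where A = "{..S}" and B = "{..Q}"]
          sum.swap[where A = "{..S}" and B = "{..l}"]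
          sum.swap[where A = "{..S}" and B = "{..C'}"])
      also have "\<dots> = ?RS (\<lambda>q' p' c'. sW (B' c' q' p') (?LS (\<lambda>s p c. sW (A c s p)
            (chain_phi i c (psi T a (?u q' c') (t - b' + of_nat q' - of_nat s, l - p')) (r + of_nat s, k - p)))))"
        by (simp only: W.scale_sum_right)
      also have "\<dots> = ?RS (\<lambda>q' p' c'. sW (B' c' q' p') (\<Sum>q\<le>Q. \<Sum>p\<le>l - p'. \<Sum>c\<le>C. sW (B c q p)
            (psi T a (chain_vfield i c (?u q' c') (r + b - of_nat q, k)) (t - b' + of_nat q' - b + of_nat q, l - p' - p))))"
      proof (rule sum.cong[OF refl], rule sum.cong[OF refl], rule sum.cong[OF refl])
        fix q' p' c' assume q': "q' \<in> {..Q}" and c': "c' \<in> {..C'}"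
        have "Re (t - b' + of_nat q') - real S < R3" using S q' by simp
        then have "?LS (\<lambda>s p c. sW (A c s p)
            (chain_phi i c (psi T a (?u q' c') (t - b' + of_nat q' - of_nat s, l - p')) (r + of_nat s, k - p)))
          = (\<Sum>q\<le>Q. \<Sum>p\<le>l - p'. \<Sum>c\<le>C. sW (B c q p)
            (psi T a (chain_vfield i c (?u q' c') (r + b - of_nat q, k)) (t - b' + of_nat q' - b + of_nat q, l - p' - p)))"
          using ri[unfolded field_relation_def, rule_format, where R = R3 and R' = R2 and v = "?u q' c'"
              and t = "t - b' + of_nat q'" and S = S and r = r and Q = Q and k = k and l = "l - p'"]
            R2 R3 uU[of c' q'] c' Q by simp
        then show "sW (B' c' q' p') (?LS (\<lambda>s p c. sW (A c s p)
            (chain_phi i c (psi T a (?u q' c') (t - b' + of_nat q' - of_nat s, l - p')) (r + of_nat s, k - p))))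
          = sW (B' c' q' p') (\<Sum>q\<le>Q. \<Sum>p\<le>l - p'. \<Sum>c\<le>C. sW (B c q p)
            (psi T a (chain_vfield i c (?u q' c') (r + b - of_nat q, k)) (t - b' + of_nat q' - b + of_nat q, l - p' - p)))"
          by simp
      qed
      also have "\<dots> = ?RS (\<lambda>q' p' c'. \<Sum>q\<le>Q. \<Sum>p\<le>l - p'. \<Sum>c\<le>C. sW (B c q p * B' c' q' p')
            (psi T a (chain_vfield i c (?u q' c') (r + b - of_nat q, k)) (t - b' + of_nat q' - b + of_nat q, l - p' - p)))"
        by (simp only: W.scale_sum_right W.scale_scale mult.commute)
      finally show ?case .
    qed
  qed
qed

end

lemma sum6_product:
  fixes h :: "_ \<Rightarrow> _ \<Rightarrow> _ \<Rightarrow> _ \<Rightarrow> _ \<Rightarrow> _ \<Rightarrow> 'w::comm_monoid_add"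
  shows "(\<Sum>x\<in>X. \<Sum>y\<in>Y. \<Sum>z\<in>Z. \<Sum>x'\<in>X'. \<Sum>y'\<in>Y'. \<Sum>z'\<in>Z'. h x y z x' y' z')
    = (\<Sum>((x, y, z), (x', y', z'))\<in>(X \<times> Y \<times> Z) \<times> (X' \<times> Y' \<times> Z'). h x y z x' y' z')"
    (is "?l = ?r")
    and "(\<Sum>x\<in>X. \<Sum>y\<in>Y. \<Sum>z\<in>Z. \<Sum>x'\<in>X'. \<Sum>y'\<in>Y'. \<Sum>z'\<in>Z'. h x y z x' y' z')
    = (\<Sum>((x', y', z'), (x, y, z))\<in>(X' \<times> Y' \<times> Z') \<times> (X \<times> Y \<times> Z). h x y z x' y' z')"
    (is "_ = ?r'")
proof -
  have t: "(\<Sum>x\<in>X. \<Sum>y\<in>Y. \<Sum>z\<in>Z. g x y z) = (\<Sum>(x, y, z)\<in>X \<times> Y \<times> Z. g x y z)" for g :: "_ \<Rightarrow> _ \<Rightarrow> _ \<Rightarrow> 'w"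
    by (simp add: sum.cartesian_product)
  have t': "(\<Sum>x\<in>X'. \<Sum>y\<in>Y'. \<Sum>z\<in>Z'. g x y z) = (\<Sum>(x, y, z)\<in>X' \<times> Y' \<times> Z'. g x y z)" for g :: "_ \<Rightarrow> _ \<Rightarrow> _ \<Rightarrow> 'w"
    by (simp add: sum.cartesian_product)
  show l: "?l = ?r" unfolding t t' by (simp add: sum.cartesian_product split_beta)
  have "?r = ?r'"
    by (rule sum.reindex_bij_witness[of _ prod.swap prod.swap]) auto
  with l show "?l = ?r'" by simp
qed

lemma sum6_triangle:
  fixes h :: "_ \<Rightarrow> nat \<Rightarrow> _ \<Rightarrow> _ \<Rightarrow> nat \<Rightarrow> _ \<Rightarrow> 'w::ab_group_add"
  assumes "vector_space sc"
  shows "(\<Sum>x'\<in>X'. \<Sum>p'\<le>l. \<Sum>z'\<in>Z'. \<Sum>x\<in>X. \<Sum>p\<le>l - p'. \<Sum>z\<in>Z. sc (g x p z x' p' z') (h x p z x' p' z'))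
    = (\<Sum>((x, p, z), (x', p', z'))\<in>(X \<times> {..l} \<times> Z) \<times> (X' \<times> {..l} \<times> Z').
        sc (if p + p' \<le> l then g x p z x' p' z' else 0) (h x p z x' p' z'))"
    (is "?l = ?r")
    and "(\<Sum>x'\<in>X'. \<Sum>p'\<le>l. \<Sum>z'\<in>Z'. \<Sum>x\<in>X. \<Sum>p\<le>l - p'. \<Sum>z\<in>Z. sc (g x p z x' p' z') (h x p z x' p' z'))
    = (\<Sum>((x', p', z'), (x, p, z))\<in>(X' \<times> {..l} \<times> Z') \<times> (X \<times> {..l} \<times> Z).
        sc (if p + p' \<le> l then g x p z x' p' z' else 0) (h x p z x' p' z'))"
    (is "_ = ?r'")
proof -
  interpret vector_space sc by fact
  have "?l = (\<Sum>x'\<in>X'. \<Sum>p'\<le>l. \<Sum>z'\<in>Z'. \<Sum>x\<in>X. \<Sum>p\<le>l. \<Sum>z\<in>Z.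
      sc (if p + p' \<le> l then g x p z x' p' z' else 0) (h x p z x' p' z'))"
  proof (rule sum.cong[OF refl], rule sum.cong[OF refl], rule sum.cong[OF refl], rule sum.cong[OF refl])
    fix x' p' z' x assume p': "p' \<in> {..l}"
    show "(\<Sum>p\<le>l - p'. \<Sum>z\<in>Z. sc (g x p z x' p' z') (h x p z x' p' z'))
      = (\<Sum>p\<le>l. \<Sum>z\<in>Z. sc (if p + p' \<le> l then g x p z x' p' z' else 0) (h x p z x' p' z'))"
    proof (rule sum.mono_neutral_cong_left, goal_cases)
      case 3
      show ?case
      proof
        fix p assume "p \<in> {..l} - {..l - p'}"
        then have "\<not> p + p' \<le> l" by auto
        then show "(\<Sum>z\<in>Z. sc (if p + p' \<le> l then g x p z x' p' z' else 0) (h x p z x' p' z')) = 0"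
          by simp
      qed
    next
      case (4 p)
      then have "p + p' \<le> l" using p' by auto
      then show ?case by simp
    qed auto
  qed
  then show "?l = ?r'" "?l = ?r" by (simp_all only: sum6_product(1)) (rule sum.reindex_bij_witness[of _ prod.swap prod.swap]; auto)
qed

lemma (in vector_space) sum_commutator:
  "(\<Sum>x\<in>D. scale (f x) (\<Sum>n\<in>N. scale (b n) (X n x - scale e (Y n x))))
    = (\<Sum>n\<in>N. scale (b n) ((\<Sum>x\<in>D. scale (f x) (X n x)) - scale e (\<Sum>x\<in>D. scale (f x) (Y n x))))"
proof -
  have "(\<Sum>x\<in>D. scale (f x) (\<Sum>n\<in>N. scale (b n) (X n x - scale e (Y n x))))
    = (\<Sum>x\<in>D. \<Sum>n\<in>N. scale (b n) (scale (f x) (X n x) - scale e (scale (f x) (Y n x))))"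
    by (simp add: scale_sum_right scale_right_diff_distrib mult_ac)
  also have "\<dots> = (\<Sum>n\<in>N. \<Sum>x\<in>D. scale (b n) (scale (f x) (X n x) - scale e (scale (f x) (Y n x))))"
    by (rule sum.swap)
  finally show ?thesis by (simp add: scale_sum_right scale_right_diff_distrib sum_subtractf)
qed

context twisted_setting begin

lemma commutator_relation:
  assumes ri: "field_relation i a b C A B" and rj: "field_relation j a b' C' A' B'"
    and i: "i \<in> gidx G" and j: "j \<in> gidx G" and a: "a \<in> aidx T"
    and comm: "\<And>c d m1 m2 v. comm_coeff sV M e (chain_vfield i c) (chain_vfield j d) m1 m2 v = 0"
  shows "\<exists>S. (\<Sum>((s, p, c), (s', p', c'))\<in>({..S} \<times> {..k} \<times> {..C}) \<times> ({..S} \<times> {..k'} \<times> {..C'}).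
      sW (A c s p * A' c' s' p') (comm_coeff sW M e (chain_phi i c) (chain_phi j c')
        (r + of_nat s, k - p) (r' + of_nat s', k' - p') (psi T a v (t - of_nat s - of_nat s', l)))) = 0"
proof -
  let ?Xi = "\<lambda>n s p c s' p' c'. chain_phi i c (chain_phi j c'
      (psi T a v (t - of_nat s - of_nat s', l)) (r' - of_nat n + of_nat s', k' - p')) (r + of_nat n + of_nat s, k - p)"
  let ?Xj = "\<lambda>n s' p' c' s p c. chain_phi j c' (chain_phi i c
      (psi T a v (t - of_nat s' - of_nat s, l)) (r + of_nat n + of_nat s, k - p)) (r' - of_nat n + of_nat s', k' - p')"
  let ?Yi = "\<lambda>n q p c q' p' c'. psi T a (chain_vfield i c (chain_vfield j c' v
        (r' - of_nat n + b' - of_nat q', k')) (r + of_nat n + b - of_nat q, k))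
        (t - b' + of_nat q' - b + of_nat q, l - p' - p)"
  let ?Yj = "\<lambda>n q' p' c' q p c. psi T a (chain_vfield j c' (chain_vfield i c v
        (r + of_nat n + b - of_nat q, k)) (r' - of_nat n + b' - of_nat q', k'))
        (t - b + of_nat q - b' + of_nat q', l - p - p')"
  let ?Li = "\<lambda>n S. \<Sum>s\<le>S. \<Sum>p\<le>k. \<Sum>c\<le>C. \<Sum>s'\<le>S. \<Sum>p'\<le>k'. \<Sum>c'\<le>C'. sW (A c s p * A' c' s' p') (?Xi n s p c s' p' c')"
  let ?Lj = "\<lambda>n S. \<Sum>s'\<le>S. \<Sum>p'\<le>k'. \<Sum>c'\<le>C'. \<Sum>s\<le>S. \<Sum>p\<le>k. \<Sum>c\<le>C. sW (A' c' s' p' * A c s p) (?Xj n s' p' c' s p c)"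
  let ?Ri = "\<lambda>n Q. \<Sum>q'\<le>Q. \<Sum>p'\<le>l. \<Sum>c'\<le>C'. \<Sum>q\<le>Q. \<Sum>p\<le>l - p'. \<Sum>c\<le>C. sW (B c q p * B' c' q' p') (?Yi n q p c q' p' c')"
  let ?Rj = "\<lambda>n Q. \<Sum>q\<le>Q. \<Sum>p\<le>l. \<Sum>c\<le>C. \<Sum>q'\<le>Q. \<Sum>p'\<le>l - p. \<Sum>c'\<le>C'. sW (B' c' q' p' * B c q p) (?Yj n q' p' c' q p c)"
  have "\<forall>\<^sub>F Q in sequentially. \<forall>\<^sub>F S in sequentially. ?Li n S = ?Ri n Q \<and> ?Lj n S = ?Rj n Q" for n
    using field_relation_twice[OF ri rj i j a, where k = k and k' = k' and t = t and l = l
        and r' = "r' - of_nat n" and r = "r + of_nat n" and v = v]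
      field_relation_twice[OF rj ri j i a, where k = k' and k' = k and t = t and l = l
        and r' = "r + of_nat n" and r = "r' - of_nat n" and v = v]
    by eventually_elim (rule eventually_conj)
  then have "\<forall>n\<in>{..M}. \<forall>\<^sub>F Q in sequentially. \<forall>\<^sub>F S in sequentially. ?Li n S = ?Ri n Q \<and> ?Lj n S = ?Rj n Q" by blast
  then have "\<forall>\<^sub>F Q in sequentially. \<forall>n\<in>{..M}. \<forall>\<^sub>F S in sequentially. ?Li n S = ?Ri n Q \<and> ?Lj n S = ?Rj n Q"
    by (intro eventually_ball_finite) auto
  from eventually_happens'[OF sequentially_bot this] obtain Q where
    "\<forall>n\<in>{..M}. \<forall>\<^sub>F S in sequentially. ?Li n S = ?Ri n Q \<and> ?Lj n S = ?Rj n Q" by blast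
  then have "\<forall>\<^sub>F S in sequentially. \<forall>n\<in>{..M}. ?Li n S = ?Ri n Q \<and> ?Lj n S = ?Rj n Q"
    by (intro eventually_ball_finite) auto
  from eventually_happens'[OF sequentially_bot this] obtain S where
    S: "\<forall>n\<in>{..M}. ?Li n S = ?Ri n Q \<and> ?Lj n S = ?Rj n Q" by blast
  let ?b = "\<lambda>n. (- 1) ^ n * of_nat (M choose n) :: complex"
  let ?D = "({..S} \<times> {..k} \<times> {..C}) \<times> ({..S} \<times> {..k'} \<times> {..C'})"
  let ?D' = "({..Q} \<times> {..l} \<times> {..C}) \<times> ({..Q} \<times> {..l} \<times> {..C'})"
  let ?fA = "\<lambda>((s, p, c), (s', p', c')). A c s p * A' c' s' p'"
  let ?fB = "\<lambda>((q, p, c), (q', p', c')). if p + p' \<le> l then B c q p * B' c' q' p' else 0"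
  have Li: "?Li n S = (\<Sum>x\<in>?D. sW (?fA x) (case x of ((s, p, c), (s', p', c')) \<Rightarrow> ?Xi n s p c s' p' c'))" for n
    unfolding sum6_product(1) by (rule sum.cong[OF refl]) (auto simp: mult.commute add.commute)
  have Lj: "?Lj n S = (\<Sum>x\<in>?D. sW (?fA x) (case x of ((s, p, c), (s', p', c')) \<Rightarrow> ?Xj n s' p' c' s p c))" for n
    unfolding sum6_product(2) by (rule sum.cong[OF refl]) (auto simp: mult.commute add.commute)
  have Ri: "?Ri n Q = (\<Sum>x\<in>?D'. sW (?fB x) (case x of ((q, p, c), (q', p', c')) \<Rightarrow> ?Yi n q p c q' p' c'))" for n
    unfolding sum6_triangle(1)[OF ws] by (rule sum.cong[OF refl]) (auto simp: mult.commute add.commute)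
  have Rj: "?Rj n Q = (\<Sum>x\<in>?D'. sW (?fB x) (case x of ((q, p, c), (q', p', c')) \<Rightarrow> ?Yj n q' p' c' q p c))" for n
    unfolding sum6_triangle(2)[OF ws] by (rule sum.cong[OF refl]) (auto simp: mult.commute add.commute)
  have "(\<Sum>((s, p, c), (s', p', c'))\<in>?D.
      sW (A c s p * A' c' s' p') (comm_coeff sW M e (chain_phi i c) (chain_phi j c')
        (r + of_nat s, k - p) (r' + of_nat s', k' - p') (psi T a v (t - of_nat s - of_nat s', l))))
     = (\<Sum>x\<in>?D. sW (?fA x) (\<Sum>n\<le>M. sW (?b n)
        ((case x of ((s, p, c), (s', p', c')) \<Rightarrow> ?Xi n s p c s' p' c')
         - sW e (case x of ((s, p, c), (s', p', c')) \<Rightarrow> ?Xj n s' p' c' s p c))))"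
    by (intro sum.cong refl) (simp add: comm_coeff_def split_beta algebra_simps)
  also have "\<dots> = (\<Sum>n\<le>M. sW (?b n) (?Li n S - sW e (?Lj n S)))"
    unfolding W.sum_commutator Li Lj ..
  also have "\<dots> = (\<Sum>n\<le>M. sW (?b n) (?Ri n Q - sW e (?Rj n Q)))"
    using S by (intro sum.cong refl) simp
  also have "\<dots> = (\<Sum>x\<in>?D'. sW (?fB x) (\<Sum>n\<le>M. sW (?b n)
        ((case x of ((q, p, c), (q', p', c')) \<Rightarrow> ?Yi n q p c q' p' c')
         - sW e (case x of ((q, p, c), (q', p', c')) \<Rightarrow> ?Yj n q' p' c' q p c))))"
    unfolding W.sum_commutator Ri Rj ..
  also have "\<dots> = 0"
  proof (rule sum.neutral, rule ballI)
    fix x assume "x \<in> ?D'"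
    obtain q p c q' p' c' where x: "x = ((q, p, c), (q', p', c'))" by (metis prod_cases3 surj_pair)
    note pl = linear_rules[OF psi_linear[OF a]]
    have "(\<Sum>n\<le>M. sW (?b n) (?Yi n q p c q' p' c' - sW e (?Yj n q' p' c' q p c)))
      = psi T a (comm_coeff sV M e (chain_vfield i c) (chain_vfield j c')
          (r + b - of_nat q, k) (r' + b' - of_nat q', k') v) (t - b' + of_nat q' - b + of_nat q, l - p' - p)"
      by (simp add: comm_coeff_def pl algebra_simps)
    then show "sW (?fB x) (\<Sum>n\<le>M. sW (?b n)
        ((case x of ((q, p, c), (q', p', c')) \<Rightarrow> ?Yi n q p c q' p' c')
         - sW e (case x of ((q, p, c), (q', p', c')) \<Rightarrow> ?Yj n q' p' c' q p c))) = 0"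
      by (simp only: x prod.case comm pl W.scale_zero_right)
  qed
  finally show ?thesis by blast
qed

lemma chain_phi_add: "Nidx_iter G i c = Some i' \<Longrightarrow> chain_phi i' d = chain_phi i (c + d)"
  by (simp add: chain_phi_def Nidx_iter_add)

lemma chain_vfield_add:
  assumes "i \<in> gidx G" "Nidx_iter G i c = Some i'"
  shows "chain_vfield i' d = chain_vfield i (c + d)"
proof -
  have "(NV ^^ d) (gvec G i') = (NV ^^ (d + c)) (gvec G i)"
    using Nidx_iter_gvec[OF assms] unfolding funpow_add comp_apply by simp
  then show ?thesis by (simp add: chain_vfield_def add.commute)
qed

lemma comm_coeff_psi:
  assumes i: "i \<in> gidx G" and j: "j \<in> gidx G" and a: "a \<in> aidx T"
    and comm: "\<And>c d m1 m2 v. comm_coeff sV M e (chain_vfield i c) (chain_vfield j d) m1 m2 v = 0"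
    and R: "\<And>m. Re (fst m) < R \<Longrightarrow> psi T a v m = 0"
  shows "Re t - R + real k + real k' < real n \<Longrightarrow>
    comm_coeff sW M e (chain_phi i c) (chain_phi j d) (r, k) (r', k') (psi T a v (t, l)) = 0"
proof (induction n arbitrary: c d r k r' k' t l)
  case 0
  then have "psi T a v (t, l) = 0" using R[of "(t, l)"] by simp
  then show ?case
    using comm_coeff_linear(3)[OF ws chain_phi_linear[OF i] chain_phi_linear[OF j]] by simp
next
  case (Suc n)
  show ?case
  proof (cases "Nidx_iter G i c = None \<or> Nidx_iter G j d = None")
    case True
    then show ?thesis
      using linear_rules(1)[OF chain_phi_linear[OF i]] linear_rules(1)[OF chain_phi_linear[OF j]]
      by (auto simp: comm_coeff_def chain_phi_def opt_field_def)
  next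
    case False
    then obtain i' j' where i': "Nidx_iter G i c = Some i'" and j': "Nidx_iter G j d = Some j'" by auto
    have i'G: "i' \<in> gidx G" and j'G: "j' \<in> gidx G"
      using Nidx_iter_gvec[OF i i'] Nidx_iter_gvec[OF j j'] by auto
    obtain b C A B where ri: "field_relation i' a b C A B" and A: "A 0 0 0 = 1" "\<And>c. c > 0 \<Longrightarrow> A c 0 0 = 0"
      using field_relation_exists[OF i'G a] by blast
    obtain b' C' A' B' where rj: "field_relation j' a b' C' A' B'" and A': "A' 0 0 0 = 1" "\<And>c. c > 0 \<Longrightarrow> A' c 0 0 = 0"
      using field_relation_exists[OF j'G a] by blast
    have comm': "comm_coeff sV M e (chain_vfield i' c') (chain_vfield j' d') m1 m2 v = 0" for c' d' m1 m2 v
      unfolding chain_vfield_add[OF i i'] chain_vfield_add[OF j j'] by (rule comm)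
    let ?f = "\<lambda>((s, p, c'), (s', p', d')). sW (A c' s p * A' d' s' p')
        (comm_coeff sW M e (chain_phi i' c') (chain_phi j' d')
        (r + of_nat s, k - p) (r' + of_nat s', k' - p') (psi T a v (t - of_nat s - of_nat s', l)))"
    obtain S where S: "(\<Sum>x\<in>({..S} \<times> {..k} \<times> {..C}) \<times> ({..S} \<times> {..k'} \<times> {..C'}). ?f x) = 0"
      using commutator_relation[OF ri rj i'G j'G a comm', where k = k and k' = k' and r = r and r' = r'
          and v = v and t = t and l = l] by blast
    then have tot: "sum ?f (({..S} \<times> {..k} \<times> {..C}) \<times> ({..S} \<times> {..k'} \<times> {..C'})) \<in> {0}" by blast
    have "?f ((0, 0, 0), (0, 0, 0)) \<in> {0}"
    proof (rule W.subspace_sum_isolate[OF W.subspace_single_0 _ _ tot])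
      fix x assume x: "x \<in> ({..S} \<times> {..k} \<times> {..C}) \<times> ({..S} \<times> {..k'} \<times> {..C'})"
        "x \<noteq> ((0, 0, 0), (0, 0, 0))"
      obtain s p c' s' p' d' where x': "x = ((s, p, c'), (s', p', d'))" by (metis prod_cases3 surj_pair)
      show "?f x \<in> {0}"
      proof (cases "s = 0 \<and> p = 0 \<and> s' = 0 \<and> p' = 0")
        case True
        then have "A c' s p * A' d' s' p' = 0" using x x' A(2) A'(2) by auto
        then show ?thesis by (simp add: x')
      next
        case False
        have "real (k - p) = real k - real p" "real (k' - p') = real k' - real p'"
          using x x' by (auto simp: of_nat_diff)
        moreover have "real s + real s' + real p + real p' \<ge> 1" using False by linarith
        ultimately have "Re (t - of_nat s - of_nat s') - R + real (k - p) + real (k' - p') < real n"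
          using Suc.prems by simp
        then have "comm_coeff sW M e (chain_phi i' c') (chain_phi j' d')
          (r + of_nat s, k - p) (r' + of_nat s', k' - p') (psi T a v (t - of_nat s - of_nat s', l)) = 0"
          unfolding chain_phi_add[OF i'] chain_phi_add[OF j'] by (rule Suc.IH)
        then show ?thesis by (simp add: x')
      qed
    qed auto
    then show ?thesis by (simp add: A(1) A'(1) chain_phi_add[OF i'] chain_phi_add[OF j'])
  qed
qed

lemma comm_coeff_zero:
  assumes i: "i \<in> gidx G" and j: "j \<in> gidx G"
    and comm: "\<And>c d m1 m2 v. comm_coeff sV M e (chain_vfield i c) (chain_vfield j d) m1 m2 v = 0"
  shows "comm_coeff sW M e (phi T i) (phi T j) m1 m2 w = 0"
proof -
  have phi: "chain_phi i 0 = phi T i" "chain_phi j 0 = phi T j" by (simp_all add: chain_phi_def opt_field_def)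
  note lin = comm_coeff_linear[OF ws phi_linear[OF i] phi_linear[OF j]]
  have "W.subspace {w. comm_coeff sW M e (phi T i) (phi T j) m1 m2 w = 0}"
    by (rule W.subspaceI) (simp_all add: lin)
  moreover have "{psi T a v m | a v m. a \<in> aidx T} \<subseteq> {w. comm_coeff sW M e (phi T i) (phi T j) m1 m2 w = 0}"
  proof clarify
    fix a v t l assume a: "a \<in> aidx T"
    obtain R where R: "\<And>m. Re (fst m) < R \<Longrightarrow> psi T a v m = 0" using psi_truncated[OF a] by blast
    obtain r k r' k' where m: "m1 = (r, k)" "m2 = (r', k')" by (cases m1, cases m2)
    obtain n where n: "Re t - R + real k + real k' < real n" using reals_Archimedean2 by blast
    show "comm_coeff sW M e (phi T i) (phi T j) m1 m2 (psi T a v (t, l)) = 0"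
      using comm_coeff_psi[OF i j a comm R n, of 0 0 r r' l] unfolding phi m .
  qed
  ultimately have "psi_span \<subseteq> {w. comm_coeff sW M e (phi T i) (phi T j) m1 m2 w = 0}"
    unfolding psi_span_def by (intro W.span_minimal)
  then show ?thesis unfolding psi_span_UNIV by blast
qed

end

lemma op_comp_in_x1_in_x2:
  assumes "\<And>m. F 0 m = 0"
  shows "(in_x1 F \<odot> in_x2 H) w ((r, k), m) = F (H w m) (r, k)"
proof -
  obtain t l where m: "m = (t, l)" by (cases m)
  have "(in_x1 F \<odot> in_x2 H) w ((r, k), (t, l))
    = (\<Sum>s\<le>0. \<Sum>j\<le>k. F (in_x2 H w ((- of_nat s, j), (t, l))) (r + of_nat s, k - j))"
  proof (rule op_comp_in_x1[where F = F and S = 0, OF assms])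
    fix q assume "in_x2 H w (q, (t, l)) \<noteq> 0"
    then show "\<exists>s\<le>0. \<exists>j. q = (- of_nat s, j)" by (cases q) (auto simp: in_x2_shift_eq split: if_splits)
  qed
  also have "\<dots> = (\<Sum>j\<le>k. if j = 0 then F (H w (t, l)) (r, k) else 0)"
    by (simp add: in_x2_shift_eq assms if_distrib[where f = "\<lambda>x. F x _"] cong: if_cong)
  finally show ?thesis by (simp add: m)
qed

lemma op_comp_in_x2_in_x1:
  assumes "\<And>m. H 0 m = 0"
  shows "(in_x2 H \<odot> in_x1 F) w (m, (t, l)) = H (F w m) (t, l)"
  using op_comp_swap[of "in_x2 H" "in_x1 F" w "((t, l), m)"] op_comp_in_x1_in_x2[where F = H and H = F, OF assms]
  by (simp add: in_x_swap[of _ _ "(_, _)", simplified] in_x_swap)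

lemma op_comp_pow_of_nat:
  fixes B :: "'v \<Rightarrow> mono2 \<Rightarrow> 'w::ab_group_add"
  assumes "vector_space sc"
  shows "(scalar_ser sc (pow_x1_x2 (of_nat M)) \<odot> B) v ((r + of_nat M, k), (t, l))
    = (\<Sum>s\<le>M. sc ((- 1) ^ s * of_nat (M choose s)) (B v ((r + of_nat s, k), (t - of_nat s, l))))"
proof -
  interpret vector_space sc by fact
  have g: "(of_nat M gchoose s :: complex) = of_nat (M choose s)" for s by (simp add: binomial_gbinomial)
  have "(scalar_ser sc (pow_x1_x2 (of_nat M)) \<odot> B) v ((r + of_nat M, k), (t, l))
    = (\<Sum>s\<le>M. \<Sum>j\<le>k. sc (coeff2 (binom_series (of_nat M)) s j)
        (B v ((r + of_nat M - of_nat M + of_nat s, k - j), (t - of_nat s, l))))"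
    by (rule op_comp_cone)
      (auto simp: scalar_ser_def pow_x1_x2_shifted_cone coeff2_binom_series g binomial_eq_0 intro: pow_x1_x2_nonzero)
  also have "\<dots> = (\<Sum>s\<le>M. \<Sum>j\<le>k. if j = 0 then sc ((- 1) ^ s * of_nat (M choose s)) (B v ((r + of_nat s, k), (t - of_nat s, l))) else 0)"
    by (intro sum.cong refl) (simp add: coeff2_binom_series g)
  finally show ?thesis by simp
qed

theorem theorem5p1:
  fixes V :: "('v::ab_group_add) vertex_superalgebra"
    and g :: "'v g_action"
    and G :: "('i, 'v) gen_fields"
    and T :: "('i, 'a, 'v, 'w::ab_group_add) twisted_fields"
    and i j :: 'i
  assumes "grading_restricted_vertex_superalgebra V"
    and "automorphism_with_log V g"
    and "generating_fields V g G"
    and "twisted_field_data V g G T"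
    and "L0_property V G T"
    and "Lm1_property V G T"
    and "creation_property V T"
    and "spanning_property G T"
    and "g_action_property V g G T"
    and "generalized_weak_commutativity V g G T"
    and "i \<in> gidx G" and "j \<in> gidx G"
  shows "\<exists>M::nat. 0 < M \<and>
    scalar_ser (wscale T) (pow_x1_x2 (of_nat M)) \<odot> in_x1 (phi T i) \<odot> in_x2 (phi T j)
    = scalar_ser (wscale T) (pow_x1_x2 (of_nat M))
        \<odot> op_scale (wscale T) (koszul (gpar G i) (gpar G j)) (in_x2 (phi T j) \<odot> in_x1 (phi T i))"
proof -
  interpret twisted_setting V g G T by unfold_locales (use assms in auto)
  note ij = \<open>i \<in> gidx G\<close> \<open>j \<in> gidx G\<close>
  let ?e = "koszul (gpar G i) (gpar G j)"
  obtain M where M: "M > 0" and comm: "\<And>c d m1 m2 v.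
      comm_coeff sV M ?e (chain_vfield i c) (chain_vfield j d) m1 m2 v = 0"
    using chain_vfield_weak_commutativity[OF ij] by blast
  note zero = linear_rules(1)[OF phi_linear[OF ij(1)]] linear_rules(1)[OF phi_linear[OF ij(2)]]
  have "(scalar_ser sW (pow_x1_x2 (of_nat M)) \<odot> in_x1 (phi T i) \<odot> in_x2 (phi T j)) w ((r + of_nat M, k), (t, l))
    = (scalar_ser sW (pow_x1_x2 (of_nat M)) \<odot> op_scale sW ?e (in_x2 (phi T j) \<odot> in_x1 (phi T i))) w ((r + of_nat M, k), (t, l))"
    for w r k t l
    using comm_coeff_zero[OF ij comm, of "(r, k)" "(t, l)" w]
    unfolding op_comp_pow_of_nat[OF ws] op_scale_def op_comp_in_x1_in_x2[where F = "phi T i", OF zero(1)]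
      op_comp_in_x2_in_x1[where H = "phi T j", OF zero(2)]
    by (simp add: comm_coeff_def W.scale_right_diff_distrib sum_subtractf)
  from this[of _ "r - of_nat M" for r] show ?thesis
    using M by (intro exI[of _ M] conjI ext) auto
qed

end
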